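(* In the deconvolution setting of the context, suppose that the source condition $(\varphi,T)\in\mathcal F(0,\beta,C)$ and Assumption D hold, and that $\alpha_n^{3/2+\beta\wedge1}n^{1/2}\to0$. Then for any $\gamma\in(0,1)$, $$\inf_{(\varphi,T)\in\mathcal F}\Pr\left(\varphi\in C^{2,\mathrm{ci}}_{1-\gamma,n}\right)\ge1-\gamma-o(1),\qquad \inf_{(\varphi,T)\in\mathcal F}\Pr\left(\varphi\in C^{2,\mathrm g}_{1-\gamma,n}\right)\ge1-\gamma-O(n^{-1/6})-o(1).$$
   Context: Deconvolution model: $Y=Z+U$, $Z,U$ independent real random variables; $Z$ has density $\varphi$, $U$ has known density $f$, $Y$ has density $r$. On $L_2[a,b]$: $(T\varphi)(y)=\int\varphi(z)f(y-z)dz$, $(T^*\psi)(z)=\int\psi(y)f(y-z)dy$, $r=T\varphi$. From an i.i.d. sample $(Y_i)_{i=1}^n$: $\widehat{T^*r}(z)=\frac1n\sum_if(Y_i-z)$, $\hat\varphi_{\alpha_n}=(\alpha_nI+T^*T)^{-1}\widehat{T^*r}$, $\alpha_n>0$, $\alpha_n\to0$. $\|\cdot\|$: $L_2$ norm; $\|\cdot\|_\infty$: sup norm; $\|A\|_{2,\infty}=\sup_{\|\psi\|\le1}\|A\psi\|_\infty$. Source class $\mathcal F(0,\beta,C)$: pairs $(\varphi,T)$ with $\varphi$ continuous on $[a,b]$, $\|\varphi\|_\infty\le M$, $T^*$ bounded from $L_2[a,b]$ into continuous functions, $\varphi=(T^*T)^\beta T^*\psi$ with $\psi\in L_2[a,b]$,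 $\|T^*\|_{2,\infty}\vee\|\psi\|\vee\|T\|^{-1}\le C$. Assumption D: (i) i.i.d. sample of $Y$; (ii) $f,\varphi,r$ continuous and compactly supported in subsets of $[a,b]$; (iii) $f\in C^s_M[a,b]$, $s\in(0,1]$ ($\|f\|_\infty\le M$, $|f(x)-f(x')|\le M|x-x'|^s$); (iv) $T$ one-to-one. Confidence sets: $C^{2,s}_{1-\gamma,n}(z)=[\hat\varphi_{\alpha_n}(z)-q^{2,s},\hat\varphi_{\alpha_n}(z)+q^{2,s}]$, $z\in[a,b]$, with $q^{2,\mathrm{ci}}=2\|\nu^\varepsilon_{2,n}\|_\infty+\frac{3\|f\|_\infty(\|T^*\|_{2,\infty}/2+\alpha_n^{1/2})\sqrt{2\log(2/\gamma)}}{\alpha_n^{3/2}n^{1/2}}$, where $\nu^\varepsilon_{2,n}=\frac1n\sum_i(\alpha_nI+T^*T)^{-1}\varepsilon_if(Y_i-\cdot)$ with i.i.d. Rademacher $\varepsilon_i$ independent of the data; and $q^{2,\mathrm g}=c_{2,1-\gamma}\frac{\|T^*\|_{2,\infty}/2+\alpha_n^{1/2}}{\alpha_n^{3/2}n^{1/2}}$, with $c_{2,1-\gamma}$ the $(1-\gamma)$-quantile of $\|\mathbb G_2\|_\infty$ for a centered Gaussian process $\mathbb G_2$ on $[a,b]$ with covariance $(s,t)\mapsto\mathbb E[f(Y-s)f(Y-t)]$. "$\varphi\in C$" means $\varphi(z)\in C(z)$ for all $z$. *)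

theory Defs
  imports "HOL-Probability.Probability"
begin

section \<open>The Hilbert space L2[a,b] (functions real => real, only values on [a,b] matter)\<close>

definition L2fun :: "real \<Rightarrow> real \<Rightarrow> (real \<Rightarrow> real) \<Rightarrow> bool" where
  "L2fun a b g \<longleftrightarrow> g \<in> borel_measurable lborel \<and> set_integrable lborel {a..b} (\<lambda>x. (g x)\<^sup>2)"

definition L2inner :: "real \<Rightarrow> real \<Rightarrow> (real \<Rightarrow> real) \<Rightarrow> (real \<Rightarrow> real) \<Rightarrow> real" where
  "L2inner a b g h = (LINT x:{a..b}|lborel. g x * h x)"

definition L2norm :: "real \<Rightarrow> real \<Rightarrow> (real \<Rightarrow> real) \<Rightarrow> real" where
  "L2norm a b g = sqrt (LINT x:{a..b}|lborel. (g x)\<^sup>2)"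

definition supnorm :: "real \<Rightarrow> real \<Rightarrow> (real \<Rightarrow> real) \<Rightarrow> real" where
  "supnorm a b g = (SUP z\<in>{a..b}. \<bar>g z\<bar>)"

definition Top :: "real \<Rightarrow> real \<Rightarrow> (real \<Rightarrow> real) \<Rightarrow> (real \<Rightarrow> real) \<Rightarrow> (real \<Rightarrow> real)" where
  "Top a b f \<phi> = (\<lambda>y. LINT z:{a..b}|lborel. \<phi> z * f (y - z))"

definition Tadj :: "real \<Rightarrow> real \<Rightarrow> (real \<Rightarrow> real) \<Rightarrow> (real \<Rightarrow> real) \<Rightarrow> (real \<Rightarrow> real)" where
  "Tadj a b f \<psi> = (\<lambda>z. LINT y:{a..b}|lborel. \<psi> y * f (y - z))"

definition TadjT :: "real \<Rightarrow> real \<Rightarrow> (real \<Rightarrow> real) \<Rightarrow> (real \<Rightarrow> real) \<Rightarrow> (real \<Rightarrow> real)" where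
  "TadjT a b f g = Tadj a b f (Top a b f g)"

text \<open>(alpha I + T*T)^(-1) h, applied to a (measurable, bounded) function h: the unique
  L2[a,b] function g (normalised to vanish outside [a,b]) with alpha g + T*T g = h on [a,b].\<close>
definition resolvent :: "real \<Rightarrow> real \<Rightarrow> (real \<Rightarrow> real) \<Rightarrow> real \<Rightarrow> (real \<Rightarrow> real) \<Rightarrow> (real \<Rightarrow> real)" where
  "resolvent a b f \<alpha> h = (THE g. L2fun a b g \<and> (\<forall>z. z \<notin> {a..b} \<longrightarrow> g z = 0)
      \<and> (\<forall>z\<in>{a..b}. \<alpha> * g z + TadjT a b f g z = h z))"

definition Tadj_norm_2inf :: "real \<Rightarrow> real \<Rightarrow> (real \<Rightarrow> real) \<Rightarrow> real" where
  "Tadj_norm_2inf a b f =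
     (SUP \<psi>\<in>{\<psi>. L2fun a b \<psi> \<and> L2norm a b \<psi> \<le> 1}. supnorm a b (Tadj a b f \<psi>))"

definition T_norm :: "real \<Rightarrow> real \<Rightarrow> (real \<Rightarrow> real) \<Rightarrow> real" where
  "T_norm a b f = (SUP \<psi>\<in>{\<psi>. L2fun a b \<psi> \<and> L2norm a b \<psi> \<le> 1}. L2norm a b (Top a b f \<psi>))"

definition T_injective :: "real \<Rightarrow> real \<Rightarrow> (real \<Rightarrow> real) \<Rightarrow> bool" where
  "T_injective a b f \<longleftrightarrow>
     (\<forall>g. L2fun a b g \<and> L2norm a b (Top a b f g) = 0 \<longrightarrow> L2norm a b g = 0)"

definition spectral_system :: "real \<Rightarrow> real \<Rightarrow> (real \<Rightarrow> real) \<Rightarrow> (nat \<Rightarrow> real) \<Rightarrow> (nat \<Rightarrow> real \<Rightarrow> real) \<Rightarrow> bool" where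
  "spectral_system a b f lam e \<longleftrightarrow>
     (\<forall>j. L2fun a b (e j)) \<and>
     (\<forall>i j. L2inner a b (e i) (e j) = (if i = j then 1 else 0)) \<and>
     (\<forall>j. lam j > 0) \<and>
     (\<forall>h. L2fun a b h \<longrightarrow>
        (\<lambda>N. L2norm a b (\<lambda>z. TadjT a b f h z - (\<Sum>j<N. lam j * L2inner a b h (e j) * e j z)))
          \<longlonglongrightarrow> 0)"

text \<open>phi = (T*T)^beta T* psi  (equality in L2[a,b])\<close>
definition source_condition :: "real \<Rightarrow> real \<Rightarrow> (real \<Rightarrow> real) \<Rightarrow> real \<Rightarrow> (real \<Rightarrow> real) \<Rightarrow> (real \<Rightarrow> real) \<Rightarrow> bool" where
  "source_condition a b f \<beta> \<phi> \<psi> \<longleftrightarrow>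
     (\<exists>lam e. spectral_system a b f lam e \<and>
        (\<lambda>N. L2norm a b (\<lambda>z. \<phi> z -
            (\<Sum>j<N. lam j powr \<beta> * L2inner a b (Tadj a b f \<psi>) (e j) * e j z))) \<longlonglongrightarrow> 0)"

definition in_class :: "real \<Rightarrow> real \<Rightarrow> real \<Rightarrow> real \<Rightarrow> real \<Rightarrow> real \<Rightarrow> (real \<Rightarrow> real) \<Rightarrow> (real \<Rightarrow> real) \<Rightarrow> bool" where
  "in_class a b M s \<beta> C \<phi> f \<longleftrightarrow>
     \<comment> \<open>phi and f are probability densities\<close>
     (\<forall>x. \<phi> x \<ge> 0) \<and> \<phi> \<in> borel_measurable lborel \<and> integral\<^sup>L lborel \<phi> = 1 \<and>
     (\<forall>x. f x \<ge> 0) \<and> f \<in> borel_measurable lborel \<and> integral\<^sup>L lborel f = 1 \<and>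
     \<comment> \<open>Assumption D(ii): f, phi, r = T phi continuous, supported in [a,b]\<close>
     continuous_on {a..b} f \<and> continuous_on {a..b} \<phi> \<and> continuous_on {a..b} (Top a b f \<phi>) \<and>
     (\<forall>x. x \<notin> {a..b} \<longrightarrow> f x = 0 \<and> \<phi> x = 0 \<and> Top a b f \<phi> x = 0) \<and>
     \<comment> \<open>Assumption D(iii): f in C^s_M[a,b]\<close>
     (\<forall>x\<in>{a..b}. \<bar>f x\<bar> \<le> M) \<and>
     (\<forall>x\<in>{a..b}. \<forall>x'\<in>{a..b}. \<bar>f x - f x'\<bar> \<le> M * \<bar>x - x'\<bar> powr s) \<and>
     \<comment> \<open>Assumption D(iv): T one-to-one\<close>
     T_injective a b f \<and>
     \<comment> \<open>source class F(0,beta,C)\<close>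
     (\<forall>x\<in>{a..b}. \<bar>\<phi> x\<bar> \<le> M) \<and>
     (\<forall>\<psi>. L2fun a b \<psi> \<longrightarrow> continuous_on {a..b} (Tadj a b f \<psi>)) \<and>
     bdd_above ((\<lambda>\<psi>. supnorm a b (Tadj a b f \<psi>)) ` {\<psi>. L2fun a b \<psi> \<and> L2norm a b \<psi> \<le> 1}) \<and>
     Tadj_norm_2inf a b f \<le> C \<and>
     (\<exists>\<psi>. L2fun a b \<psi> \<and> L2norm a b \<psi> \<le> C \<and> source_condition a b f \<beta> \<phi> \<psi>) \<and>
     T_norm a b f > 0 \<and> 1 / T_norm a b f \<le> C"

definition Ymeasure :: "real \<Rightarrow> real \<Rightarrow> (real \<Rightarrow> real) \<Rightarrow> (real \<Rightarrow> real) \<Rightarrow> real measure" where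
  "Ymeasure a b f \<phi> = density lborel (\<lambda>y. ennreal (Top a b f \<phi> y))"

definition rademacher :: "real measure" where
  "rademacher = measure_pmf (pmf_of_set {-1, 1})"

definition sample_space :: "real \<Rightarrow> real \<Rightarrow> (real \<Rightarrow> real) \<Rightarrow> (real \<Rightarrow> real) \<Rightarrow> nat \<Rightarrow> ((nat \<Rightarrow> real) \<times> (nat \<Rightarrow> real)) measure" where
  "sample_space a b f \<phi> n =
     (\<Pi>\<^sub>M i\<in>{..<n}. Ymeasure a b f \<phi>) \<Otimes>\<^sub>M (\<Pi>\<^sub>M i\<in>{..<n}. rademacher)"

definition sample_Y :: "real \<Rightarrow> real \<Rightarrow> (real \<Rightarrow> real) \<Rightarrow> (real \<Rightarrow> real) \<Rightarrow> nat \<Rightarrow> (nat \<Rightarrow> real) measure" where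
  "sample_Y a b f \<phi> n = (\<Pi>\<^sub>M i\<in>{..<n}. Ymeasure a b f \<phi>)"

definition phihat :: "real \<Rightarrow> real \<Rightarrow> (real \<Rightarrow> real) \<Rightarrow> real \<Rightarrow> nat \<Rightarrow> (nat \<Rightarrow> real) \<Rightarrow> (real \<Rightarrow> real)" where
  "phihat a b f \<alpha> n Y = resolvent a b f \<alpha> (\<lambda>z. (\<Sum>i<n. f (Y i - z)) / real n)"

definition nu_eps :: "real \<Rightarrow> real \<Rightarrow> (real \<Rightarrow> real) \<Rightarrow> real \<Rightarrow> nat \<Rightarrow> (nat \<Rightarrow> real) \<Rightarrow> (nat \<Rightarrow> real) \<Rightarrow> (real \<Rightarrow> real)" where
  "nu_eps a b f \<alpha> n Y \<epsilon> = resolvent a b f \<alpha> (\<lambda>z. (\<Sum>i<n. \<epsilon> i * f (Y i - z)) / real n)"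

definition q_ci :: "real \<Rightarrow> real \<Rightarrow> (real \<Rightarrow> real) \<Rightarrow> real \<Rightarrow> real \<Rightarrow> nat \<Rightarrow> (nat \<Rightarrow> real) \<Rightarrow> (nat \<Rightarrow> real) \<Rightarrow> real" where
  "q_ci a b f \<alpha> \<gamma> n Y \<epsilon> =
     2 * supnorm a b (nu_eps a b f \<alpha> n Y \<epsilon>) +
     3 * (SUP x. \<bar>f x\<bar>) * (Tadj_norm_2inf a b f / 2 + sqrt \<alpha>) * sqrt (2 * ln (2 / \<gamma>))
       / (\<alpha> powr (3/2) * sqrt (real n))"

text \<open>covariance E[f(Y-s) f(Y-t)] of the limiting Gaussian process\<close>
definition cov_G2 :: "real \<Rightarrow> real \<Rightarrow> (real \<Rightarrow> real) \<Rightarrow> (real \<Rightarrow> real) \<Rightarrow> real \<Rightarrow> real \<Rightarrow> real" where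
  "cov_G2 a b f \<phi> s t = (LINT y|lborel. Top a b f \<phi> y * f (y - s) * f (y - t))"

definition centered_gp :: "real \<Rightarrow> real \<Rightarrow> (real \<Rightarrow> real \<Rightarrow> real) \<Rightarrow> 'w measure \<Rightarrow> (real \<Rightarrow> 'w \<Rightarrow> real) \<Rightarrow> bool" where
  "centered_gp a b K M G \<longleftrightarrow>
     prob_space M \<and> (\<forall>t\<in>{a..b}. G t \<in> borel_measurable M) \<and>
     (\<forall>\<omega>\<in>space M. continuous_on {a..b} (\<lambda>t. G t \<omega>)) \<and>
     (\<forall>(I::nat set) (t::nat \<Rightarrow> real) (c::nat \<Rightarrow> real). finite I \<longrightarrow> (\<forall>i\<in>I. t i \<in> {a..b}) \<longrightarrow>
        distr M borel (\<lambda>\<omega>. \<Sum>i\<in>I. c i * G (t i) \<omega>) =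
          (let v = (\<Sum>i\<in>I. \<Sum>j\<in>I. c i * c j * K (t i) (t j)) in
           if v = 0 then return borel 0
           else density lborel (\<lambda>x. ennreal (normal_density 0 (sqrt v) x))))"

text \<open>(1-gamma)-quantile of sup_{[a,b]} |G2| (depends only on the law of the process)\<close>
definition gauss_sup_quantile :: "real \<Rightarrow> real \<Rightarrow> (real \<Rightarrow> real \<Rightarrow> real) \<Rightarrow> real \<Rightarrow> real" where
  "gauss_sup_quantile a b K \<gamma> =
     (THE c. \<forall>(M::(nat \<Rightarrow> real) measure) G. centered_gp a b K M G \<longrightarrow>
        c = Inf {x. measure M {\<omega>\<in>space M. (SUP t\<in>{a..b}. \<bar>G t \<omega>\<bar>) \<le> x} \<ge> 1 - \<gamma>})"

definition q_g :: "real \<Rightarrow> real \<Rightarrow> (real \<Rightarrow> real) \<Rightarrow> (real \<Rightarrow> real) \<Rightarrow> real \<Rightarrow> real \<Rightarrow> nat \<Rightarrow> real" where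
  "q_g a b f \<phi> \<alpha> \<gamma> n =
     gauss_sup_quantile a b (cov_G2 a b f \<phi>) \<gamma> * (Tadj_norm_2inf a b f / 2 + sqrt \<alpha>)
       / (\<alpha> powr (3/2) * sqrt (real n))"

definition in_band :: "real \<Rightarrow> real \<Rightarrow> (real \<Rightarrow> real) \<Rightarrow> (real \<Rightarrow> real) \<Rightarrow> real \<Rightarrow> bool" where
  "in_band a b \<phi> c q \<longleftrightarrow> (\<forall>z\<in>{a..b}. c z - q \<le> \<phi> z \<and> \<phi> z \<le> c z + q)"

definition coverage_ci :: "real \<Rightarrow> real \<Rightarrow> (real \<Rightarrow> real) \<Rightarrow> (real \<Rightarrow> real) \<Rightarrow> real \<Rightarrow> real \<Rightarrow> nat \<Rightarrow> real" where
  "coverage_ci a b f \<phi> \<alpha> \<gamma> n =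
     measure (sample_space a b f \<phi> n)
       {(Y, \<epsilon>) \<in> space (sample_space a b f \<phi> n).
          in_band a b \<phi> (phihat a b f \<alpha> n Y) (q_ci a b f \<alpha> \<gamma> n Y \<epsilon>)}"

definition coverage_g :: "real \<Rightarrow> real \<Rightarrow> (real \<Rightarrow> real) \<Rightarrow> (real \<Rightarrow> real) \<Rightarrow> real \<Rightarrow> real \<Rightarrow> nat \<Rightarrow> real" where
  "coverage_g a b f \<phi> \<alpha> \<gamma> n =
     measure (sample_Y a b f \<phi> n)
       {Y \<in> space (sample_Y a b f \<phi> n).
          in_band a b \<phi> (phihat a b f \<alpha> n Y) (q_g a b f \<phi> \<alpha> \<gamma> n)}"

end

theory Submission
  imports Defs "HOL-Real_Asymp.Real_Asymp"
begin

text \<open>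
  Both radii are at least \<open>\<kappa> / (\<alpha> powr (3/2) * \<surd>n)\<close> with \<open>\<kappa> > 0\<close> uniform over the class, and this alone
  dominates the error \<open>\<phi> - \<phi>\<^sub>\<alpha>\<close>: the coverage probabilities tend to 1 uniformly, so the rate
  \<open>n powr (-1/6)\<close> is absorbed in \<open>o(1)\<close> and no Gaussian approximation of the empirical process is needed.

  The bias is \<open>O(\<alpha> powr min \<beta> 1)\<close> in the supremum norm, negligible by the rate assumption. The noise is
  \<open>(\<alpha> + T\<^sup>*T)\<^sup>-\<^sup>1 h\<close> with \<open>h\<close> the empirical process \<open>z \<mapsto> (P\<^sub>n - P) f(\<cdot> - z)\<close>, and its supremum norm is
  at most \<open>(\<bar>h\<bar>\<^sub>\<infinity> + \<bar>T\<^sup>*\<bar> \<bar>T (\<alpha> + T\<^sup>*T)\<^sup>-\<^sup>1 h\<bar>) / \<alpha>\<close>. Hoeffding's inequality on a grid makes the first term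
  small. For the second one, averaging \<open>f(y - z)\<close> over \<open>N\<close> cells in \<open>y\<close> splits \<open>h = T\<^sup>*w + \<rho>\<close>; then
  \<open>\<bar>T (\<alpha> + T\<^sup>*T)\<^sup>-\<^sup>1 h\<bar> \<le> \<bar>w\<bar> + \<bar>\<rho>\<bar> / (2 \<surd>\<alpha>)\<close>, where \<open>\<bar>w\<bar>\<^sup>2\<close> has mean at most \<open>N / (n (b - a))\<close> and \<open>n \<bar>\<rho>\<bar>\<^sup>2\<close>
  has a mean that tends to 0 as \<open>N\<close> grows. This gains the factor \<open>o(1)\<close> over the trivial bound.

  The quantile in the second radius is defined by a definite description. That it denotes the quantile
  requires a continuous Gaussian process with the given covariance (Gram-Schmidt on a dense countable set,
  then dyadic approximation as in the Kolmogorov-Chentsov theorem) and that the law of its supremum is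
  unique (Cramer-Wold, by replacing one coordinate after the other in the characteristic function).
\<close>

text \<open>The trivial bound |T (\<alpha> + T*T)^-1 h| \<le> |h| / (2 sqrt \<alpha>) only shows
  that the noise is at most of the order 1 / (\<alpha>^(3/2) sqrt n), which is the order of the
  radii themselves, so a strictly smaller bound is needed. The number N of cells is chosen from the
  tolerated failure probability alone, before n: the residual then has a small constant, while the
  contribution of the weight is smaller than the radius by a factor of order sqrt \<alpha>. The
  supremum of the empirical process is affordable because the exponent in the rate assumption is at
  most 5/2. This forces \<alpha> \<le> n^(-1/5) eventually, so that exceeding the level
  \<alpha>^(-1/4) / sqrt n has a probability exponentially small in n^(1/10), against polynomially
  many grid points. The kernel is continuous on [a,b] only and may jump to 0 at both endpoints; this
  is why neighbourhoods of the jumps are carried through all modulus estimates.\<close>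

lemma integrable_mult_of_squares:
  fixes g h :: "'a \<Rightarrow> real"
  assumes [measurable]: "g \<in> borel_measurable N" "h \<in> borel_measurable N"
    and "integrable N (\<lambda>x. (g x)\<^sup>2)" "integrable N (\<lambda>x. (h x)\<^sup>2)"
  shows "integrable N (\<lambda>x. g x * h x)"
proof (rule Bochner_Integration.integrable_bound)
  show "integrable N (\<lambda>x. (g x)\<^sup>2 + (h x)\<^sup>2)" using assms by auto
  have "\<bar>u * v\<bar> \<le> u\<^sup>2 + v\<^sup>2" for u v :: real
  proof -
    have "2 * (\<bar>u\<bar> * \<bar>v\<bar>) \<le> u\<^sup>2 + v\<^sup>2" using sum_squares_bound[of "\<bar>u\<bar>" "\<bar>v\<bar>"] by (simp add: mult.assoc)
    moreover have "0 \<le> \<bar>u\<bar> * \<bar>v\<bar>" by simp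
    ultimately show ?thesis unfolding abs_mult by linarith
  qed
  then show "AE x in N. norm (g x * h x) \<le> norm ((g x)\<^sup>2 + (h x)\<^sup>2)" by simp
qed simp

text \<open>Nonnegativity of the quadratic form (t, u) \<mapsto> integral of (t g + u h)^2,
  evaluated at t = B, u = -D. Using two parameters avoids a division by B; only B = 0 needs its own
  argument.\<close>

lemma Cauchy_Schwarz_integral:
  fixes g h :: "'a \<Rightarrow> real"
  assumes [measurable]: "g \<in> borel_measurable N" "h \<in> borel_measurable N"
    and gi: "integrable N (\<lambda>x. (g x)\<^sup>2)" and hi: "integrable N (\<lambda>x. (h x)\<^sup>2)"
  shows "(\<integral>x. g x * h x \<partial>N)\<^sup>2 \<le> (\<integral>x. (g x)\<^sup>2 \<partial>N) * (\<integral>x. (h x)\<^sup>2 \<partial>N)"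
proof -
  define A B D where "A = (\<integral>x. (g x)\<^sup>2 \<partial>N)" and "B = (\<integral>x. (h x)\<^sup>2 \<partial>N)" and "D = (\<integral>x. g x * h x \<partial>N)"
  have ghi: "integrable N (\<lambda>x. g x * h x)"
    by (rule integrable_mult_of_squares) (use assms in auto)
  have "0 \<le> t\<^sup>2 * A + 2 * t * u * D + u\<^sup>2 * B" for t u
  proof -
    have "0 \<le> (\<integral>x. (t * g x + u * h x)\<^sup>2 \<partial>N)" by simp
    also have "\<dots> = (\<integral>x. t\<^sup>2 * (g x)\<^sup>2 + 2 * t * u * (g x * h x) + u\<^sup>2 * (h x)\<^sup>2 \<partial>N)"
      by (rule Bochner_Integration.integral_cong) (auto simp: power2_eq_square algebra_simps)
    also have "\<dots> = t\<^sup>2 * A + 2 * t * u * D + u\<^sup>2 * B"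
      unfolding A_def B_def D_def using gi hi ghi by (simp add: mult.assoc)
    finally show ?thesis .
  qed
  note q = this
  have A0: "A \<ge> 0" and B0: "B \<ge> 0" unfolding A_def B_def by auto
  have "D\<^sup>2 \<le> A * B"
  proof (cases "B = 0")
    case True
    have "D = 0"
    proof (rule ccontr)
      assume "D \<noteq> 0"
      \<comment> \<open>With B = 0 the form is affine in u, and this u makes it equal to -1.\<close>
      have "0 \<le> A + 2 * (- (A + 1) / (2 * D)) * D" using q[of 1 "- (A + 1) / (2 * D)"] True by simp
      also have "\<dots> = -1" using \<open>D \<noteq> 0\<close> by (simp add: field_simps)
      finally show False by simp
    qed
    then show ?thesis using True by simp
  next
    case False
    have "0 \<le> B\<^sup>2 * A + 2 * B * (-D) * D + (-D)\<^sup>2 * B" by (rule q)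
    also have "\<dots> = B * (A * B - D\<^sup>2)" by (simp add: power2_eq_square algebra_simps)
    finally show ?thesis using False B0 by (simp add: zero_le_mult_iff)
  qed
  then show ?thesis by (simp add: A_def B_def D_def)
qed

section \<open>Square-integrable functions on an interval\<close>

text \<open>All set integrals of the definitions become plain integrals over this finite measure, so
  that general facts on integrals apply without indicators.\<close>

abbreviation mu :: "real \<Rightarrow> real \<Rightarrow> real measure" where
  "mu a b \<equiv> restrict_space lborel {a..b}"

lemma finite_measure_mu: "finite_measure (mu a b)"
  by (intro finite_measureI) (simp add: emeasure_restrict_space emeasure_lborel_Icc_eq)

lemma measure_mu: "a \<le> b \<Longrightarrow> measure (mu a b) {a..b} = b - a"
  by (simp add: measure_restrict_space)

lemma borel_imp_mu [measurable (raw)]: "g \<in> borel_measurable borel \<Longrightarrow> g \<in> borel_measurable (mu a b)"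
  by (auto intro: measurable_restrict_space1)

lemma set_integral_mu: "(LINT x:{a..b}|lborel. g x) = integral\<^sup>L (mu a b) (g :: real \<Rightarrow> real)"
  unfolding set_lebesgue_integral_def by (subst integral_restrict_space) auto

lemma L2fun_mu: "L2fun a b g \<longleftrightarrow> g \<in> borel_measurable borel \<and> integrable (mu a b) (\<lambda>x. (g x)\<^sup>2)"
  unfolding L2fun_def set_integrable_def by (subst integrable_restrict_space) auto

lemma L2inner_mu: "L2inner a b g h = (\<integral>x. g x * h x \<partial>mu a b)"
  unfolding L2inner_def set_integral_mu ..

lemma L2norm_mu: "L2norm a b g = sqrt (\<integral>x. (g x)\<^sup>2 \<partial>mu a b)"
  unfolding L2norm_def set_integral_mu ..

lemma Top_mu: "Top a b f g y = (\<integral>z. g z * f (y - z) \<partial>mu a b)"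
  unfolding Top_def set_integral_mu ..

lemma Tadj_mu: "Tadj a b f g z = (\<integral>y. g y * f (y - z) \<partial>mu a b)"
  unfolding Tadj_def set_integral_mu ..

lemma L2fun_borel [measurable_dest]: "L2fun a b g \<Longrightarrow> g \<in> borel_measurable borel"
  by (simp add: L2fun_mu)

lemma L2fun_bounded:
  assumes [measurable]: "g \<in> borel_measurable borel" and "\<And>x. x \<in> {a..b} \<Longrightarrow> \<bar>g x\<bar> \<le> B"
  shows "L2fun a b g"
proof -
  interpret finite_measure "mu a b" by (rule finite_measure_mu)
  have "integrable (mu a b) (\<lambda>x. (g x)\<^sup>2)"
  proof (rule integrable_const_bound[where B="B\<^sup>2"])
    show "AE x in mu a b. norm ((g x)\<^sup>2) \<le> B\<^sup>2"
    proof (rule AE_I2)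
      fix x assume "x \<in> space (mu a b)"
      then have "\<bar>g x\<bar> \<le> B" using assms(2) by (simp add: space_restrict_space)
      then have "\<bar>g x\<bar>\<^sup>2 \<le> B\<^sup>2" by (intro power_mono) auto
      then show "norm ((g x)\<^sup>2) \<le> B\<^sup>2" by simp
    qed
  qed simp
  then show ?thesis by (simp add: L2fun_mu)
qed

lemma L2fun_integrable_mult:
  assumes "L2fun a b g" "L2fun a b h" shows "integrable (mu a b) (\<lambda>x. g x * h x)"
  using assms by (intro integrable_mult_of_squares) (auto simp: L2fun_mu)

lemma L2fun_integrable: assumes "L2fun a b g" shows "integrable (mu a b) g"
proof -
  have "L2fun a b (\<lambda>_. 1)" by (rule L2fun_bounded[where B=1]) auto
  from L2fun_integrable_mult[OF assms this] show ?thesis by simp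
qed

lemma L2fun_scale: assumes "L2fun a b g" shows "L2fun a b (\<lambda>x. c * g x)"
  using assms by (auto simp: L2fun_mu power_mult_distrib)

lemma L2fun_add: assumes "L2fun a b g" "L2fun a b h" shows "L2fun a b (\<lambda>x. g x + h x)"
proof -
  have "integrable (mu a b) (\<lambda>x. (g x)\<^sup>2 + 2 * (g x * h x) + (h x)\<^sup>2)"
    using assms L2fun_integrable_mult[OF assms] by (auto simp: L2fun_mu)
  then show ?thesis using assms by (auto simp: L2fun_mu power2_sum algebra_simps)
qed

lemma L2fun_diff: assumes "L2fun a b g" "L2fun a b h" shows "L2fun a b (\<lambda>x. g x - h x)"
  using L2fun_add[OF assms(1) L2fun_scale[OF assms(2), of "-1"]] by simp

lemma L2fun_sum: "(\<And>i. i \<in> I \<Longrightarrow> L2fun a b (g i)) \<Longrightarrow> L2fun a b (\<lambda>x. \<Sum>i\<in>I. g i x)"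
proof (induction I rule: infinite_finite_induct)
  case (insert x F)
  then have "L2fun a b (\<lambda>z. g x z + (\<Sum>i\<in>F. g i z))" by (intro L2fun_add) auto
  then show ?case using insert by simp
qed (auto intro: L2fun_bounded[where B=0])

lemma L2norm_nonneg: "L2norm a b g \<ge> 0"
  by (simp add: L2norm_mu)

lemma L2norm_sq: "(L2norm a b g)\<^sup>2 = L2inner a b g g"
  by (simp add: L2norm_mu L2inner_mu power2_eq_square[symmetric])

lemma L2inner_commute: "L2inner a b g h = L2inner a b h g"
  by (simp add: L2inner_mu mult.commute)

lemma L2inner_CS: assumes "L2fun a b g" "L2fun a b h"
  shows "\<bar>L2inner a b g h\<bar> \<le> L2norm a b g * L2norm a b h"
proof -
  have "(L2inner a b g h)\<^sup>2 \<le> (L2norm a b g * L2norm a b h)\<^sup>2"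
    using Cauchy_Schwarz_integral[of g "mu a b" h] assms
    by (auto simp: L2inner_mu L2norm_mu power_mult_distrib L2fun_mu)
  then have "\<bar>L2inner a b g h\<bar> \<le> \<bar>L2norm a b g * L2norm a b h\<bar>" unfolding abs_le_square_iff .
  then show ?thesis using L2norm_nonneg by (simp add: abs_mult)
qed

lemma L2inner_add_left: "L2fun a b g \<Longrightarrow> L2fun a b g' \<Longrightarrow> L2fun a b h \<Longrightarrow>
    L2inner a b (\<lambda>x. g x + g' x) h = L2inner a b g h + L2inner a b g' h"
  by (simp add: L2inner_mu distrib_right L2fun_integrable_mult)

lemma L2inner_diff_left: "L2fun a b g \<Longrightarrow> L2fun a b g' \<Longrightarrow> L2fun a b h \<Longrightarrow>
    L2inner a b (\<lambda>x. g x - g' x) h = L2inner a b g h - L2inner a b g' h"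
  by (simp add: L2inner_mu left_diff_distrib L2fun_integrable_mult)

lemma L2inner_add_right: "L2fun a b g \<Longrightarrow> L2fun a b g' \<Longrightarrow> L2fun a b h \<Longrightarrow>
    L2inner a b h (\<lambda>x. g x + g' x) = L2inner a b h g + L2inner a b h g'"
  by (simp add: L2inner_mu distrib_left L2fun_integrable_mult)

lemma L2inner_diff_right: "L2fun a b g \<Longrightarrow> L2fun a b g' \<Longrightarrow> L2fun a b h \<Longrightarrow>
    L2inner a b h (\<lambda>x. g x - g' x) = L2inner a b h g - L2inner a b h g'"
  by (simp add: L2inner_mu right_diff_distrib L2fun_integrable_mult)

lemma L2inner_scale_left: "L2inner a b (\<lambda>x. c * g x) h = c * L2inner a b g h"
  by (simp add: L2inner_mu mult.assoc)

lemma L2inner_scale_right: "L2inner a b g (\<lambda>x. c * h x) = c * L2inner a b g h"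
  by (simp add: L2inner_commute[of a b g] L2inner_scale_left)

lemma L2inner_sum_left: "(\<And>i. i \<in> I \<Longrightarrow> L2fun a b (g i)) \<Longrightarrow> L2fun a b h \<Longrightarrow>
    L2inner a b (\<lambda>x. \<Sum>i\<in>I. g i x) h = (\<Sum>i\<in>I. L2inner a b (g i) h)"
  by (simp add: L2inner_mu sum_distrib_right L2fun_integrable_mult)

lemma L2inner_sum_right: "(\<And>i. i \<in> I \<Longrightarrow> L2fun a b (g i)) \<Longrightarrow> L2fun a b h \<Longrightarrow>
    L2inner a b h (\<lambda>x. \<Sum>i\<in>I. g i x) = (\<Sum>i\<in>I. L2inner a b h (g i))"
  by (simp add: L2inner_commute[of a b h] L2inner_sum_left)

lemma L2norm_scale: "L2norm a b (\<lambda>x. c * g x) = \<bar>c\<bar> * L2norm a b g"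
  by (simp add: L2norm_mu power_mult_distrib real_sqrt_mult)

lemma L2norm_triangle: assumes "L2fun a b g" "L2fun a b h"
  shows "L2norm a b (\<lambda>x. g x + h x) \<le> L2norm a b g + L2norm a b h"
proof (rule power2_le_imp_le)
  have "(L2norm a b (\<lambda>x. g x + h x))\<^sup>2 = (L2norm a b g)\<^sup>2 + 2 * L2inner a b g h + (L2norm a b h)\<^sup>2"
    unfolding L2norm_sq using assms
    by (simp add: L2inner_add_left L2fun_add L2inner_add_right L2inner_commute[of a b h g])
  also have "\<dots> \<le> (L2norm a b g + L2norm a b h)\<^sup>2"
    using L2inner_CS[OF assms] by (simp add: power2_sum)
  finally show "(L2norm a b (\<lambda>x. g x + h x))\<^sup>2 \<le> (L2norm a b g + L2norm a b h)\<^sup>2" .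
qed (simp add: L2norm_nonneg)

lemma L2norm_cong_AE: assumes "AE x in mu a b. g x = h x" "L2fun a b g" "L2fun a b h"
  shows "L2norm a b g = L2norm a b h"
  unfolding L2norm_mu using assms
  by (intro arg_cong[where f=sqrt] integral_cong_AE) (auto simp: L2fun_mu)

lemma L2inner_cong_AE: assumes "AE x in mu a b. g x = g' x" "L2fun a b g" "L2fun a b g'" "L2fun a b h"
  shows "L2inner a b g h = L2inner a b g' h"
  unfolding L2inner_mu using assms
  by (intro integral_cong_AE) (auto simp: L2fun_mu)

lemma L2norm_zero_AE: assumes "L2fun a b g" "L2norm a b g = 0" shows "AE x in mu a b. g x = 0"
proof -
  have "(\<integral>x. (g x)\<^sup>2 \<partial>mu a b) = 0" using assms by (simp add: L2norm_mu)
  then have "AE x in mu a b. (g x)\<^sup>2 = 0"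
    using assms by (subst integral_nonneg_eq_0_iff_AE[symmetric]) (auto simp: L2fun_mu)
  then show ?thesis by simp
qed

lemma L2norm_mono: assumes "L2fun a b h" "g \<in> borel_measurable borel" "\<And>x. x \<in> {a..b} \<Longrightarrow> \<bar>g x\<bar> \<le> \<bar>h x\<bar>"
  shows "L2norm a b g \<le> L2norm a b h"
  unfolding L2norm_mu using assms
  by (intro real_sqrt_le_mono integral_mono_AE' AE_I2) (auto simp: L2fun_mu space_restrict_space abs_le_square_iff[symmetric])

lemma L2norm_bounded: assumes "a \<le> b" "\<And>x. x \<in> {a..b} \<Longrightarrow> \<bar>g x\<bar> \<le> B" "g \<in> borel_measurable borel"
  shows "L2norm a b g \<le> B * sqrt (b - a)"
proof -
  have B: "B \<ge> 0" using assms(1) assms(2)[of a] by auto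
  have "L2norm a b g \<le> L2norm a b (\<lambda>_. B)"
    using assms B by (intro L2norm_mono L2fun_bounded[where B=B]) auto
  also have "L2norm a b (\<lambda>_. B) = B * sqrt (b - a)"
    using assms(1) B by (simp add: L2norm_mu measure_mu space_restrict_space real_sqrt_mult mult.commute)
  finally show ?thesis .
qed

text \<open>The sublevel set of \<open>g\<close> is closed and contains almost every point of the
  open interval, hence also the closure of that interval. Such arguments turn almost-everywhere
  statements into pointwise ones, as the resolvent and the bands are defined pointwise.\<close>

lemma continuous_AE_le:
  assumes ab: "a < b" and c: "continuous_on {a..b} g" and ae: "AE x in mu a b. g x \<le> (B::real)"
    and x: "x \<in> {a..b}"
  shows "g x \<le> B"
proof -
  define C where "C = {x \<in> {a..b}. g x \<le> B}"
  have C: "closed C" unfolding C_def using c by (intro continuous_on_closed_Collect_le) auto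
  have "AE x in lborel. x \<in> {a..b} \<longrightarrow> g x \<le> B" using ae by (simp add: AE_restrict_space_iff)
  then have "AE x in lebesgue. x \<in> {a<..<b} \<longrightarrow> x \<in> C"
    by (intro AE_completion) (auto simp: C_def elim!: eventually_mono)
  then have "{a<..<b} \<subseteq> C" using mem_closed_if_AE_lebesgue_open[OF open_greaterThanLessThan C] by blast
  then have "closure {a<..<b} \<subseteq> C" using C by (intro closure_minimal)
  then show ?thesis using ab x by (auto simp: C_def)
qed

lemma continuous_L2norm_zero:
  assumes "a < b" "continuous_on {a..b} g" "L2fun a b g" "L2norm a b g = 0" "x \<in> {a..b}"
  shows "g x = 0"
proof -
  have "AE x in mu a b. g x \<le> 0" "AE x in mu a b. - g x \<le> 0" using L2norm_zero_AE[OF assms(3,4)] by auto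
  from continuous_AE_le[OF assms(1,2) this(1) assms(5)] continuous_AE_le[OF assms(1) _ this(2) assms(5)] assms(2)
  show ?thesis by (auto intro: continuous_on_minus)
qed

text \<open>Expand the squared norm of \<open>h - p\<close>, where \<open>p\<close> is the
  projection onto the finite span.\<close>

lemma Bessel_L2:
  assumes u: "\<And>j. L2fun a b (u j)" and on: "\<And>i j. L2inner a b (u i) (u j) = (if i = j then 1 else 0)"
    and h: "L2fun a b h" and J: "finite (J :: nat set)"
  shows "(\<Sum>j\<in>J. (L2inner a b h (u j))\<^sup>2) \<le> (L2norm a b h)\<^sup>2"
proof -
  define c where "c j = L2inner a b h (u j)" for j
  define p where "p x = (\<Sum>j\<in>J. c j * u j x)" for x
  have p: "L2fun a b p" unfolding p_def using u by (intro L2fun_sum L2fun_scale)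
  have hp: "L2inner a b h p = (\<Sum>j\<in>J. (c j)\<^sup>2)"
    unfolding p_def using u h by (simp add: L2inner_sum_right L2fun_scale L2inner_scale_right c_def power2_eq_square)
  have "L2inner a b (u i) p = c i" if "i \<in> J" for i
    unfolding p_def using u that J by (simp add: L2inner_sum_right L2fun_scale L2inner_scale_right on if_distrib[where f="\<lambda>x. _ * x"] cong: if_cong)
  then have pp: "L2inner a b p p = (\<Sum>j\<in>J. (c j)\<^sup>2)"
  proof -
    have "L2inner a b (\<lambda>x. \<Sum>j\<in>J. c j * u j x) p = (\<Sum>j\<in>J. c j * L2inner a b (u j) p)"
      using u p by (simp add: L2inner_sum_left L2fun_scale L2inner_scale_left)
    then show ?thesis using \<open>\<And>i. i \<in> J \<Longrightarrow> L2inner a b (u i) p = c i\<close>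
      by (simp add: p_def[abs_def, symmetric] power2_eq_square)
  qed
  have "0 \<le> (L2norm a b (\<lambda>x. h x - p x))\<^sup>2" by simp
  also have "\<dots> = (L2norm a b h)\<^sup>2 - 2 * L2inner a b h p + L2inner a b p p"
    unfolding L2norm_sq using h p
    by (simp add: L2inner_diff_left L2fun_diff L2inner_diff_right L2inner_commute[of a b p h])
  finally show ?thesis unfolding hp pp c_def by simp
qed

text \<open>Stated without normalization because it is applied to the functions
  \<open>T (e j)\<close>, whose squared norms are the eigenvalues.\<close>

lemma L2norm_orthogonal_sum:
  assumes u: "\<And>j. L2fun a b (u j)" and og: "\<And>i j. i \<noteq> j \<Longrightarrow> L2inner a b (u i) (u j) = 0" and J: "finite J"
  shows "(L2norm a b (\<lambda>x. \<Sum>j\<in>J. c j * u j x))\<^sup>2 = (\<Sum>j\<in>J. (c j)\<^sup>2 * L2inner a b (u j) (u j))"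
proof -
  have s: "L2fun a b (\<lambda>x. \<Sum>j\<in>J. c j * u j x)" using u by (intro L2fun_sum L2fun_scale)
  have "L2inner a b (u i) (\<lambda>x. \<Sum>j\<in>J. c j * u j x) = c i * L2inner a b (u i) (u i)" if "i \<in> J" for i
  proof -
    have "L2inner a b (u i) (\<lambda>x. \<Sum>j\<in>J. c j * u j x) = (\<Sum>j\<in>J. c j * L2inner a b (u i) (u j))"
      using u by (simp add: L2inner_sum_right L2fun_scale L2inner_scale_right)
    also have "\<dots> = (\<Sum>j\<in>J. if j = i then c i * L2inner a b (u i) (u i) else 0)"
      by (intro sum.cong) (auto simp: og)
    finally show ?thesis using that J by simp
  qed
  then show ?thesis unfolding L2norm_sq using u s
    by (subst L2inner_sum_left) (auto simp: L2fun_scale L2inner_scale_left power2_eq_square mult.assoc intro!: sum.cong)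
qed

section \<open>The convolution operator and its adjoint\<close>

lemma pair_mu_measurable:
  fixes k :: "real \<times> real \<Rightarrow> real"
  assumes k: "k \<in> borel_measurable (borel \<Otimes>\<^sub>M borel)"
  shows "k \<in> borel_measurable (borel \<Otimes>\<^sub>M mu a b)" "k \<in> borel_measurable (mu a b \<Otimes>\<^sub>M mu c d)"
proof -
  have i: "(\<lambda>x. x) \<in> mu a b \<rightarrow>\<^sub>M borel" for a b :: real by (rule borel_imp_mu) simp
  have "(\<lambda>p. (fst p, snd p)) \<in> (borel \<Otimes>\<^sub>M mu a b) \<rightarrow>\<^sub>M (borel \<Otimes>\<^sub>M borel)"
    by (intro measurable_Pair measurable_fst measurable_compose[OF measurable_snd i])
  from measurable_compose[OF this k] show "k \<in> borel_measurable (borel \<Otimes>\<^sub>M mu a b)" by simp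
  have "(\<lambda>p. (fst p, snd p)) \<in> (mu a b \<Otimes>\<^sub>M mu c d) \<rightarrow>\<^sub>M (borel \<Otimes>\<^sub>M borel)"
    by (intro measurable_Pair measurable_compose[OF measurable_fst i] measurable_compose[OF measurable_snd i])
  from measurable_compose[OF this k] show "k \<in> borel_measurable (mu a b \<Otimes>\<^sub>M mu c d)" by simp
qed

lemma borel_measurable_integral_mu:
  fixes k :: "real \<Rightarrow> real \<Rightarrow> real"
  assumes "(\<lambda>(y, z). k y z) \<in> borel_measurable (borel \<Otimes>\<^sub>M borel)"
  shows "(\<lambda>y. \<integral>z. k y z \<partial>mu a b) \<in> borel_measurable borel"
proof -
  interpret finite_measure "mu a b" by (rule finite_measure_mu)
  show ?thesis by (rule borel_measurable_lebesgue_integral[OF pair_mu_measurable(1)[OF assms]])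
qed

text \<open>The bound on \<open>f\<close> is required on the whole line since \<open>y - z\<close>
  leaves [a,b]. Continuity of the images of \<open>Tadj\<close> makes \<open>A g\<close> continuous,
  which lets identities in L2 be read at every point.\<close>

locale kernel_op =
  fixes a b M :: real and f :: "real \<Rightarrow> real"
  assumes ab: "a < b" and f_meas [measurable]: "f \<in> borel_measurable borel"
    and f_bd: "\<And>x. \<bar>f x\<bar> \<le> M"
    and T_cont: "\<And>\<psi>. L2fun a b \<psi> \<Longrightarrow> continuous_on {a..b} (Tadj a b f \<psi>)"
begin

abbreviation "L2 \<equiv> L2fun a b"
abbreviation "ip \<equiv> L2inner a b"
abbreviation "nm \<equiv> L2norm a b"
abbreviation "T \<equiv> Top a b f"
abbreviation "T' \<equiv> Tadj a b f"
abbreviation "A \<equiv> TadjT a b f"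

text \<open>Bounds the L2 norm of every slice of f (y - z), and thus both \<open>T\<close> and
  \<open>T'\<close> as maps from L2 into bounded functions. It depends only on a, b and M, which
  keeps later estimates uniform over the class.\<close>

definition B where "B = M * sqrt (b - a)"

lemma M_nonneg: "M \<ge> 0" using f_bd[of 0] by linarith
lemma B_nonneg: "B \<ge> 0" using ab M_nonneg by (simp add: B_def)

lemma L2_slice: "L2 (\<lambda>z. f (y - z))" "L2 (\<lambda>y. f (y - z))"
  using f_bd by (auto intro!: L2fun_bounded[where B=M])

lemma nm_slice: "nm (\<lambda>z. f (y - z)) \<le> B" "nm (\<lambda>y. f (y - z)) \<le> B"
  unfolding B_def using f_bd ab by (auto intro!: L2norm_bounded)

lemma T_ip: "T g y = ip g (\<lambda>z. f (y - z))" by (simp add: Top_mu L2inner_mu)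
lemma T'_ip: "T' g z = ip g (\<lambda>y. f (y - z))" by (simp add: Tadj_mu L2inner_mu)
lemma A_eq: "A g = T' (T g)" by (simp add: TadjT_def)

lemma T_bound: assumes "L2 g" shows "\<bar>T g y\<bar> \<le> B * nm g"
proof -
  have "\<bar>T g y\<bar> \<le> nm g * nm (\<lambda>z. f (y - z))" unfolding T_ip by (rule L2inner_CS[OF assms L2_slice(1)])
  also have "\<dots> \<le> nm g * B" by (intro mult_left_mono nm_slice L2norm_nonneg)
  finally show ?thesis by (simp add: mult.commute)
qed

lemma T'_bound: assumes "L2 g" shows "\<bar>T' g z\<bar> \<le> B * nm g"
proof -
  have "\<bar>T' g z\<bar> \<le> nm g * nm (\<lambda>y. f (y - z))" unfolding T'_ip by (rule L2inner_CS[OF assms L2_slice(2)])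
  also have "\<dots> \<le> nm g * B" by (intro mult_left_mono nm_slice L2norm_nonneg)
  finally show ?thesis by (simp add: mult.commute)
qed

lemma T_borel: assumes "L2 g" shows "T g \<in> borel_measurable borel"
proof -
  note [measurable] = L2fun_borel[OF assms]
  show ?thesis unfolding Top_mu[abs_def] by (rule borel_measurable_integral_mu) measurable
qed

lemma T'_borel: assumes "L2 g" shows "T' g \<in> borel_measurable borel"
proof -
  note [measurable] = L2fun_borel[OF assms]
  show ?thesis unfolding Tadj_mu[abs_def] by (rule borel_measurable_integral_mu) measurable
qed

lemma L2_T: assumes "L2 g" shows "L2 (T g)"
  by (rule L2fun_bounded[OF T_borel[OF assms] T_bound[OF assms]])
lemma L2_T': assumes "L2 g" shows "L2 (T' g)"
  by (rule L2fun_bounded[OF T'_borel[OF assms] T'_bound[OF assms]])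
lemma L2_A: "L2 g \<Longrightarrow> L2 (A g)" by (simp add: A_eq L2_T L2_T')

lemma A_cont: "L2 g \<Longrightarrow> continuous_on {a..b} (A g)" by (simp add: A_eq L2_T T_cont)

lemma nm_T: assumes "L2 g" shows "nm (T g) \<le> B * sqrt (b - a) * nm g"
  using L2norm_bounded[OF less_imp_le[OF ab] T_bound[OF assms] T_borel[OF assms]] by (simp add: mult_ac)

lemma A_bound_T: "L2 g \<Longrightarrow> \<bar>A g z\<bar> \<le> B * nm (T g)"
  by (simp add: A_eq L2_T T'_bound)

lemma A_bound: assumes "L2 g" shows "\<bar>A g z\<bar> \<le> B * (B * sqrt (b - a)) * nm g"
  using A_bound_T[OF assms, of z] mult_left_mono[OF nm_T[OF assms] B_nonneg] by (simp add: mult_ac)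

text \<open>Fubini for the kernel \<open>g z * f (y - z) * p y\<close>, which is dominated by M
  times the integrable product of |p y| and |g z|.\<close>

lemma T_adjoint: assumes g: "L2 g" and p: "L2 p" shows "ip (T g) p = ip g (T' p)"
proof -
  interpret finite_measure "mu a b" by (rule finite_measure_mu)
  interpret P: pair_sigma_finite "mu a b" "mu a b" ..
  note [measurable] = L2fun_borel[OF g] L2fun_borel[OF p]
  define k where "k = (\<lambda>y z. g z * f (y - z) * p y)"
  have i1: "integrable (mu a b \<Otimes>\<^sub>M mu a b) (\<lambda>(y, z). M * (\<bar>p y\<bar> * \<bar>g z\<bar>))"
    by (rule P.Fubini_integrable[OF pair_mu_measurable(2)])
       (use L2fun_integrable[OF g] L2fun_integrable[OF p] in \<open>auto simp: abs_mult\<close>)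
  have int: "integrable (mu a b \<Otimes>\<^sub>M mu a b) (\<lambda>(y, z). k y z)"
  proof (rule Bochner_Integration.integrable_bound[OF i1])
    have "\<bar>k y z\<bar> \<le> \<bar>M * (\<bar>p y\<bar> * \<bar>g z\<bar>)\<bar>" for y z
    proof -
      have "\<bar>k y z\<bar> = \<bar>f (y - z)\<bar> * (\<bar>p y\<bar> * \<bar>g z\<bar>)" by (simp add: k_def abs_mult mult_ac)
      also have "\<dots> \<le> M * (\<bar>p y\<bar> * \<bar>g z\<bar>)" by (intro mult_right_mono f_bd) simp
      finally show ?thesis by linarith
    qed
    then show "AE x in mu a b \<Otimes>\<^sub>M mu a b. norm (case x of (y, z) \<Rightarrow> k y z) \<le> norm (case x of (y, z) \<Rightarrow> M * (\<bar>p y\<bar> * \<bar>g z\<bar>))"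
      by (intro AE_I2) (auto split: prod.split)
    show "(\<lambda>(y, z). k y z) \<in> borel_measurable (mu a b \<Otimes>\<^sub>M mu a b)"
      by (rule pair_mu_measurable(2)) (simp add: k_def)
  qed
  have "ip (T g) p = (\<integral>y. (\<integral>z. k y z \<partial>mu a b) \<partial>mu a b)"
    by (simp add: L2inner_mu Top_mu k_def)
  also have "\<dots> = (\<integral>z. (\<integral>y. k y z \<partial>mu a b) \<partial>mu a b)" by (rule P.Fubini_integral[OF int, symmetric])
  also have "\<dots> = ip g (T' p)"
  proof -
    have "(\<integral>y. k y z \<partial>mu a b) = g z * (\<integral>y. p y * f (y - z) \<partial>mu a b)" for z
      unfolding integral_mult_right_zero[symmetric] k_def
      by (rule Bochner_Integration.integral_cong) (auto simp: mult_ac)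
    then show ?thesis by (simp add: L2inner_mu Tadj_mu)
  qed
  finally show ?thesis .
qed

lemma ip_A: "L2 g \<Longrightarrow> L2 h \<Longrightarrow> ip (A g) h = ip (T g) (T h)"
  by (metis A_eq L2_T L2inner_commute T_adjoint)

lemma T_add: "L2 g \<Longrightarrow> L2 h \<Longrightarrow> T (\<lambda>x. g x + h x) y = T g y + T h y"
  by (simp add: T_ip L2inner_add_left L2_slice)
lemma T_diff: "L2 g \<Longrightarrow> L2 h \<Longrightarrow> T (\<lambda>x. g x - h x) y = T g y - T h y"
  by (simp add: T_ip L2inner_diff_left L2_slice)
lemma T_scale: "T (\<lambda>x. c * g x) y = c * T g y"
  by (simp add: T_ip L2inner_scale_left)
lemma T_sum: "(\<And>i. i \<in> I \<Longrightarrow> L2 (g i)) \<Longrightarrow> T (\<lambda>x. \<Sum>i\<in>I. g i x) y = (\<Sum>i\<in>I. T (g i) y)"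
  by (simp add: T_ip L2inner_sum_left L2_slice)
lemma T'_add: "L2 g \<Longrightarrow> L2 h \<Longrightarrow> T' (\<lambda>x. g x + h x) y = T' g y + T' h y"
  by (simp add: T'_ip L2inner_add_left L2_slice)
lemma T'_diff: "L2 g \<Longrightarrow> L2 h \<Longrightarrow> T' (\<lambda>x. g x - h x) y = T' g y - T' h y"
  by (simp add: T'_ip L2inner_diff_left L2_slice)
lemma T'_scale: "T' (\<lambda>x. c * g x) y = c * T' g y"
  by (simp add: T'_ip L2inner_scale_left)
lemma T'_sum: "(\<And>i. i \<in> I \<Longrightarrow> L2 (g i)) \<Longrightarrow> T' (\<lambda>x. \<Sum>i\<in>I. g i x) y = (\<Sum>i\<in>I. T' (g i) y)"
  by (simp add: T'_ip L2inner_sum_left L2_slice)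
lemma A_diff: "L2 g \<Longrightarrow> L2 h \<Longrightarrow> A (\<lambda>x. g x - h x) y = A g y - A h y"
proof -
  assume g: "L2 g" and h: "L2 h"
  have "T (\<lambda>x. g x - h x) = (\<lambda>y. T g y - T h y)" by (rule ext) (rule T_diff[OF g h])
  then show ?thesis using g h by (simp add: A_eq T'_diff L2_T)
qed
lemma A_scale: "A (\<lambda>x. c * g x) y = c * A g y"
  by (simp add: A_eq T_scale[abs_def] T'_scale)
lemma A_sum: "(\<And>i. i \<in> I \<Longrightarrow> L2 (g i)) \<Longrightarrow> A (\<lambda>x. \<Sum>i\<in>I. g i x) y = (\<Sum>i\<in>I. A (g i) y)"
proof -
  assume g: "\<And>i. i \<in> I \<Longrightarrow> L2 (g i)"
  have "T (\<lambda>x. \<Sum>i\<in>I. g i x) = (\<lambda>y. \<Sum>i\<in>I. T (g i) y)" by (rule ext) (rule T_sum[OF g])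
  then show ?thesis using g by (simp add: A_eq T'_sum L2_T)
qed

text \<open>The value of \<open>A g\<close> at every single point depends only on the class of
  \<open>g\<close> modulo null sets, so relations valid almost everywhere can be used inside
  \<open>A\<close>.\<close>

lemma A_cong_AE: assumes "AE x in mu a b. g x = h x" "L2 g" "L2 h" shows "A g = A h"
proof -
  have "T g = T h" unfolding T_ip[abs_def] using L2inner_cong_AE[OF assms L2_slice(1)] by auto
  then show ?thesis by (simp add: A_eq)
qed

lemma A_cong: assumes "\<And>x. x \<in> {a..b} \<Longrightarrow> g x = h x" "L2 g" "L2 h" shows "A g = A h"
  using assms by (intro A_cong_AE AE_I2) (auto simp: space_restrict_space)

section \<open>The Tikhonov resolvent\<close>

text \<open>The condition inside the definite description of \<open>resolvent\<close>. Validity at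
  every point of [a,b] and the value 0 outside single out one function, not merely one class modulo
  null sets.\<close>

definition solves :: "real \<Rightarrow> (real \<Rightarrow> real) \<Rightarrow> (real \<Rightarrow> real) \<Rightarrow> bool" where
  "solves \<alpha> h g \<longleftrightarrow> L2 g \<and> (\<forall>z. z \<notin> {a..b} \<longrightarrow> g z = 0) \<and> (\<forall>z\<in>{a..b}. \<alpha> * g z + A g z = h z)"

text \<open>Take the inner product of the equation with \<open>g\<close>. The almost-everywhere form
  is needed because truncated spectral sums satisfy their equations only up to null sets.\<close>

lemma energy_AE:
  assumes g: "L2 g" and h: "L2 h" and eq: "AE z in mu a b. \<alpha> * g z + A g z = h z"
  shows "\<alpha> * (nm g)\<^sup>2 + (nm (T g))\<^sup>2 = ip h g"
proof -
  have "ip h g = ip (\<lambda>z. \<alpha> * g z + A g z) g"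
    using eq by (intro L2inner_cong_AE h g L2fun_add L2fun_scale L2_A) auto
  also have "\<dots> = \<alpha> * (nm g)\<^sup>2 + (nm (T g))\<^sup>2"
    using g by (simp add: L2inner_add_left L2fun_scale L2_A L2inner_scale_left ip_A L2norm_sq)
  finally show ?thesis by simp
qed

lemma solves_energy:
  assumes "solves \<alpha> h g" "L2 h"
  shows "\<alpha> * (nm g)\<^sup>2 + (nm (T g))\<^sup>2 = ip h g"
  using assms by (intro energy_AE) (auto simp: solves_def space_restrict_space)

lemma solves_diff:
  assumes "solves \<alpha> h g" "solves \<alpha> h' g'"
  shows "solves \<alpha> (\<lambda>z. h z - h' z) (\<lambda>z. g z - g' z)"
proof -
  have "\<alpha> * (g z - g' z) + A (\<lambda>z. g z - g' z) z = h z - h' z" if "z \<in> {a..b}" for z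
  proof -
    have "\<alpha> * g z + A g z = h z" "\<alpha> * g' z + A g' z = h' z" "L2 g" "L2 g'"
      using assms that by (auto simp: solves_def)
    then show ?thesis by (simp add: A_diff algebra_simps)
  qed
  then show ?thesis using assms by (auto simp: solves_def L2fun_diff)
qed

text \<open>The energy identity gives norm 0 for the difference, so \<open>A\<close> of the
  difference vanishes at every point, and the equation then yields equality at every point.\<close>

lemma solves_unique:
  assumes "\<alpha> > 0" "solves \<alpha> h g" "solves \<alpha> h g'" shows "g = g'"
proof
  fix z
  have s: "solves \<alpha> (\<lambda>z. 0) (\<lambda>z. g z - g' z)" using solves_diff[OF assms(2,3)] by simp
  have L: "L2 (\<lambda>z. g z - g' z)" using s by (simp add: solves_def)
  have "\<alpha> * (nm (\<lambda>z. g z - g' z))\<^sup>2 + (nm (T (\<lambda>z. g z - g' z)))\<^sup>2 = 0"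
    using solves_energy[OF s] by (simp add: L2fun_bounded[where B=0] L2inner_mu)
  then have "\<alpha> * (nm (\<lambda>z. g z - g' z))\<^sup>2 = 0" using assms(1)
    by (metis add_nonneg_eq_0_iff less_imp_le mult_nonneg_nonneg zero_le_power2)
  then have n0: "nm (\<lambda>z. g z - g' z) = 0" using assms(1) by simp
  show "g z = g' z"
  proof (cases "z \<in> {a..b}")
    case True
    have "A (\<lambda>z. g z - g' z) z = 0" using A_bound[OF L, of z] n0 by simp
    moreover have "\<alpha> * (g z - g' z) + A (\<lambda>z. g z - g' z) z = 0" using s True unfolding solves_def by blast
    ultimately show ?thesis using assms(1) by simp
  next
    case False then show ?thesis using assms by (simp add: solves_def)
  qed
qed

lemma resolvent_eqI: assumes "\<alpha> > 0" "solves \<alpha> h g" shows "resolvent a b f \<alpha> h = g"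
  unfolding resolvent_def
proof (rule the_equality)
  show "L2 g \<and> (\<forall>z. z \<notin> {a..b} \<longrightarrow> g z = 0) \<and> (\<forall>z\<in>{a..b}. \<alpha> * g z + A g z = h z)"
    using assms by (simp add: solves_def)
next
  fix g' assume "L2 g' \<and> (\<forall>z. z \<notin> {a..b} \<longrightarrow> g' z = 0) \<and> (\<forall>z\<in>{a..b}. \<alpha> * g' z + A g' z = h z)"
  then have "solves \<alpha> h g'" by (simp add: solves_def)
  then show "g' = g" using assms solves_unique by blast
qed

text \<open>The part of the data of the form \<^term>\<open>T' w\<close> is damped by the resolvent without any
  factor \<open>\<alpha>\<close>; only the remainder pays \<open>1 / (2 \<surd>\<alpha>)\<close>.\<close>

lemma solves_nm_T:
  assumes al: "\<alpha> > 0" and s: "solves \<alpha> h g" and h: "L2 h" and w: "L2 w" and r: "L2 r"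
    and split: "\<And>z. z \<in> {a..b} \<Longrightarrow> h z = T' w z + r z"
  shows "nm (T g) \<le> nm w + nm r / (2 * sqrt \<alpha>)"
proof -
  have g: "L2 g" using s by (simp add: solves_def)
  have "ip h g = ip (\<lambda>z. T' w z + r z) g"
    unfolding L2inner_mu by (intro Bochner_Integration.integral_cong) (auto simp: split space_restrict_space)
  also have "\<dots> = ip w (T g) + ip r g"
    using g w r by (simp add: L2inner_add_left L2_T' L2inner_commute[of a b "T' w"] L2inner_commute[of a b w] T_adjoint)
  finally have e: "\<alpha> * (nm g)\<^sup>2 + (nm (T g))\<^sup>2 = ip w (T g) + ip r g" using solves_energy[OF s h] by simp
  define x where "x = nm (T g)"
  define c where "c = nm r / (2 * sqrt \<alpha>)"
  have c0: "c \<ge> 0" using L2norm_nonneg al by (simp add: c_def)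
  have "ip w (T g) \<le> nm w * x" using L2inner_CS[OF w L2_T[OF g]] by (simp add: x_def)
  \<comment> \<open>Young's inequality, weighted so that the first term is exactly the energy term
    \<alpha> |g|^2 and cancels; this fixes the factor 1 / (2 sqrt \<alpha>).\<close>
  moreover have "ip r g \<le> \<alpha> * (nm g)\<^sup>2 + c\<^sup>2"
  proof -
    have "ip r g \<le> nm r * nm g" using L2inner_CS[OF r g] by simp
    also have "\<dots> = 2 * (sqrt \<alpha> * nm g) * c" using al by (simp add: c_def)
    also have "\<dots> \<le> (sqrt \<alpha> * nm g)\<^sup>2 + c\<^sup>2" by (rule sum_squares_bound)
    also have "\<dots> = \<alpha> * (nm g)\<^sup>2 + c\<^sup>2" using al by (simp add: power_mult_distrib)
    finally show ?thesis .
  qed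
  ultimately have q: "x\<^sup>2 \<le> nm w * x + c\<^sup>2" using e by (simp add: x_def)
  show ?thesis
  proof (rule ccontr)
    assume "\<not> ?thesis"
    then have l: "x > nm w + c" by (simp add: x_def c_def)
    have n: "nm w \<ge> 0" by (rule L2norm_nonneg)
    \<comment> \<open>If \<open>x > nm w + c\<close>, both \<open>x\<close> and
      \<open>x - nm w\<close> exceed \<open>c\<close>, so their product exceeds
      \<open>c * c\<close>, against the quadratic inequality. Monotonicity gives only the weak form;
      strictness is shown separately.\<close>
    have "c * c \<le> x * (x - nm w) " using l n c0 by (intro mult_mono) auto
    moreover have "c * c \<noteq> x * (x - nm w)"
    proof
      assume eq: "c * c = x * (x - nm w)"
      have "c * c \<le> x * c" using l n c0 by (intro mult_right_mono) auto
      moreover have "x * c < x * (x - nm w)" using l n c0 by (intro mult_strict_left_mono) auto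
      ultimately show False using eq by linarith
    qed
    ultimately show False using q by (simp add: power2_eq_square algebra_simps)
  qed
qed

lemma solves_sup_bound:
  assumes "\<alpha> > 0" "solves \<alpha> h g" "z \<in> {a..b}"
  shows "\<bar>g z\<bar> \<le> (\<bar>h z\<bar> + B * nm (T g)) / \<alpha>"
proof -
  have "L2 g" "\<alpha> * g z = h z - A g z" using assms(2,3) by (auto simp: solves_def algebra_simps)
  then have "\<alpha> * \<bar>g z\<bar> \<le> \<bar>h z\<bar> + B * nm (T g)"
  proof -
    have "\<alpha> * \<bar>g z\<bar> = \<bar>h z - A g z\<bar>" using assms(1) \<open>\<alpha> * g z = h z - A g z\<close>[symmetric] by (simp add: abs_mult)
    then show ?thesis using A_bound_T[OF \<open>L2 g\<close>, of z] by linarith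
  qed
  then show ?thesis using assms(1) by (simp add: field_simps)
qed

end

section \<open>The regularized equation solved by a spectral series\<close>

locale spectral_op = kernel_op +
  fixes lam :: "nat \<Rightarrow> real" and e :: "nat \<Rightarrow> real \<Rightarrow> real"
  assumes spec: "spectral_system a b f lam e"
begin

lemma e_L2: "L2 (e j)" and e_on: "ip (e i) (e j) = (if i = j then 1 else 0)" and lam_pos: "lam j > 0"
  and A_lim: "L2 h \<Longrightarrow> (\<lambda>N. nm (\<lambda>z. A h z - (\<Sum>j<N. lam j * ip h (e j) * e j z))) \<longlonglongrightarrow> 0"
  using spec unfolding spectral_system_def by auto

text \<open>Orthonormality makes the expansion of \<open>A (e i)\<close> stationary after the index
  \<open>i\<close>. As the expansion converges in norm, the relation is obtained only almost
  everywhere.\<close>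

lemma A_e_AE: "AE x in mu a b. A (e i) x = lam i * e i x"
proof -
  have "(\<lambda>N. nm (\<lambda>z. A (e i) z - (\<Sum>j<N. lam j * ip (e i) (e j) * e j z))) \<longlonglongrightarrow> 0" by (rule A_lim[OF e_L2])
  moreover have "eventually (\<lambda>N. nm (\<lambda>z. A (e i) z - (\<Sum>j<N. lam j * ip (e i) (e j) * e j z)) = nm (\<lambda>z. A (e i) z - lam i * e i z)) sequentially"
    using eventually_gt_at_top[of i]
  proof eventually_elim
    case (elim N)
    have "(\<Sum>j<N. lam j * ip (e i) (e j) * e j z) = (\<Sum>j<N. if j = i then lam i * e i z else 0)" for z
      by (intro sum.cong) (auto simp: e_on)
    then show ?case using elim by simp
  qed
  ultimately have "(\<lambda>N. nm (\<lambda>z. A (e i) z - lam i * e i z)) \<longlonglongrightarrow> 0"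
    using tendsto_cong by fast
  then have "nm (\<lambda>z. A (e i) z - lam i * e i z) = 0" by (simp add: LIMSEQ_const_iff)
  then have "AE x in mu a b. A (e i) x - lam i * e i x = 0"
    by (intro L2norm_zero_AE L2fun_diff L2_A L2fun_scale e_L2)
  then show ?thesis by simp
qed

text \<open>Applying \<open>A\<close> once more removes the exceptional null set:
  \<open>A (e i)\<close> is a multiple of the eigenfunction, in a version for which the eigenvalue
  equation holds everywhere.\<close>

lemma A_A_e: "A (A (e i)) z = lam i * A (e i) z"
  using A_cong_AE[OF A_e_AE[of i] L2_A[OF e_L2] L2fun_scale[OF e_L2]] by (simp add: A_scale)

lemma ip_T_e: "ip (T (e i)) (T (e j)) = (if i = j then lam i else 0)"
proof -
  have "ip (T (e i)) (T (e j)) = ip (A (e i)) (e j)" using e_L2 by (simp add: ip_A)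
  also have "\<dots> = ip (\<lambda>z. lam i * e i z) (e j)"
    by (rule L2inner_cong_AE[OF A_e_AE L2_A[OF e_L2] L2fun_scale[OF e_L2] e_L2])
  finally show ?thesis by (simp add: L2inner_scale_left e_on)
qed

text \<open>\<open>lam j\<close> is the squared norm of \<open>T (e j)\<close>. The uniform bound
  makes the constant in the bias independent of the spectral system.\<close>

lemma lam_le: "lam j \<le> (B * sqrt (b - a))\<^sup>2"
proof -
  have "lam j = (nm (T (e j)))\<^sup>2" by (simp add: L2norm_sq ip_T_e)
  also have "\<dots> \<le> (B * sqrt (b - a))\<^sup>2"
  proof (rule power_mono[OF _ L2norm_nonneg])
    have "(nm (e j))\<^sup>2 = 1" unfolding L2norm_sq by (simp add: e_on)
    then have "nm (e j) = 1" using L2norm_nonneg[of a b "e j"] by (simp add: power2_eq_1_iff)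
    then show "nm (T (e j)) \<le> B * sqrt (b - a)" using nm_T[OF e_L2[of j]] by simp
  qed
  finally show ?thesis .
qed

text \<open>Partial sums of (\<alpha> + T*T)^-1 T*T h and not of the resolvent: the
  \<open>e j\<close> are not assumed complete here, and the extra factor makes the series converge
  uniformly. Writing \<open>A (e j)\<close> instead of \<open>lam j * e j\<close> makes every sum
  continuous.\<close>

definition part :: "real \<Rightarrow> (real \<Rightarrow> real) \<Rightarrow> nat \<Rightarrow> real \<Rightarrow> real" where
  "part \<alpha> h N z = (\<Sum>j<N. ip h (e j) / (\<alpha> + lam j) * A (e j) z)"

lemma nm_comb_T: "finite J \<Longrightarrow> (nm (T (\<lambda>z. \<Sum>j\<in>J. c j * e j z)))\<^sup>2 = (\<Sum>j\<in>J. (c j)\<^sup>2 * lam j)"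
proof -
  assume J: "finite J"
  have "T (\<lambda>z. \<Sum>j\<in>J. c j * e j z) = (\<lambda>y. \<Sum>j\<in>J. c j * T (e j) y)"
    by (rule ext) (simp add: T_sum L2fun_scale e_L2 T_scale)
  then show ?thesis using L2norm_orthogonal_sum[of a b "\<lambda>j. T (e j)" J c] J
    by (simp add: L2_T e_L2 ip_T_e)
qed

text \<open>A block of the series is \<open>A p\<close> for a finite combination \<open>p\<close> of
  eigenfunctions, hence bounded by \<open>B * nm (T p)\<close> uniformly in \<open>z\<close>; then
  lam / (\<alpha> + lam)^2 \<le> 1 / \<alpha> is used for each eigenvalue.\<close>

lemma part_diff:
  assumes al: "\<alpha> > 0" and h: "L2 h" and "K \<le> N"
  shows "\<bar>part \<alpha> h N z - part \<alpha> h K z\<bar> \<le> B * sqrt ((\<Sum>j\<in>{K..<N}. (ip h (e j))\<^sup>2) / \<alpha>)"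
proof -
  define c where "c j = ip h (e j) / (\<alpha> + lam j)" for j
  define p where "p z = (\<Sum>j\<in>{K..<N}. c j * e j z)" for z
  have p: "L2 p" unfolding p_def by (intro L2fun_sum L2fun_scale e_L2)
  have "part \<alpha> h N z - part \<alpha> h K z = (\<Sum>j\<in>{K..<N}. c j * A (e j) z)"
    using sum_diff_nat_ivl[of 0 K N "\<lambda>j. c j * A (e j) z"] assms(3)
    by (simp add: part_def c_def atLeast0LessThan)
  also have "\<dots> = A p z"
    unfolding p_def by (subst A_sum) (auto simp: L2fun_scale e_L2 A_scale)
  finally have "\<bar>part \<alpha> h N z - part \<alpha> h K z\<bar> \<le> B * nm (T p)" using A_bound_T[OF p] by simp
  also have "nm (T p) \<le> sqrt ((\<Sum>j\<in>{K..<N}. (ip h (e j))\<^sup>2) / \<alpha>)"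
  proof (rule real_le_rsqrt)
    have "(nm (T p))\<^sup>2 = (\<Sum>j\<in>{K..<N}. (c j)\<^sup>2 * lam j)" unfolding p_def by (rule nm_comb_T) simp
    also have "\<dots> \<le> (\<Sum>j\<in>{K..<N}. (ip h (e j))\<^sup>2 / \<alpha>)"
    proof (rule sum_mono)
      fix j
      have "\<alpha> * lam j \<le> (\<alpha> + lam j)\<^sup>2" using al lam_pos[of j] by (simp add: power2_eq_square algebra_simps)
      then have "lam j / (\<alpha> + lam j)\<^sup>2 \<le> 1 / \<alpha>" using al lam_pos[of j] by (simp add: field_simps)
      from mult_left_mono[OF this zero_le_power2[of "ip h (e j)"]]
      show "(c j)\<^sup>2 * lam j \<le> (ip h (e j))\<^sup>2 / \<alpha>" by (simp add: c_def power_divide)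
    qed
    finally show "(nm (T p))\<^sup>2 \<le> (\<Sum>j\<in>{K..<N}. (ip h (e j))\<^sup>2) / \<alpha>" by (simp add: sum_divide_distrib)
  qed
  finally show ?thesis using B_nonneg by (simp add: mult_left_mono)
qed

lemma summable_coeff: assumes "L2 h" shows "summable (\<lambda>j. (ip h (e j))\<^sup>2)"
  using Bessel_L2[of a b e h, OF e_L2 e_on assms] by (intro summableI_nonneg_bounded) auto

text \<open>Bessel's inequality makes the coefficients square summable, and \<open>part_diff\<close>
  turns tails of that series into uniform bounds.\<close>

lemma part_uniform:
  assumes al: "\<alpha> > 0" and h: "L2 h"
  shows "uniform_limit UNIV (part \<alpha> h) (\<lambda>z. lim (\<lambda>N. part \<alpha> h N z)) sequentially"
proof -
  have "uniformly_Cauchy_on UNIV (part \<alpha> h)"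
  proof (rule uniformly_Cauchy_onI')
    fix \<epsilon> :: real assume \<epsilon>: "\<epsilon> > 0"
    \<comment> \<open>Dividing by \<open>B + 1\<close> and not by \<open>B\<close> also covers
      \<open>B = 0\<close>.\<close>
    define d where "d = \<alpha> * (\<epsilon> / (B + 1))\<^sup>2"
    have d: "d > 0" using al \<epsilon> B_nonneg by (simp add: d_def)
    obtain N0 where N0: "\<And>m n. m \<ge> N0 \<Longrightarrow> norm (\<Sum>j\<in>{m..<n}. (ip h (e j))\<^sup>2) < d"
      using summable_coeff[OF h] d unfolding summable_Cauchy by meson
    show "\<exists>N0. \<forall>x\<in>UNIV. \<forall>m\<ge>N0. \<forall>n>m. dist (part \<alpha> h m x) (part \<alpha> h n x) < \<epsilon>"
    proof (intro exI[of _ N0] ballI allI impI)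
      fix x m n :: _ assume mn: "m \<ge> N0" "n > m"
      have "\<bar>part \<alpha> h n x - part \<alpha> h m x\<bar> \<le> B * sqrt ((\<Sum>j\<in>{m..<n}. (ip h (e j))\<^sup>2) / \<alpha>)"
        using mn by (intro part_diff al h) auto
      also have "\<dots> \<le> B * sqrt (d / \<alpha>)" using N0[OF mn(1), of n] al B_nonneg
        by (intro mult_left_mono real_sqrt_le_mono divide_right_mono) (auto dest: less_imp_le abs_le_D1)
      also have "sqrt (d / \<alpha>) = \<epsilon> / (B + 1)" using al \<epsilon> B_nonneg by (simp add: d_def real_sqrt_abs)
      also have "B * (\<epsilon> / (B + 1)) < \<epsilon>" using \<epsilon> B_nonneg by (simp add: field_simps)
      finally show "dist (part \<alpha> h m x) (part \<alpha> h n x) < \<epsilon>" by (simp add: dist_real_def abs_minus_commute)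
    qed
  qed
  then have "uniformly_convergent_on UNIV (part \<alpha> h)" by (rule Cauchy_uniformly_convergent)
  then show ?thesis by (rule uniformly_convergent_uniform_limit_iff[THEN iffD1])
qed

text \<open>The continuous function (\<alpha> + T*T)^-1 T*T h. The resolvent of h is (h -
  \<open>smooth\<close>) / \<alpha>, so its discontinuities are those of h.\<close>

definition smooth :: "real \<Rightarrow> (real \<Rightarrow> real) \<Rightarrow> real \<Rightarrow> real" where
  "smooth \<alpha> h z = lim (\<lambda>N. part \<alpha> h N z)"

lemma part_L2: "L2 (part \<alpha> h N)"
  unfolding part_def[abs_def] by (intro L2fun_sum L2fun_scale L2_A e_L2)

lemma part_cont: "continuous_on {a..b} (part \<alpha> h N)"
  unfolding part_def[abs_def] by (intro continuous_intros A_cont e_L2)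

lemma part_tendsto: assumes "\<alpha> > 0" "L2 h" shows "(\<lambda>N. part \<alpha> h N z) \<longlonglongrightarrow> smooth \<alpha> h z"
  using tendsto_uniform_limitI[OF part_uniform[OF assms]] by (simp add: smooth_def)

lemma smooth_cont: assumes "\<alpha> > 0" "L2 h" shows "continuous_on {a..b} (smooth \<alpha> h)"
proof (rule uniform_limit_theorem)
  show "uniform_limit {a..b} (part \<alpha> h) (smooth \<alpha> h) sequentially"
    unfolding smooth_def[abs_def] by (rule uniform_limit_on_subset[OF part_uniform[OF assms]]) simp
qed (auto simp: part_cont)

lemma smooth_L2: assumes "\<alpha> > 0" "L2 h" shows "L2 (smooth \<alpha> h)"
proof -
  have "smooth \<alpha> h \<in> borel_measurable borel"
    by (rule borel_measurable_LIMSEQ_real[OF part_tendsto[OF assms]]) (use L2fun_borel[OF part_L2] in auto)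
  moreover obtain C where "\<forall>x\<in>{a..b}. \<bar>smooth \<alpha> h x\<bar> \<le> C"
    using compact_imp_bounded[OF compact_continuous_image[OF smooth_cont[OF assms]]] by (auto simp: bounded_iff)
  then have "\<And>x. x \<in> {a..b} \<Longrightarrow> \<bar>smooth \<alpha> h x\<bar> \<le> C" by blast
  ultimately show ?thesis by (rule L2fun_bounded)
qed

lemma part_nm_tendsto: assumes "\<alpha> > 0" "L2 h"
  shows "(\<lambda>N. nm (\<lambda>z. part \<alpha> h N z - smooth \<alpha> h z)) \<longlonglongrightarrow> 0"
proof (rule LIMSEQ_I)
  fix r :: real assume r: "r > 0"
  define d where "d = r / (2 * sqrt (b - a))"
  have d: "d > 0" using r ab by (simp add: d_def)
  have "\<forall>\<^sub>F n in sequentially. \<forall>x\<in>UNIV. dist (part \<alpha> h n x) (smooth \<alpha> h x) < d"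
    using uniform_limitD[OF part_uniform[OF assms] d] by (simp add: smooth_def)
  then obtain n0 where n0: "\<And>n x. n \<ge> n0 \<Longrightarrow> dist (part \<alpha> h n x) (smooth \<alpha> h x) < d"
    unfolding eventually_sequentially by auto
  show "\<exists>no. \<forall>n\<ge>no. norm (nm (\<lambda>z. part \<alpha> h n z - smooth \<alpha> h z) - 0) < r"
  proof (intro exI[of _ n0] allI impI)
    fix n assume "n \<ge> n0"
    have "nm (\<lambda>z. part \<alpha> h n z - smooth \<alpha> h z) \<le> d * sqrt (b - a)"
      using ab n0[OF \<open>n \<ge> n0\<close>] L2fun_borel[OF part_L2] L2fun_borel[OF smooth_L2[OF assms]]
      by (intro L2norm_bounded) (auto simp: dist_real_def dest: less_imp_le)
    also have "\<dots> = r / 2" using ab by (simp add: d_def)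
    finally show "norm (nm (\<lambda>z. part \<alpha> h n z - smooth \<alpha> h z) - 0) < r" using r L2norm_nonneg by simp
  qed
qed

lemma A_part: "\<alpha> > 0 \<Longrightarrow> A (part \<alpha> h N) z + \<alpha> * part \<alpha> h N z = (\<Sum>j<N. ip h (e j) * A (e j) z)"
proof -
  assume al: "\<alpha> > 0"
  have "A (part \<alpha> h N) z = (\<Sum>j<N. ip h (e j) / (\<alpha> + lam j) * (lam j * A (e j) z))"
    unfolding part_def[abs_def] by (subst A_sum) (intro L2fun_scale L2_A e_L2, simp only: A_scale A_A_e)
  then have "A (part \<alpha> h N) z + \<alpha> * part \<alpha> h N z = (\<Sum>j<N. ip h (e j) / (\<alpha> + lam j) * (lam j * A (e j) z) + \<alpha> * (ip h (e j) / (\<alpha> + lam j) * A (e j) z))"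
    by (simp add: part_def sum_distrib_left sum.distrib)
  also have "\<dots> = (\<Sum>j<N. ip h (e j) * A (e j) z)"
  proof (rule sum.cong[OF refl])
    fix j
    have "\<alpha> + lam j \<noteq> 0" using al lam_pos[of j] by linarith
    then show "ip h (e j) / (\<alpha> + lam j) * (lam j * A (e j) z) + \<alpha> * (ip h (e j) / (\<alpha> + lam j) * A (e j) z) = ip h (e j) * A (e j) z"
      by (simp add: divide_simps) (simp add: algebra_simps)
  qed
  finally show ?thesis .
qed

text \<open>The defect \<open>R\<close> of the equation is continuous, so it suffices that its L2
  norm is 0. For every \<open>N\<close> this norm is at most a constant times the distance of the
  partial sum from its limit, plus the norm of the tail in the expansion of
  \<open>A h\<close>.\<close>

lemma A_smooth: assumes al: "\<alpha> > 0" and h: "L2 h" and z: "z \<in> {a..b}"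
  shows "A (smooth \<alpha> h) z + \<alpha> * smooth \<alpha> h z = A h z"
proof -
  let ?S = "smooth \<alpha> h"
  define R where "R z = A ?S z + \<alpha> * ?S z - A h z" for z
  note S = smooth_L2[OF al h] and P = part_L2[of \<alpha> h]
  have RL: "L2 R" unfolding R_def by (intro L2fun_diff L2fun_add L2fun_scale L2_A S h)
  have Rc: "continuous_on {a..b} R" unfolding R_def by (intro continuous_intros A_cont smooth_cont S al h)
  define D where "D N z = part \<alpha> h N z - ?S z" for N z
  have DL: "L2 (D N)" for N unfolding D_def by (intro L2fun_diff P S)
  define E where "E N z = A h z - (\<Sum>j<N. lam j * ip h (e j) * e j z)" for N z
  have EL: "L2 (E N)" for N unfolding E_def by (intro L2fun_diff L2_A h L2fun_sum L2fun_scale e_L2)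
  define F where "F N z = A (D N) z + \<alpha> * D N z" for N z
  have FL: "L2 (F N)" for N unfolding F_def by (intro L2fun_add L2fun_scale L2_A DL)
  \<comment> \<open>By \<open>A_part\<close> the partial sums solve the equation with a truncated
    right-hand side. \<open>F\<close> is the effect of replacing the limit by the partial sum,
    \<open>E\<close> that of truncating \<open>A h\<close>.\<close>
  have id: "AE z in mu a b. R z = - F N z - E N z" for N
  proof -
    have "AE z in mu a b. \<forall>j\<in>{..<N}. A (e j) z = lam j * e j z"
      by (rule AE_finite_allI) (auto simp: A_e_AE)
    then show ?thesis
    proof eventually_elim
      case (elim z)
      have "F N z = A (part \<alpha> h N) z - A ?S z + \<alpha> * part \<alpha> h N z - \<alpha> * ?S z"
        unfolding F_def D_def using P S by (simp add: A_diff right_diff_distrib)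
      moreover have "(\<Sum>j<N. ip h (e j) * A (e j) z) = (\<Sum>j<N. lam j * ip h (e j) * e j z)"
        using elim by (intro sum.cong) auto
      ultimately show ?case using A_part[OF al, of h N z] by (simp add: R_def E_def)
    qed
  qed
  define c where "c = B * (B * sqrt (b - a)) * sqrt (b - a) + \<alpha>"
  have bound: "nm R \<le> c * nm (D N) + nm (E N)" for N
  proof -
    have "nm R = nm (\<lambda>z. - 1 * (F N z + E N z))"
      using id[of N] by (intro L2norm_cong_AE RL L2fun_scale L2fun_add FL EL) auto
    also have "\<dots> = nm (\<lambda>z. F N z + E N z)" by (simp only: L2norm_scale)
    also have "\<dots> \<le> nm (F N) + nm (E N)" by (intro L2norm_triangle FL EL)
    also have "nm (F N) \<le> nm (A (D N)) + nm (\<lambda>z. \<alpha> * D N z)"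
      unfolding F_def by (intro L2norm_triangle L2_A L2fun_scale DL)
    also have "nm (A (D N)) \<le> B * (B * sqrt (b - a)) * nm (D N) * sqrt (b - a)"
      using ab DL by (intro L2norm_bounded A_bound L2fun_borel[OF L2_A]) auto
    also have "nm (\<lambda>z. \<alpha> * D N z) = \<alpha> * nm (D N)" using al by (simp add: L2norm_scale)
    finally show ?thesis by (simp add: c_def algebra_simps)
  qed
  have "(\<lambda>N. c * nm (D N) + nm (E N)) \<longlonglongrightarrow> c * 0 + 0"
    unfolding D_def E_def by (intro tendsto_intros part_nm_tendsto A_lim al h)
  then have "nm R \<le> c * 0 + 0" by (rule LIMSEQ_le_const) (use bound in auto)
  then have "nm R = 0" using L2norm_nonneg[of a b R] by simp
  from continuous_L2norm_zero[OF ab Rc RL this z] show ?thesis by (simp add: R_def)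
qed

text \<open>From (\<alpha> + T*T)^-1 = (1 - (\<alpha> + T*T)^-1 T*T) / \<alpha>. Setting the
  candidate to 0 outside [a,b] does not change \<open>A\<close> of it, and
  \<open>resolvent_eqI\<close> shows that the definite description denotes it.\<close>

lemma resolvent_solves:
  assumes al: "\<alpha> > 0" and h: "L2 h"
  shows "solves \<alpha> h (resolvent a b f \<alpha> h)"
    and "z \<in> {a..b} \<Longrightarrow> resolvent a b f \<alpha> h z = (h z - smooth \<alpha> h z) / \<alpha>"
proof -
  let ?S = "smooth \<alpha> h"
  define g0 where "g0 z = (1 / \<alpha>) * (h z - ?S z)" for z
  define g where "g z = indicator {a..b} z * g0 z" for z
  note S = smooth_L2[OF al h]
  have g0: "L2 g0" unfolding g0_def by (intro L2fun_scale L2fun_diff h S)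
  have g: "L2 g"
  proof -
    have "integrable (mu a b) (\<lambda>x. (g x)\<^sup>2) = integrable (mu a b) (\<lambda>x. (g0 x)\<^sup>2)"
      by (intro Bochner_Integration.integrable_cong) (auto simp: g_def space_restrict_space)
    then show ?thesis using g0 by (auto simp: L2fun_mu g_def[abs_def])
  qed
  have "A g = A g0" by (rule A_cong) (auto simp: g g0 g_def)
  then have Ag: "A g z = (1 / \<alpha>) * (A h z - A ?S z)" for z
    unfolding g0_def using h S by (simp only: A_scale A_diff)
  have s: "solves \<alpha> h g" unfolding solves_def
  proof (intro conjI g allI ballI impI)
    fix z assume z: "z \<in> {a..b}"
    have "\<alpha> * g z = h z - ?S z" using al z by (simp add: g_def g0_def)
    moreover have "A g z = ?S z" using A_smooth[OF al h z] al by (simp add: Ag field_simps)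
    ultimately show "\<alpha> * g z + A g z = h z" by simp
  qed (simp add: g_def)
  show "solves \<alpha> h (resolvent a b f \<alpha> h)"
    using resolvent_eqI[OF al s] s by simp
  show "z \<in> {a..b} \<Longrightarrow> resolvent a b f \<alpha> h z = (h z - smooth \<alpha> h z) / \<alpha>"
    using resolvent_eqI[OF al s] by (simp add: g_def g0_def)
qed

end

text \<open>For \<beta> \<le> 1 a weighted geometric mean of \<alpha> and l is at most \<alpha> + l;
  beyond 1 the factor saturates at the order \<alpha>, and the surplus power of l is paid by L. The
  maximum with 1 gives both ranges a common constant.\<close>

lemma Tikhonov_factor_le:
  fixes \<alpha> \<beta> l L :: real
  assumes al: "\<alpha> > 0" and l: "l > 0" "l \<le> L" and be: "\<beta> \<ge> 0"
  shows "\<alpha> * l powr \<beta> / (\<alpha> + l) \<le> \<alpha> powr (min \<beta> 1) * (max 1 L) powr \<beta>"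
proof (cases "\<beta> \<le> 1")
  case True
  have "\<alpha> powr (1 - \<beta>) * l powr \<beta> \<le> \<alpha> + l"
  proof (cases "l \<le> \<alpha>")
    case True
    have "\<alpha> powr (1 - \<beta>) * l powr \<beta> \<le> \<alpha> powr (1 - \<beta>) * \<alpha> powr \<beta>"
      using True be l by (intro mult_left_mono powr_mono2) auto
    also have "\<dots> = \<alpha>" using al by (simp add: powr_add[symmetric])
    finally show ?thesis using l by simp
  next
    case False
    have "\<alpha> powr (1 - \<beta>) * l powr \<beta> \<le> l powr (1 - \<beta>) * l powr \<beta>"
      using False al \<open>\<beta> \<le> 1\<close> by (intro mult_right_mono powr_mono2) auto
    also have "\<dots> = l" using l by (simp add: powr_add[symmetric])
    finally show ?thesis using al by simp
  qed
  then have "\<alpha> powr \<beta> * (\<alpha> powr (1 - \<beta>) * l powr \<beta>) \<le> \<alpha> powr \<beta> * (\<alpha> + l)" by (intro mult_left_mono) auto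
  moreover have "\<alpha> powr \<beta> * (\<alpha> powr (1 - \<beta>) * l powr \<beta>) = \<alpha> * l powr \<beta>"
    using al by (simp add: mult.assoc[symmetric] powr_add[symmetric])
  ultimately have "\<alpha> * l powr \<beta> \<le> \<alpha> powr \<beta> * (\<alpha> + l)" by simp
  then have "\<alpha> * l powr \<beta> / (\<alpha> + l) \<le> \<alpha> powr \<beta>" using al l by (simp add: pos_divide_le_eq)
  also have "\<dots> \<le> \<alpha> powr \<beta> * (max 1 L) powr \<beta>"
    using mult_left_mono[OF ge_one_powr_ge_zero[of "max 1 L" \<beta>], of "\<alpha> powr \<beta>"] be by simp
  finally show ?thesis using True by simp
next
  case False
  have "l powr \<beta> = l * l powr (\<beta> - 1)" using l by (simp add: powr_mult_base)
  then have "\<alpha> * l powr \<beta> / (\<alpha> + l) = \<alpha> * l powr (\<beta> - 1) * (l / (\<alpha> + l))" by simp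
  also have "\<dots> \<le> \<alpha> * l powr (\<beta> - 1) * 1" using al l by (intro mult_left_mono) (auto simp: field_simps)
  also have "\<dots> \<le> \<alpha> * (max 1 L) powr (\<beta> - 1)" using al l False by (simp, intro powr_mono2) auto
  also have "\<dots> \<le> \<alpha> * (max 1 L) powr \<beta>" using al by (intro mult_left_mono powr_mono) auto
  finally show ?thesis using False al by simp
qed

context spectral_op
begin

section \<open>The regularization bias\<close>

text \<open>The spectral sums \<open>g N\<close> of the bias are \<open>T' (w N)\<close> with
  \<open>nm (w N)\<close> at most \<open>Q * nm \<psi>\<close>, so they are bounded by
  \<open>D\<close> at every point and for every \<open>N\<close>. They converge to the bias
  \<open>d\<close> only in L2; the bound passes to \<open>d\<close> because the excess of |d| over
  \<open>D\<close> is continuous and has norm 0.\<close>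

lemma bias_bound:
  assumes al: "\<alpha> > 0" and be: "\<beta> \<ge> 0" and phi: "L2 \<phi>" "continuous_on {a..b} \<phi>" and psi: "L2 \<psi>"
    and conv: "(\<lambda>N. nm (\<lambda>z. \<phi> z - (\<Sum>j<N. lam j powr \<beta> * ip (T' \<psi>) (e j) * e j z))) \<longlonglongrightarrow> 0"
    and z: "z \<in> {a..b}"
  shows "\<bar>resolvent a b f \<alpha> (\<lambda>z. \<alpha> * \<phi> z) z\<bar> \<le>
    B * (\<alpha> powr (min \<beta> 1) * (max 1 ((B * sqrt (b - a))\<^sup>2)) powr \<beta> * nm \<psi>)"
proof -
  define Q where "Q = \<alpha> powr (min \<beta> 1) * (max 1 ((B * sqrt (b - a))\<^sup>2)) powr \<beta>"
  have Q0: "Q \<ge> 0" by (simp add: Q_def)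
  define D where "D = B * (Q * nm \<psi>)"
  define d where "d = resolvent a b f \<alpha> (\<lambda>z. \<alpha> * \<phi> z)"
  have sd: "solves \<alpha> (\<lambda>z. \<alpha> * \<phi> z) d" unfolding d_def by (rule resolvent_solves(1)[OF al L2fun_scale[OF phi(1)]])
  have dL: "L2 d" using sd by (simp add: solves_def)
  have d_eq: "d z = \<phi> z - A d z / \<alpha>" if "z \<in> {a..b}" for z
    using sd that al by (auto simp: solves_def field_simps)
  have dc: "continuous_on {a..b} d"
    by (subst continuous_on_cong[OF refl d_eq]) (use al in \<open>auto intro!: continuous_intros phi A_cont dL\<close>)
  define k where "k j = ip \<psi> (T (e j))" for j
  have k: "ip (T' \<psi>) (e j) = k j" for j
    using T_adjoint[OF e_L2 psi, of j] by (simp add: k_def L2inner_commute)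
  define q where "q j = \<alpha> * lam j powr \<beta> / (\<alpha> + lam j)" for j
  have q0: "q j \<ge> 0" and qQ: "q j \<le> Q" for j
    unfolding q_def Q_def using al lam_pos[of j] Tikhonov_factor_le[OF al lam_pos lam_le be] by auto
  \<comment> \<open>Makes \<open>c j * A (e j)\<close> the j-th term \<open>q j * k j * e j\<close>
    of the bias up to null sets; the division compensates for the eigenvalue that \<open>A\<close>
    produces.\<close>
  define c where "c j = q j * k j / lam j" for j
  define w where "w N y = (\<Sum>j<N. c j * T (e j) y)" for N y
  define g where "g N z = (\<Sum>j<N. c j * A (e j) z)" for N z
  have wL: "L2 (w N)" for N unfolding w_def by (intro L2fun_sum L2fun_scale L2_T e_L2)
  have gL: "L2 (g N)" for N unfolding g_def by (intro L2fun_sum L2fun_scale L2_A e_L2)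
  have gw: "g N z = T' (w N) z" for N z
    unfolding g_def w_def by (subst T'_sum) (auto intro: L2fun_scale L2_T e_L2 simp: T'_scale A_eq)
  have nw: "nm (w N) \<le> Q * nm \<psi>" for N
  proof (rule power2_le_imp_le)
    \<comment> \<open>The left singular functions of \<open>T\<close>. They are orthonormal, so
      Bessel's inequality can be applied to \<psi> itself.\<close>
    define u where "u j y = (1 / sqrt (lam j)) * T (e j) y" for j y
    have uL: "L2 (u j)" for j unfolding u_def by (intro L2fun_scale L2_T e_L2)
    have uo: "ip (u i) (u j) = (if i = j then 1 else 0)" for i j
      unfolding u_def L2inner_scale_left L2inner_scale_right ip_T_e using lam_pos[of i] by auto
    have "(nm (w N))\<^sup>2 = (\<Sum>j<N. (c j)\<^sup>2 * ip (T (e j)) (T (e j)))"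
      unfolding w_def by (rule L2norm_orthogonal_sum) (auto simp: L2_T e_L2 ip_T_e)
    also have "\<dots> = (\<Sum>j<N. (q j)\<^sup>2 * (ip \<psi> (u j))\<^sup>2)"
    proof (rule sum.cong[OF refl])
      fix j
      have l: "lam j > 0" by (rule lam_pos)
      have "ip \<psi> (u j) = k j / sqrt (lam j)" unfolding u_def L2inner_scale_right by (simp add: k_def)
      then show "(c j)\<^sup>2 * ip (T (e j)) (T (e j)) = (q j)\<^sup>2 * (ip \<psi> (u j))\<^sup>2"
        using l by (simp add: c_def ip_T_e power_divide power_mult_distrib) (simp add: power2_eq_square)
    qed
    also have "\<dots> \<le> (\<Sum>j<N. Q\<^sup>2 * (ip \<psi> (u j))\<^sup>2)"
      using q0 qQ by (intro sum_mono mult_right_mono power_mono) auto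
    also have "\<dots> \<le> Q\<^sup>2 * (nm \<psi>)\<^sup>2"
      unfolding sum_distrib_left[symmetric] by (intro mult_left_mono Bessel_L2 uL uo psi) auto
    finally show "(nm (w N))\<^sup>2 \<le> (Q * nm \<psi>)\<^sup>2" by (simp add: power_mult_distrib)
  qed (simp add: Q0 L2norm_nonneg)
  have gD: "\<bar>g N z\<bar> \<le> D" for N z
    unfolding gw D_def using T'_bound[OF wL, of N z] mult_left_mono[OF nw B_nonneg, of N] by linarith
  define E where "E N z = \<phi> z - (\<Sum>j<N. lam j powr \<beta> * ip (T' \<psi>) (e j) * e j z)" for N z
  have EL: "L2 (E N)" for N unfolding E_def by (intro L2fun_diff phi L2fun_sum L2fun_scale e_L2)
  define x where "x N z = d z - g N z" for N z
  have xL: "L2 (x N)" for N unfolding x_def by (intro L2fun_diff dL gL)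
  \<comment> \<open>\<open>x N\<close> solves, almost everywhere, the equation with right-hand side
    \<alpha> \<open>E N\<close>, and \<alpha> (\<alpha> + T*T)^-1 is a contraction of L2.\<close>
  have xE: "nm (x N) \<le> nm (E N)" for N
  proof -
    have Ag: "A (g N) z = (\<Sum>j<N. c j * (lam j * A (e j) z))" for z
      unfolding g_def by (subst A_sum) (intro L2fun_scale L2_A e_L2, simp only: A_scale A_A_e)
    have "AE z in mu a b. \<forall>j\<in>{..<N}. A (e j) z = lam j * e j z"
      by (rule AE_finite_allI) (auto simp: A_e_AE)
    moreover have "AE z in mu a b. z \<in> {a..b}" by (auto simp: space_restrict_space intro!: AE_I2)
    ultimately have "AE z in mu a b. \<alpha> * x N z + A (x N) z = \<alpha> * E N z"
    proof eventually_elim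
      case (elim z)
      have "\<alpha> * g N z + A (g N) z = (\<Sum>j<N. \<alpha> * (c j * A (e j) z) + c j * (lam j * A (e j) z))"
        by (simp add: Ag g_def sum_distrib_left sum.distrib)
      also have "\<dots> = (\<Sum>j<N. \<alpha> * (lam j powr \<beta> * ip (T' \<psi>) (e j) * e j z))"
      proof (rule sum.cong[OF refl])
        fix j assume j: "j \<in> {..<N}"
        have "\<alpha> + lam j > 0" "lam j > 0" using al lam_pos[of j] by auto
        then have "c j * (\<alpha> + lam j) * lam j = \<alpha> * lam j powr \<beta> * k j"
          by (simp add: c_def q_def)
        moreover have "A (e j) z = lam j * e j z" using elim j by auto
        ultimately show "\<alpha> * (c j * A (e j) z) + c j * (lam j * A (e j) z) = \<alpha> * (lam j powr \<beta> * ip (T' \<psi>) (e j) * e j z)"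
          unfolding k by algebra
      qed
      finally have "\<alpha> * g N z + A (g N) z = \<alpha> * \<phi> z - \<alpha> * E N z"
        by (simp add: E_def sum_distrib_left algebra_simps)
      moreover have "\<alpha> * d z + A d z = \<alpha> * \<phi> z" using sd elim by (simp add: solves_def)
      moreover have "A (x N) z = A d z - A (g N) z" unfolding x_def by (rule A_diff[OF dL gL])
      ultimately show ?case by (simp add: x_def algebra_simps)
    qed
    from energy_AE[OF xL L2fun_scale[OF EL] this]
    have "\<alpha> * (nm (x N))\<^sup>2 + (nm (T (x N)))\<^sup>2 = \<alpha> * ip (E N) (x N)" by (simp only: L2inner_scale_left)
    then have "\<alpha> * (nm (x N))\<^sup>2 \<le> \<alpha> * ip (E N) (x N)" using zero_le_power2[of "nm (T (x N))"] by linarith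
    then have "(nm (x N))\<^sup>2 \<le> nm (E N) * nm (x N)" using al L2inner_CS[OF EL xL, of N N] by simp
    then show ?thesis using L2norm_nonneg[of a b "x N"] L2norm_nonneg[of a b "E N"]
      by (cases "nm (x N) = 0") (auto simp: power2_eq_square)
  qed
  define v where "v z = max 0 (\<bar>d z\<bar> - D)" for z
  have vL: "L2 v"
  proof -
    have "L2 (\<lambda>z. \<bar>d z\<bar>)" using dL by (auto simp: L2fun_mu)
    then have L: "L2 (\<lambda>z. \<bar>d z\<bar> - D)" by (rule L2fun_diff) (rule L2fun_bounded[where B="\<bar>D\<bar>"], auto)
    note [measurable] = L2fun_borel[OF dL]
    have vm: "v \<in> borel_measurable borel" unfolding v_def[abs_def] by measurable
    have "integrable (mu a b) (\<lambda>z. (v z)\<^sup>2)"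
    proof (rule Bochner_Integration.integrable_bound)
      show "integrable (mu a b) (\<lambda>z. (\<bar>d z\<bar> - D)\<^sup>2)" using L by (simp add: L2fun_mu)
      have "(v z)\<^sup>2 \<le> (\<bar>d z\<bar> - D)\<^sup>2" for z unfolding abs_le_square_iff[symmetric] by (simp add: v_def)
      then show "AE z in mu a b. norm ((v z)\<^sup>2) \<le> norm ((\<bar>d z\<bar> - D)\<^sup>2)" by simp
    qed (use vm in measurable)
    then show ?thesis using vm by (simp add: L2fun_mu)
  qed
  have vc: "continuous_on {a..b} v" unfolding v_def by (intro continuous_intros dc)
  have "nm v \<le> nm (E N)" for N
  proof -
    have "\<bar>v z\<bar> \<le> \<bar>x N z\<bar>" for z using gD[of N z] by (simp add: v_def x_def)
    then have "nm v \<le> nm (x N)" using vL by (intro L2norm_mono xL) (auto simp: L2fun_mu)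
    then show ?thesis using xE[of N] by simp
  qed
  moreover have "(\<lambda>N. nm (E N)) \<longlonglongrightarrow> 0" using conv unfolding E_def .
  ultimately have "nm v \<le> 0" by (meson LIMSEQ_le_const)
  then have "nm v = 0" using L2norm_nonneg[of a b v] by simp
  from continuous_L2norm_zero[OF ab vc vL this z] have "\<bar>d z\<bar> \<le> D" by (simp add: v_def max_def split: if_splits)
  then show ?thesis by (simp add: d_def D_def Q_def mult.assoc)
qed

text \<open>\<phi> itself solves the equation with right-hand side \<alpha> \<phi> + T*T \<phi>;
  linearity and uniqueness do the rest. This is uniqueness of functions, which is why \<phi> has to
  vanish outside [a,b].\<close>

lemma error_decomposition:
  assumes al: "\<alpha> > 0" and h: "L2 h" and phi: "L2 \<phi>" "\<And>z. z \<notin> {a..b} \<Longrightarrow> \<phi> z = 0"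
  shows "\<phi> z - resolvent a b f \<alpha> h z =
    resolvent a b f \<alpha> (\<lambda>z. \<alpha> * \<phi> z) z - resolvent a b f \<alpha> (\<lambda>z. h z - A \<phi> z) z"
proof -
  let ?d1 = "resolvent a b f \<alpha> (\<lambda>z. \<alpha> * \<phi> z)" and ?d2 = "resolvent a b f \<alpha> (\<lambda>z. h z - A \<phi> z)"
  have "solves \<alpha> (\<lambda>z. \<alpha> * \<phi> z + A \<phi> z) \<phi>" using phi by (simp add: solves_def)
  from solves_diff[OF this solves_diff[OF resolvent_solves(1)[OF al L2fun_scale[OF phi(1), of \<alpha>]]
      resolvent_solves(1)[OF al L2fun_diff[OF h L2_A[OF phi(1)]]]]]
  have "solves \<alpha> h (\<lambda>z. \<phi> z - (?d1 z - ?d2 z))" by simp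
  from resolvent_eqI[OF al this] show ?thesis by simp
qed

lemma noise_bound:
  assumes al: "\<alpha> > 0" and h: "L2 h" and w: "L2 w" and r: "L2 r"
    and split: "\<And>z. z \<in> {a..b} \<Longrightarrow> h z = T' w z + r z" and z: "z \<in> {a..b}"
  shows "\<bar>resolvent a b f \<alpha> h z\<bar> \<le> (\<bar>h z\<bar> + B * (nm w + nm r / (2 * sqrt \<alpha>))) / \<alpha>"
proof -
  note s = resolvent_solves(1)[OF al h]
  have "\<bar>resolvent a b f \<alpha> h z\<bar> \<le> (\<bar>h z\<bar> + B * nm (T (resolvent a b f \<alpha> h))) / \<alpha>"
    by (rule solves_sup_bound[OF al s z])
  also have "\<dots> \<le> (\<bar>h z\<bar> + B * (nm w + nm r / (2 * sqrt \<alpha>))) / \<alpha>"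
    using al B_nonneg solves_nm_T[OF al s h w r split] by (intro divide_right_mono add_left_mono mult_left_mono) auto
  finally show ?thesis .
qed

section \<open>Measurability of the coverage events\<close>

text \<open>The data enter a partial sum only through the numbers \<open>v i\<close> and
  \<open>T (e j) (y i)\<close>, so measurability passes to the limit. The evaluation point \<zeta>
  is random because data-dependent jump points will be inserted for it.\<close>

lemma smooth_measurable:
  fixes N :: "'w measure" and y v :: "nat \<Rightarrow> 'w \<Rightarrow> real" and \<zeta> :: "'w \<Rightarrow> real"
  assumes al: "\<alpha> > 0"
    and [measurable]: "\<And>i. i < n \<Longrightarrow> y i \<in> borel_measurable N" "\<And>i. i < n \<Longrightarrow> v i \<in> borel_measurable N"
      "\<zeta> \<in> borel_measurable N"
  shows "(\<lambda>\<omega>. smooth \<alpha> (\<lambda>z. (\<Sum>i<n. v i \<omega> * f (y i \<omega> - z)) / real n) (\<zeta> \<omega>)) \<in> borel_measurable N"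
proof -
  define h where "h \<omega> z = (\<Sum>i<n. v i \<omega> * f (y i \<omega> - z)) / real n" for \<omega> z
  have h': "h \<omega> = (\<lambda>z. \<Sum>i<n. (v i \<omega> / real n) * f (y i \<omega> - z))" for \<omega>
    by (rule ext) (simp add: h_def sum_divide_distrib)
  have hL: "L2 (h \<omega>)" for \<omega> unfolding h' by (intro L2fun_sum L2fun_scale L2_slice)
  have ih: "ip (h \<omega>) (e j) = (\<Sum>i<n. (v i \<omega> / real n) * T (e j) (y i \<omega>))" for \<omega> j
    unfolding h' T_ip L2inner_commute[of a b "e j"]
    by (subst L2inner_sum_left) (intro L2fun_scale L2_slice e_L2, rule e_L2, simp only: L2inner_scale_left)
  have [measurable]: "T (e j) \<in> borel_measurable borel" "A (e j) \<in> borel_measurable borel" for j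
    using L2fun_borel[OF L2_T[OF e_L2]] L2fun_borel[OF L2_A[OF e_L2]] by auto
  have "(\<lambda>\<omega>. smooth \<alpha> (h \<omega>) (\<zeta> \<omega>)) \<in> borel_measurable N"
  proof (rule borel_measurable_LIMSEQ_real)
    show "(\<lambda>K. part \<alpha> (h \<omega>) K (\<zeta> \<omega>)) \<longlonglongrightarrow> smooth \<alpha> (h \<omega>) (\<zeta> \<omega>)" for \<omega> by (rule part_tendsto[OF al hL])
    show "(\<lambda>\<omega>. part \<alpha> (h \<omega>) K (\<zeta> \<omega>)) \<in> borel_measurable N" for K
      unfolding part_def ih by measurable
  qed
  then show ?thesis by (simp add: h_def[abs_def])
qed

text \<open>\<^term>\<open>f\<close> may jump at \<^term>\<open>a\<close> and \<^term>\<open>b\<close>, so a dense set of points \<open>z\<close> does not determine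
  the supremum; the jump points, which depend measurably on the data, have to be added.\<close>

lemma band_measurable:
  fixes N :: "'w measure" and y v :: "nat \<Rightarrow> 'w \<Rightarrow> real"
  assumes al: "\<alpha> > 0" and fc: "continuous_on {a..b} f" and f0: "\<And>x. x \<notin> {a..b} \<Longrightarrow> f x = 0"
    and phi: "continuous_on {a..b} \<phi>" and phim [measurable]: "\<phi> \<in> borel_measurable borel"
    and ym [measurable]: "\<And>i. i < n \<Longrightarrow> y i \<in> borel_measurable N"
    and vm [measurable]: "\<And>i. i < n \<Longrightarrow> v i \<in> borel_measurable N"
    and qm [measurable]: "q \<in> borel_measurable N"
  shows "{\<omega> \<in> space N. \<forall>z\<in>{a..b}. \<bar>resolvent a b f \<alpha> (\<lambda>z. (\<Sum>i<n. v i \<omega> * f (y i \<omega> - z)) / real n) z - \<phi> z\<bar> \<le> q \<omega>} \<in> sets N"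
proof -
  define h where "h \<omega> z = (\<Sum>i<n. v i \<omega> * f (y i \<omega> - z)) / real n" for \<omega> z
  have hL: "L2 (h \<omega>)" for \<omega>
  proof -
    have "h \<omega> = (\<lambda>z. \<Sum>i<n. (v i \<omega> / real n) * f (y i \<omega> - z))" by (rule ext) (simp add: h_def sum_divide_distrib)
    then show ?thesis by (simp only:) (intro L2fun_sum L2fun_scale L2_slice)
  qed
  define F where "F \<omega> z = (h \<omega> z - smooth \<alpha> (h \<omega>) z) / \<alpha> - \<phi> z" for \<omega> z
  have Fm: "(\<lambda>\<omega>. F \<omega> (\<zeta> \<omega>)) \<in> borel_measurable N" if [measurable]: "\<zeta> \<in> borel_measurable N" for \<zeta>
  proof -
    have [measurable]: "(\<lambda>\<omega>. smooth \<alpha> (h \<omega>) (\<zeta> \<omega>)) \<in> borel_measurable N"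
      unfolding h_def[abs_def] by (rule smooth_measurable[OF al ym vm that])
    have [measurable]: "(\<lambda>\<omega>. h \<omega> (\<zeta> \<omega>)) \<in> borel_measurable N" unfolding h_def by measurable
    have "(\<lambda>\<omega>. (h \<omega> (\<zeta> \<omega>) - smooth \<alpha> (h \<omega>) (\<zeta> \<omega>)) / \<alpha> - \<phi> (\<zeta> \<omega>)) \<in> borel_measurable N" by measurable
    then show ?thesis unfolding F_def .
  qed
  \<comment> \<open>In the interior of [a,b] continuity is assumed; outside, \<open>f\<close>
    vanishes on a neighbourhood.\<close>
  have fcont: "isCont f x" if "x \<noteq> a" "x \<noteq> b" for x
  proof -
    consider "a < x \<and> x < b" | "x \<notin> {a..b}" using \<open>x \<noteq> a\<close> \<open>x \<noteq> b\<close> by fastforce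
    then show ?thesis
    proof cases
      case 1
      then show ?thesis using fc by (intro continuous_on_interior) auto
    next
      case 2
      have "eventually (\<lambda>x'. x' \<in> - {a..b}) (nhds x)" using 2 by (intro eventually_nhds_in_open) auto
      then have "eventually (\<lambda>x'. f x' = 0) (nhds x)" by eventually_elim (auto simp: f0)
      then show ?thesis by (simp add: isCont_cong)
    qed
  qed
  have Fcont: "continuous (at z within {a..b}) (F \<omega>)"
    if z: "z \<in> {a..b}" and nb: "\<And>i. i < n \<Longrightarrow> y i \<omega> - z \<noteq> a \<and> y i \<omega> - z \<noteq> b" for z \<omega>
  proof -
    have fi: "isCont (\<lambda>z. f (y i \<omega> - z)) z" if "i < n" for i
    proof (rule isCont_o2[where g=f])
      show "isCont (\<lambda>z. y i \<omega> - z) z" by (intro continuous_intros)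
      show "isCont f (y i \<omega> - z)" using fcont nb[OF that] by blast
    qed
    have "isCont (\<lambda>z. \<Sum>i<n. (v i \<omega> / real n) * f (y i \<omega> - z)) z"
      by (intro continuous_sum continuous_mult continuous_const fi) simp
    moreover have "(\<lambda>z. \<Sum>i<n. (v i \<omega> / real n) * f (y i \<omega> - z)) = h \<omega>"
      by (rule ext) (simp add: h_def sum_divide_distrib)
    ultimately have "continuous (at z within {a..b}) (h \<omega>)"
      by (simp add: continuous_at_imp_continuous_at_within)
    moreover have "continuous (at z within {a..b}) (smooth \<alpha> (h \<omega>))" "continuous (at z within {a..b}) \<phi>"
      using smooth_cont[OF al hL] phi z by (auto simp: continuous_on_eq_continuous_within)
    ultimately have "continuous (at z within {a..b}) (\<lambda>z. (1 / \<alpha>) * (h \<omega> z - smooth \<alpha> (h \<omega>) z) - \<phi> z)"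
      by (intro continuous_diff continuous_mult continuous_const)
    then show ?thesis by (simp add: F_def[abs_def])
  qed
  have res: "resolvent a b f \<alpha> (h \<omega>) z - \<phi> z = F \<omega> z" if "z \<in> {a..b}" for \<omega> z
    using resolvent_solves(2)[OF al hL that] by (simp add: F_def)
  \<comment> \<open>A violation at a point that is not a jump point is strict and therefore persists
    on a neighbourhood in [a,b], which contains a rational. The jump points are listed
    explicitly.\<close>
  have key: "(\<forall>z\<in>{a..b}. \<bar>F \<omega> z\<bar> \<le> q \<omega>) \<longleftrightarrow>
     (\<forall>z\<in>\<rat> \<inter> {a..b}. \<bar>F \<omega> z\<bar> \<le> q \<omega>) \<and>
     (\<forall>i\<in>{..<n}. \<forall>x\<in>{a, b}. y i \<omega> - x \<in> {a..b} \<longrightarrow> \<bar>F \<omega> (y i \<omega> - x)\<bar> \<le> q \<omega>)" (is "?L \<longleftrightarrow> ?R") for \<omega>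
  proof
    assume R: ?R
    show ?L
    proof (intro ballI, rule ccontr)
      fix z assume z: "z \<in> {a..b}" and n: "\<not> \<bar>F \<omega> z\<bar> \<le> q \<omega>"
      have nb: "y i \<omega> - z \<noteq> a \<and> y i \<omega> - z \<noteq> b" if "i < n" for i
      proof (rule ccontr)
        assume "\<not> ?thesis"
        then obtain x where "x \<in> {a, b}" "z = y i \<omega> - x" by force
        then show False using R n z that by blast
      qed
      have "continuous (at z within {a..b}) (\<lambda>z. \<bar>F \<omega> z\<bar>)" using Fcont[OF z nb] by (intro continuous_intros)
      then have "((\<lambda>z. \<bar>F \<omega> z\<bar>) \<longlongrightarrow> \<bar>F \<omega> z\<bar>) (at z within {a..b})" by (simp add: continuous_within)
      then have "eventually (\<lambda>x. \<bar>F \<omega> x\<bar> > q \<omega>) (at z within {a..b})" using n by (intro order_tendstoD(1)) auto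
      then obtain d where d: "d > 0" "\<And>x. x \<in> {a..b} \<Longrightarrow> x \<noteq> z \<Longrightarrow> dist x z < d \<Longrightarrow> \<bar>F \<omega> x\<bar> > q \<omega>"
        unfolding eventually_at by auto
      have "max a (z - d) < min b (z + d)" using d(1) z ab by auto
      then obtain x where x: "x \<in> \<rat>" "max a (z - d) < x" "x < min b (z + d)"
        using Rats_dense_in_real by blast
      then have "\<bar>F \<omega> x\<bar> > q \<omega>" using d(2)[of x] n by (cases "x = z") (auto simp: dist_real_def)
      moreover have "x \<in> \<rat> \<inter> {a..b}" using x by auto
      moreover have "\<forall>z\<in>\<rat> \<inter> {a..b}. \<bar>F \<omega> z\<bar> \<le> q \<omega>" using R by blast
      ultimately show False by (meson not_le)
    qed
  qed auto
  have c: "countable (\<rat> \<inter> {a..b})" by (simp add: countable_rat)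
  have "{\<omega> \<in> space N. (\<forall>z\<in>\<rat> \<inter> {a..b}. \<bar>F \<omega> z\<bar> \<le> q \<omega>) \<and>
     (\<forall>i\<in>{..<n}. \<forall>x\<in>{a, b}. y i \<omega> - x \<in> {a..b} \<longrightarrow> \<bar>F \<omega> (y i \<omega> - x)\<bar> \<le> q \<omega>)} \<in> sets N"
  proof (rule sets.sets_Collect_conj)
    have [measurable]: "(\<lambda>\<omega>. F \<omega> z) \<in> borel_measurable N" for z by (rule Fm) simp
    show "{\<omega> \<in> space N. \<forall>z\<in>\<rat> \<inter> {a..b}. \<bar>F \<omega> z\<bar> \<le> q \<omega>} \<in> sets N"
    proof -
      have "{\<omega> \<in> space N. \<bar>F \<omega> z\<bar> \<le> q \<omega>} \<in> sets N" for z by measurable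
      then show ?thesis using c by (rule sets.sets_Collect_countable_All')
    qed
    show "{\<omega> \<in> space N. \<forall>i\<in>{..<n}. \<forall>x\<in>{a, b}. y i \<omega> - x \<in> {a..b} \<longrightarrow> \<bar>F \<omega> (y i \<omega> - x)\<bar> \<le> q \<omega>} \<in> sets N"
    proof (intro sets.sets_Collect_countable_All')
      fix i x :: _ assume i: "i \<in> {..<n}"
      then have [measurable]: "y i \<in> borel_measurable N" by simp
      have [measurable]: "(\<lambda>\<omega>. F \<omega> (y i \<omega> - x)) \<in> borel_measurable N" by (rule Fm) simp
      show "{\<omega> \<in> space N. y i \<omega> - x \<in> {a..b} \<longrightarrow> \<bar>F \<omega> (y i \<omega> - x)\<bar> \<le> q \<omega>} \<in> sets N" by measurable
    qed auto
  qed
  then show ?thesis using key res by (simp add: h_def[abs_def] cong: conj_cong)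
qed

end

section \<open>Independent samples\<close>

text \<open>The joint law of the coordinates is the product measure itself. The index set may be
  infinite, as the Gaussian construction uses it for a whole sequence.\<close>

lemma indep_vars_PiM_coordinates:
  assumes ps: "\<And>i. prob_space (N i)" and I: "I \<noteq> {}"
  shows "prob_space.indep_vars (PiM I N) N (\<lambda>i \<omega>. \<omega> i) I"
proof -
  interpret product_prob_space N I by (intro product_prob_spaceI ps)
  have "distr (PiM I N) (PiM I N) (\<lambda>x. \<lambda>i\<in>I. x i) = distr (PiM I N) (PiM I N) (\<lambda>x. x)"
    by (rule distr_cong) (auto simp: space_PiM)
  moreover have "(\<Pi>\<^sub>M i\<in>I. distr (PiM I N) (N i) (\<lambda>\<omega>. \<omega> i)) = PiM I N"
    by (rule PiM_cong) (auto simp: PiM_component)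
  ultimately show ?thesis
    by (subst P.indep_vars_iff_distr_eq_PiM'[OF I]) (auto simp: distr_id)
qed

locale iid_sample = prob_space P for P :: "real measure" +
  assumes sets_P [measurable_cong]: "sets P = sets borel"
begin

abbreviation "S n \<equiv> \<Pi>\<^sub>M i\<in>{..<n}. P"

lemma prob_space_S: "prob_space (S n)" by (intro prob_space_PiM prob_space_axioms)

lemma coord_measurable [measurable (raw)]: "i < n \<Longrightarrow> (\<lambda>\<omega>. \<omega> i) \<in> borel_measurable (S n)"
  using measurable_component_singleton[of i "{..<n}" "\<lambda>_. P"] by (simp add: measurable_cong_sets[OF refl sets_P])

lemma distr_coord: "i < n \<Longrightarrow> distr (S n) borel (\<lambda>\<omega>. \<omega> i) = P"
proof -
  assume i: "i < n"
  have "distr (S n) borel (\<lambda>\<omega>. \<omega> i) = distr (S n) P (\<lambda>\<omega>. \<omega> i)" by (rule distr_cong) (auto simp: sets_P)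
  also have "\<dots> = P" using i by (intro distr_PiM_component prob_space_axioms) auto
  finally show ?thesis .
qed

lemma integral_coord:
  assumes "i < n" and u: "u \<in> borel_measurable borel"
  shows "(\<integral>\<omega>. u (\<omega> i) \<partial>S n) = (\<integral>y. u y \<partial>P :: real)"
proof -
  have "(\<integral>y. u y \<partial>P) = (\<integral>y. u y \<partial>distr (S n) borel (\<lambda>\<omega>. \<omega> i))" using distr_coord[OF assms(1)] by simp
  also have "\<dots> = (\<integral>\<omega>. u (\<omega> i) \<partial>S n)" using assms by (intro integral_distr) auto
  finally show ?thesis ..
qed

lemma indep_coord:
  fixes u :: "real \<Rightarrow> real"
  assumes n: "n > 0" and u: "u \<in> borel_measurable borel"
  shows "prob_space.indep_vars (S n) (\<lambda>_. borel) (\<lambda>i \<omega>. u (\<omega> i)) {..<n}"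
proof -
  interpret Sn: prob_space "S n" by (rule prob_space_S)
  have "Sn.indep_vars (\<lambda>_. P) (\<lambda>i \<omega>. \<omega> i) {..<n}"
    using n by (intro indep_vars_PiM_coordinates prob_space_axioms) auto
  moreover have "u \<in> P \<rightarrow>\<^sub>M borel" using u by (simp add: measurable_cong_sets[OF sets_P refl])
  ultimately show ?thesis using Sn.indep_vars_compose2[where Y="\<lambda>_. u" and N="\<lambda>_. borel"] by blast
qed

lemma bounded_integrable:
  fixes u :: "real \<Rightarrow> real"
  assumes "u \<in> borel_measurable borel" "\<And>y. \<bar>u y\<bar> \<le> c"
  shows "integrable P u"
  using assms by (intro integrable_const_bound[where B=c]) (auto simp: measurable_cong_sets[OF sets_P refl])

text \<open>Off-diagonal terms of the expanded square vanish by independence, and a variance is at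
  most the second moment.\<close>

lemma sample_variance:
  fixes u :: "real \<Rightarrow> real"
  assumes n: "n > 0" and u [measurable]: "u \<in> borel_measurable borel" and bd: "\<And>y. \<bar>u y\<bar> \<le> c"
  shows "(\<integral>\<omega>. ((\<Sum>i<n. u (\<omega> i)) / real n - (\<integral>y. u y \<partial>P))\<^sup>2 \<partial>S n) \<le> (\<integral>y. (u y)\<^sup>2 \<partial>P) / real n"
proof -
  interpret Sn: prob_space "S n" by (rule prob_space_S)
  define m where "m = (\<integral>y. u y \<partial>P)"
  define U where "U y = u y - m" for y
  have U [measurable]: "U \<in> borel_measurable borel" unfolding U_def[abs_def] by measurable
  have ui: "integrable P u" by (rule bounded_integrable[OF u bd])
  have c0: "c \<ge> 0" using bd[of 0] by linarith
  have mc: "\<bar>m\<bar> \<le> c"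
  proof -
    have "\<bar>m\<bar> \<le> (\<integral>y. \<bar>u y\<bar> \<partial>P)" unfolding m_def using integral_norm_bound[of P u] by simp
    also have "\<dots> \<le> (\<integral>y. c \<partial>P)" using ui bd by (intro integral_mono) auto
    finally show ?thesis by (simp add: prob_space)
  qed
  have Ub: "\<bar>U y\<bar> \<le> 2 * c" for y using bd[of y] mc by (simp add: U_def)
  have UU: "\<bar>U y * U z\<bar> \<le> (2 * c) * (2 * c)" for y z unfolding abs_mult using Ub c0 by (intro mult_mono) auto
  have EU: "(\<integral>y. U y \<partial>P) = 0" unfolding U_def using ui by (simp add: m_def prob_space)
  have int: "integrable (S n) (\<lambda>\<omega>. U (\<omega> i) * U (\<omega> j))" if "i < n" "j < n" for i j
    using that UU by (intro Sn.integrable_const_bound[where B="(2 * c) * (2 * c)"]) auto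
  have off: "(\<integral>\<omega>. U (\<omega> i) * U (\<omega> j) \<partial>S n) = 0" if ij: "i < n" "j < n" "i \<noteq> j" for i j
  proof -
    have ind: "Sn.indep_vars (\<lambda>_. borel) (\<lambda>i \<omega>. U (\<omega> i)) {i, j}"
      by (rule Sn.indep_vars_subset[OF indep_coord[OF n U]]) (use ij in auto)
    have "integrable (S n) (\<lambda>\<omega>. U (\<omega> k))" if "k < n" for k
      using that Ub by (intro Sn.integrable_const_bound[where B="2 * c"]) auto
    from Sn.indep_vars_lebesgue_integral[OF _ ind] this ij
    have "(\<integral>\<omega>. (\<Prod>k\<in>{i, j}. U (\<omega> k)) \<partial>S n) = (\<Prod>k\<in>{i, j}. \<integral>\<omega>. U (\<omega> k) \<partial>S n)" by auto
    then show ?thesis using ij integral_coord[OF ij(1) U] by (simp add: EU)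
  qed
  have diag: "(\<integral>\<omega>. U (\<omega> i) * U (\<omega> i) \<partial>S n) = (\<integral>y. U y * U y \<partial>P)" if "i < n" for i
    using integral_coord[OF that, of "\<lambda>y. U y * U y"] by simp
  have ui2: "integrable P (\<lambda>y. (u y)\<^sup>2)"
  proof (rule bounded_integrable[where c="c\<^sup>2"])
    show "\<bar>(u y)\<^sup>2\<bar> \<le> c\<^sup>2" for y using power_mono[OF bd[of y], of 2] by simp
  qed simp
  have "(\<integral>y. U y * U y \<partial>P) = (\<integral>y. (u y)\<^sup>2 - 2 * m * u y + m\<^sup>2 \<partial>P)"
    by (rule Bochner_Integration.integral_cong) (auto simp: U_def power2_eq_square algebra_simps)
  also have "\<dots> = (\<integral>y. (u y)\<^sup>2 \<partial>P) - 2 * m * m + m\<^sup>2" using ui ui2 by (simp add: prob_space m_def)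
  also have "\<dots> \<le> (\<integral>y. (u y)\<^sup>2 \<partial>P)" using zero_le_power2[of m] by (simp add: power2_eq_square)
  finally have dle: "(\<integral>y. U y * U y \<partial>P) \<le> (\<integral>y. (u y)\<^sup>2 \<partial>P)" .
  have "(\<Sum>i<n. u (\<omega> i)) / real n - m = (\<Sum>i<n. U (\<omega> i)) / real n" for \<omega>
    using n by (simp add: U_def sum_subtractf field_simps)
  then have "((\<Sum>i<n. u (\<omega> i)) / real n - m)\<^sup>2 = (\<Sum>i<n. \<Sum>j<n. U (\<omega> i) * U (\<omega> j)) / (real n)\<^sup>2" for \<omega>
    by (simp add: power_divide power2_eq_square[of "sum _ _"] sum_product)
  then have "(\<integral>\<omega>. ((\<Sum>i<n. u (\<omega> i)) / real n - m)\<^sup>2 \<partial>S n) = (\<Sum>i<n. \<Sum>j<n. \<integral>\<omega>. U (\<omega> i) * U (\<omega> j) \<partial>S n) / (real n)\<^sup>2"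
  proof -
    have "(\<integral>\<omega>. (\<Sum>i<n. \<Sum>j<n. U (\<omega> i) * U (\<omega> j)) \<partial>S n) = (\<Sum>i<n. \<integral>\<omega>. (\<Sum>j<n. U (\<omega> i) * U (\<omega> j)) \<partial>S n)"
      by (rule Bochner_Integration.integral_sum) (intro Bochner_Integration.integrable_sum int; simp)
    also have "\<dots> = (\<Sum>i<n. \<Sum>j<n. \<integral>\<omega>. U (\<omega> i) * U (\<omega> j) \<partial>S n)"
      by (intro sum.cong refl Bochner_Integration.integral_sum int) auto
    finally show ?thesis using \<open>\<And>\<omega>. ((\<Sum>i<n. u (\<omega> i)) / real n - m)\<^sup>2 = _ \<omega>\<close> by simp
  qed
  also have "(\<Sum>i<n. \<Sum>j<n. \<integral>\<omega>. U (\<omega> i) * U (\<omega> j) \<partial>S n) = (\<Sum>i<n. \<Sum>j<n. if j = i then (\<integral>y. U y * U y \<partial>P) else 0)"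
    using off diag by (intro sum.cong) auto
  also have "\<dots> = real n * (\<integral>y. U y * U y \<partial>P)" by simp
  also have "real n * (\<integral>y. U y * U y \<partial>P) / (real n)\<^sup>2 \<le> real n * (\<integral>y. (u y)\<^sup>2 \<partial>P) / (real n)\<^sup>2"
    using dle by (intro divide_right_mono mult_left_mono) auto
  also have "\<dots> = (\<integral>y. (u y)\<^sup>2 \<partial>P) / real n" using n by (simp add: power2_eq_square)
  finally show ?thesis by (simp add: m_def)
qed

text \<open>The deviation is scaled by 1 / sqrt n so that the bound is free of n. Coordinate 0
  serves as the reference variable of the identically distributed family.\<close>

lemma sample_Hoeffding:
  fixes u :: "real \<Rightarrow> real"
  assumes n: "n > 0" and u [measurable]: "u \<in> borel_measurable borel" and bd: "\<And>y. 0 \<le> u y \<and> u y \<le> c"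
    and c: "c > 0" and t: "t \<ge> 0"
  shows "measure (S n) {\<omega> \<in> space (S n). \<bar>(\<Sum>i<n. u (\<omega> i)) / real n - (\<integral>y. u y \<partial>P)\<bar> \<ge> t / sqrt (real n)}
    \<le> 2 * exp (- 2 * t\<^sup>2 / c\<^sup>2)"
proof -
  interpret Sn: prob_space "S n" by (rule prob_space_S)
  have d0: "distr (S n) borel (\<lambda>\<omega>. u (\<omega> i)) = distr P borel u" if i: "i < n" for i
  proof -
    have "distr (distr (S n) borel (\<lambda>\<omega>. \<omega> i)) borel u = distr (S n) borel (u \<circ> (\<lambda>\<omega>. \<omega> i))"
      using i by (intro distr_distr) auto
    then show ?thesis by (simp add: distr_coord[OF i] comp_def)
  qed
  interpret H: Hoeffding_ineq_iid "S n" "{..<n}" "\<lambda>i \<omega>. u (\<omega> i)" "\<lambda>\<omega>. u (\<omega> 0)" 0 c "\<integral>\<omega>. u (\<omega> 0) \<partial>S n"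
  proof unfold_locales
    show "Sn.indep_vars (\<lambda>_. borel) (\<lambda>i \<omega>. u (\<omega> i)) {..<n}" by (rule indep_coord[OF n u])
    show "distr (S n) borel (\<lambda>\<omega>. u (\<omega> i)) = distr (S n) borel (\<lambda>\<omega>. u (\<omega> 0))" if "i \<in> {..<n}" for i
      using that by (simp only: d0[OF n] d0 lessThan_iff)
    show "(\<lambda>\<omega>. u (\<omega> 0)) \<in> borel_measurable (S n)" using n by measurable
    show "AE \<omega> in S n. u (\<omega> 0) \<in> {0..c}" using bd by simp
    show "(\<integral>\<omega>. u (\<omega> 0) \<partial>S n) \<equiv> (\<integral>\<omega>. u (\<omega> 0) \<partial>S n)" by simp
  qed simp
  have "measure (S n) {\<omega> \<in> space (S n). \<bar>(\<Sum>i<n. u (\<omega> i)) / real (card {..<n}) - (\<integral>\<omega>. u (\<omega> 0) \<partial>S n)\<bar> \<ge> t / sqrt (real n)}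
      \<le> 2 * exp (- 2 * real (card {..<n}) * (t / sqrt (real n))\<^sup>2 / (c - 0)\<^sup>2)"
    by (rule H.Hoeffding_ineq_abs_ge') (use n c t in auto)
  also have "- 2 * real (card {..<n}) * (t / sqrt (real n))\<^sup>2 / (c - 0)\<^sup>2 = - 2 * t\<^sup>2 / c\<^sup>2"
    using n by (simp add: power_divide)
  finally show ?thesis using integral_coord[OF n u] by simp
qed

end

section \<open>The deconvolution model\<close>

locale decon = spectral_op +
  fixes s :: real and \<phi> :: "real \<Rightarrow> real"
  assumes s: "0 < s" "s \<le> 1"
    and f_nonneg: "\<And>x. f x \<ge> 0" and f_int: "integral\<^sup>L lborel f = 1"
    and f_cont: "continuous_on {a..b} f" and f_zero: "\<And>x. x \<notin> {a..b} \<Longrightarrow> f x = 0"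
    and hoelder: "\<And>x x'. x \<in> {a..b} \<Longrightarrow> x' \<in> {a..b} \<Longrightarrow> \<bar>f x - f x'\<bar> \<le> M * \<bar>x - x'\<bar> powr s"
    and phi_nonneg: "\<And>x. \<phi> x \<ge> 0" and phi_meas [measurable]: "\<phi> \<in> borel_measurable borel"
    and phi_int: "integral\<^sup>L lborel \<phi> = 1" and phi_cont: "continuous_on {a..b} \<phi>"
    and phi_zero: "\<And>x. x \<notin> {a..b} \<Longrightarrow> \<phi> x = 0" and phi_bd: "\<And>x. x \<in> {a..b} \<Longrightarrow> \<bar>\<phi> x\<bar> \<le> M"
    and r_zero: "\<And>x. x \<notin> {a..b} \<Longrightarrow> Top a b f \<phi> x = 0"
begin

abbreviation "r \<equiv> Top a b f \<phi>"
abbreviation "P \<equiv> Ymeasure a b f \<phi>"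

lemma phi_L2: "L2 \<phi>" by (rule L2fun_bounded[OF phi_meas phi_bd])

lemma r_meas [measurable]: "r \<in> borel_measurable borel" by (rule T_borel[OF phi_L2])

lemma integral_mu_lborel: "(\<And>x. x \<notin> {a..b} \<Longrightarrow> g x = 0) \<Longrightarrow> integral\<^sup>L (mu a b) g = (integral\<^sup>L lborel g :: real)"
proof -
  assume z: "\<And>x. x \<notin> {a..b} \<Longrightarrow> g x = 0"
  have "(\<lambda>x. indicator {a..b} x *\<^sub>R g x) = g"
  proof
    fix x show "indicator {a..b} x *\<^sub>R g x = g x" using z[of x] by (cases "x \<in> {a..b}") auto
  qed
  moreover have "integral\<^sup>L (mu a b) g = (\<integral>x. indicator {a..b} x *\<^sub>R g x \<partial>lborel)"
    by (rule integral_restrict_space) simp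
  ultimately show ?thesis by simp
qed

lemma M_pos: "M > 0"
proof (rule ccontr)
  assume "\<not> M > 0"
  then have "f = (\<lambda>_. 0)" using f_bd by (intro ext) (metis abs_le_zero_iff linorder_not_le order_trans)
  then have "integral\<^sup>L lborel f = 0" by simp
  then show False using f_int by simp
qed

lemma f_le: "f x \<le> M" using f_bd[of x] by simp

lemma r_nonneg: "r y \<ge> 0" unfolding Top_mu using phi_nonneg f_nonneg by (intro integral_nonneg_AE) auto

text \<open>\<open>r\<close> averages values of \<open>f\<close> with the density \<phi>.\<close>

lemma r_le: "r y \<le> M"
proof -
  have "r y \<le> (\<integral>z. \<phi> z * M \<partial>mu a b)" unfolding Top_mu
    using f_le phi_nonneg L2fun_integrable[OF phi_L2] L2fun_integrable_mult[OF phi_L2 L2_slice(1)]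
    by (intro integral_mono mult_left_mono) auto
  also have "\<dots> = M" using integral_mu_lborel[OF phi_zero] phi_int by simp
  finally show ?thesis .
qed

lemma lborel_integrable_density: "integral\<^sup>L lborel g = (1::real) \<Longrightarrow> integrable lborel (g :: real \<Rightarrow> real)"
  using not_integrable_integral_eq by force

text \<open>Tonelli and translation invariance: the inner integral over all y is \<phi> z times the
  mass of \<open>f\<close>.\<close>

lemma nn_integral_r: "(\<integral>\<^sup>+ y. ennreal (r y) \<partial>lborel) = 1"
proof -
  interpret finite_measure "mu a b" by (rule finite_measure_mu)
  interpret Q: pair_sigma_finite lborel "mu a b" ..
  have k: "(\<lambda>(y, z). ennreal (\<phi> z * f (y - z))) \<in> borel_measurable (lborel \<Otimes>\<^sub>M mu a b)"
  proof -
    have "(\<lambda>p. \<phi> (snd p) * f (fst p - snd p)) \<in> borel_measurable (borel \<Otimes>\<^sub>M mu a b)"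
      by (rule pair_mu_measurable(1)) measurable
    then have "(\<lambda>p. \<phi> (snd p) * f (fst p - snd p)) \<in> borel_measurable (lborel \<Otimes>\<^sub>M mu a b)"
      by (simp cong: measurable_cong_sets add: sets_pair_measure_cong[OF sets_lborel refl])
    then show ?thesis by (simp add: case_prod_beta')
  qed
  have "ennreal (r y) = (\<integral>\<^sup>+ z. ennreal (\<phi> z * f (y - z)) \<partial>mu a b)" for y
    unfolding Top_mu using phi_nonneg f_nonneg L2fun_integrable_mult[OF phi_L2 L2_slice(1)]
    by (intro nn_integral_eq_integral[symmetric]) auto
  then have "(\<integral>\<^sup>+ y. ennreal (r y) \<partial>lborel) = (\<integral>\<^sup>+ y. (\<integral>\<^sup>+ z. ennreal (\<phi> z * f (y - z)) \<partial>mu a b) \<partial>lborel)" by simp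
  also have "\<dots> = (\<integral>\<^sup>+ z. (\<integral>\<^sup>+ y. ennreal (\<phi> z * f (y - z)) \<partial>lborel) \<partial>mu a b)"
    by (rule Q.Fubini'[OF k, symmetric])
  also have "\<dots> = (\<integral>\<^sup>+ z. ennreal (\<phi> z) \<partial>mu a b)"
  proof (rule nn_integral_cong)
    fix z
    have "(\<integral>\<^sup>+ y. ennreal (\<phi> z * f (y - z)) \<partial>lborel) = ennreal (\<phi> z) * (\<integral>\<^sup>+ y. ennreal (f (y - z)) \<partial>lborel)"
      using phi_nonneg f_nonneg by (subst nn_integral_cmult[symmetric]) (auto simp: ennreal_mult)
    also have "(\<integral>\<^sup>+ y. ennreal (f (y - z)) \<partial>lborel) = (\<integral>\<^sup>+ y. ennreal (f y) \<partial>lborel)"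
      using nn_integral_real_affine[of "\<lambda>y. ennreal (f y)" 1 "- z"] by simp
    also have "\<dots> = 1" using nn_integral_eq_integral[OF lborel_integrable_density[OF f_int]] f_nonneg f_int by simp
    finally show "(\<integral>\<^sup>+ y. ennreal (\<phi> z * f (y - z)) \<partial>lborel) = ennreal (\<phi> z)" by simp
  qed
  also have "\<dots> = ennreal (integral\<^sup>L (mu a b) \<phi>)"
    using phi_nonneg L2fun_integrable[OF phi_L2] by (intro nn_integral_eq_integral) auto
  also have "\<dots> = 1" using integral_mu_lborel[OF phi_zero] phi_int by simp
  finally show ?thesis .
qed

sublocale Y: iid_sample P
proof (intro iid_sample.intro iid_sample_axioms.intro prob_spaceI)
  show "emeasure P (space P) = 1" unfolding Ymeasure_def using nn_integral_r by (subst emeasure_density) auto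
  show "sets P = sets borel" by (simp add: Ymeasure_def)
qed

lemma integral_P: assumes [measurable]: "u \<in> borel_measurable borel"
  shows "(\<integral>y. u y \<partial>P) = (\<integral>y. r y * u y \<partial>lborel :: real)" "(\<integral>y. u y \<partial>P) = (\<integral>y. r y * u y \<partial>mu a b)"
proof -
  show e: "(\<integral>y. u y \<partial>P) = (\<integral>y. r y * u y \<partial>lborel)"
    unfolding Ymeasure_def using r_nonneg by (subst integral_density) auto
  show "(\<integral>y. u y \<partial>P) = (\<integral>y. r y * u y \<partial>mu a b)"
    unfolding e using r_zero by (intro integral_mu_lborel[symmetric]) auto
qed

text \<open>T*T \<phi> is T* applied to r, hence the mean of f (Y - z). The data side of the
  estimating equation minus \<open>A \<phi>\<close> is therefore a centred empirical
  process.\<close>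

lemma A_phi: "A \<phi> z = (\<integral>y. f (y - z) \<partial>P)"
  by (simp add: A_eq Tadj_mu integral_P(2))

text \<open>Half-open because the cells of the later partition are half-open and cover exactly this
  interval.\<close>

lemma AE_P: "AE y in P. y \<in> {a..<b}"
proof -
  have "AE y in lborel. y \<noteq> b" by (rule AE_lborel_singleton)
  then have "AE y in lborel. ennreal (r y) > 0 \<longrightarrow> y \<in> {a..<b}"
  proof eventually_elim
    case (elim y)
    show ?case
    proof
      assume "ennreal (r y) > 0"
      then have "r y \<noteq> 0" by auto
      then have "y \<in> {a..b}" using r_zero by blast
      then show "y \<in> {a..<b}" using elim by auto
    qed
  qed
  then show ?thesis unfolding Ymeasure_def by (subst AE_density) auto
qed

lemma measure_P_le: assumes "A' \<in> sets borel" "emeasure lborel A' \<le> ennreal l" "l \<ge> 0"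
  shows "measure P A' \<le> M * l"
proof -
  have "emeasure P A' = (\<integral>\<^sup>+ y. ennreal (r y) * indicator A' y \<partial>lborel)"
    unfolding Ymeasure_def using assms by (subst emeasure_density) auto
  also have "\<dots> \<le> (\<integral>\<^sup>+ y. ennreal M * indicator A' y \<partial>lborel)"
    using r_le by (intro nn_integral_mono mult_right_mono ennreal_leI) auto
  also have "\<dots> = ennreal M * emeasure lborel A'" using assms by (subst nn_integral_cmult_indicator) auto
  also have "\<dots> \<le> ennreal M * ennreal l" using assms by (intro mult_left_mono) auto
  also have "\<dots> = ennreal (M * l)" using M_pos assms by (simp add: ennreal_mult)
  finally show ?thesis unfolding Y.emeasure_eq_measure using M_pos assms by (subst (asm) ennreal_le_iff) auto
qed

text \<open>The observations for which the argument \<open>y - z\<close> of the kernel comes within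
  \<Delta> of a or b, the only points where \<open>f\<close> can be discontinuous.\<close>

definition jump :: "real \<Rightarrow> real \<Rightarrow> real set" where
  "jump \<Delta> z = {y. \<bar>y - z - a\<bar> \<le> \<Delta> \<or> \<bar>y - z - b\<bar> \<le> \<Delta>}"

lemma jump_eq: "jump \<Delta> z = {z + a - \<Delta>..z + a + \<Delta>} \<union> {z + b - \<Delta>..z + b + \<Delta>}"
  by (auto simp: jump_def abs_le_iff)

lemma jump_meas [measurable]: "jump \<Delta> z \<in> sets borel" by (simp add: jump_eq)

text \<open>Two intervals of length 2 \<Delta>, under a density bounded by \<open>M\<close>.\<close>

lemma measure_jump: assumes "\<Delta> \<ge> 0" shows "measure P (jump \<Delta> z) \<le> 4 * M * \<Delta>"
proof -
  have "emeasure lborel (jump \<Delta> z) \<le> emeasure lborel {z + a - \<Delta>..z + a + \<Delta>} + emeasure lborel {z + b - \<Delta>..z + b + \<Delta>}"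
    unfolding jump_eq by (rule emeasure_subadditive) auto
  also have "\<dots> = ennreal (4 * \<Delta>)" using assms by (simp flip: ennreal_plus)
  finally have "measure P (jump \<Delta> z) \<le> M * (4 * \<Delta>)" using assms by (intro measure_P_le) auto
  then show ?thesis by (simp add: mult_ac)
qed

text \<open>A point farther than \<Delta> from both endpoints and any point within \<Delta> of it
  lie both inside or both outside [a,b]; so either the Hoelder condition applies or both values are
  0.\<close>

lemma f_modulus:
  assumes "\<bar>x - x'\<bar> \<le> \<Delta>" "\<not> \<bar>x - a\<bar> \<le> \<Delta>" "\<not> \<bar>x - b\<bar> \<le> \<Delta>"
  shows "\<bar>f x - f x'\<bar> \<le> M * \<Delta> powr s"
proof -
  have "x \<in> {a..b} \<and> x' \<in> {a..b} \<or> x \<notin> {a..b} \<and> x' \<notin> {a..b}" using assms by auto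
  then show ?thesis
  proof
    assume "x \<in> {a..b} \<and> x' \<in> {a..b}"
    then have "\<bar>f x - f x'\<bar> \<le> M * \<bar>x - x'\<bar> powr s" by (intro hoelder) auto
    also have "\<dots> \<le> M * \<Delta> powr s" using assms s M_pos by (intro mult_left_mono powr_mono2) auto
    finally show ?thesis .
  next
    assume "x \<notin> {a..b} \<and> x' \<notin> {a..b}"
    then show ?thesis using f_zero M_pos by simp
  qed
qed

lemma f_diff_le: "\<bar>f x - f x'\<bar> \<le> M"
  using f_nonneg[of x] f_nonneg[of x'] f_le[of x] f_le[of x'] by linarith

lemma f_modulus_jump:
  assumes "\<bar>y - z - x'\<bar> \<le> \<Delta>"
  shows "\<bar>f (y - z) - f x'\<bar> \<le> M * \<Delta> powr s + M * indicator (jump \<Delta> z) y"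
proof (cases "y \<in> jump \<Delta> z")
  case True
  then show ?thesis using f_diff_le[of "y - z" x'] M_pos by (simp add: add_increasing)
next
  case False
  then show ?thesis using f_modulus[of "y - z" x' \<Delta>] assms by (simp add: jump_def)
qed

section \<open>Uniform bound for the empirical process\<close>

definition emp :: "nat \<Rightarrow> (nat \<Rightarrow> real) \<Rightarrow> (real \<Rightarrow> real) \<Rightarrow> real" where
  "emp n \<omega> u = (\<Sum>i<n. u (\<omega> i)) / real n - (\<integral>y. u y \<partial>P)"

lemma emp_measurable [measurable (raw)]:
  assumes "u \<in> borel_measurable borel" shows "(\<lambda>\<omega>. emp n \<omega> u) \<in> borel_measurable (Y.S n)"
proof -
  have "(\<lambda>\<omega>. u (\<omega> i)) \<in> borel_measurable (Y.S n)" if "i \<in> {..<n}" for i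
    using measurable_compose[OF Y.coord_measurable assms] that by auto
  then show ?thesis unfolding emp_def by (intro borel_measurable_diff borel_measurable_divide borel_measurable_sum) auto
qed

text \<open>Passing from \<open>z\<close> to a nearby grid point changes the empirical mean and the
  expectation by at most the Hoelder term plus \<open>M\<close> times the mass of a jump set under
  the respective measure. The empirical mass is within \<open>\<tau>\<close> of the true one by
  \<open>g2\<close>, whence the extra \<open>M * \<tau>\<close>; the last term is
  \<open>2 * M\<close> times the bound of \<open>measure_jump\<close>.\<close>

lemma emp_sup_grid:
  assumes n: "n > 0" and K: "K > 0" and \<Delta>: "\<Delta> = (b - a) / real K"
    and g1: "\<And>k. k < K \<Longrightarrow> \<bar>emp n \<omega> (\<lambda>y. f (y - (a + real k * \<Delta>)))\<bar> \<le> \<tau>"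
    and g2: "\<And>k. k < K \<Longrightarrow> \<bar>emp n \<omega> (indicator (jump \<Delta> (a + real k * \<Delta>)))\<bar> \<le> \<tau>"
    and z: "z \<in> {a..b}"
  shows "\<bar>emp n \<omega> (\<lambda>y. f (y - z))\<bar> \<le> (1 + M) * \<tau> + 2 * M * \<Delta> powr s + 8 * M\<^sup>2 * \<Delta>"
proof -
  have D: "\<Delta> > 0" using ab K \<Delta> by simp
  \<comment> \<open>The right endpoint is treated apart, since rounding down would give the index
    \<open>K\<close>, which is not a grid index.\<close>
  have "\<exists>k<K. a + real k * \<Delta> \<le> z \<and> z \<le> a + real k * \<Delta> + \<Delta>"
  proof (cases "z = b")
    case True
    have "a + real (K - 1) * \<Delta> + \<Delta> = a + (real (K - 1) + 1) * \<Delta>" by (simp add: algebra_simps)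
    also have "\<dots> = b" using K \<Delta> by (simp add: of_nat_diff)
    finally show ?thesis using True K D by (intro exI[of _ "K - 1"]) auto
  next
    case False
    define k where "k = nat \<lfloor>(z - a) / \<Delta>\<rfloor>"
    have q0: "(z - a) / \<Delta> \<ge> 0" using z D by auto
    have k1: "real k \<le> (z - a) / \<Delta>" "(z - a) / \<Delta> < real k + 1"
      using q0 unfolding k_def by (auto simp: of_nat_nat)
    have "(z - a) / \<Delta> < real K" using False z K ab D by (simp add: \<Delta> field_simps)
    then have "k < K" using k1 by linarith
    moreover have "a + real k * \<Delta> \<le> z" "z \<le> a + real k * \<Delta> + \<Delta>"
      using k1 D by (auto simp: field_simps)
    ultimately show ?thesis by blast
  qed
  then obtain k where k: "k < K" "a + real k * \<Delta> \<le> z" "z \<le> a + real k * \<Delta> + \<Delta>" by blast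
  define zk where "zk = a + real k * \<Delta>"
  define J where "J = (indicator (jump \<Delta> zk) :: real \<Rightarrow> real)"
  have [measurable]: "J \<in> borel_measurable borel" unfolding J_def by measurable
  have mod: "\<bar>f (y - z) - f (y - zk)\<bar> \<le> M * \<Delta> powr s + M * J y" for y
  proof -
    have "\<bar>f (y - zk) - f (y - z)\<bar> \<le> M * \<Delta> powr s + M * indicator (jump \<Delta> zk) y"
      by (rule f_modulus_jump) (use k in \<open>auto simp: zk_def abs_le_iff\<close>)
    then show ?thesis by (simp add: J_def abs_minus_commute)
  qed
  have iJ: "integrable P J" by (rule Y.bounded_integrable[where c=1]) (auto simp: J_def indicator_def)
  have EJ: "(\<integral>y. J y \<partial>P) \<le> 4 * M * \<Delta>"
  proof -
    have "(\<integral>y. J y \<partial>P) = measure P (jump \<Delta> zk)" unfolding J_def by (simp add: Ymeasure_def)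
    then show ?thesis using measure_jump[of \<Delta> zk] D by simp
  qed
  define E where "E = (\<integral>y. J y \<partial>P)"
  define FJ where "FJ = (\<Sum>i<n. J (\<omega> i)) / real n"
  have eJ: "\<bar>FJ - E\<bar> \<le> \<tau>" using g2[OF k(1)] by (simp add: emp_def FJ_def E_def J_def zk_def)
  have if1: "integrable P (\<lambda>y. f (y - z))" for z by (rule Y.bounded_integrable[where c=M]) (auto simp: f_bd)
  have i1: "\<bar>(\<integral>y. f (y - z) \<partial>P) - (\<integral>y. f (y - zk) \<partial>P)\<bar> \<le> M * \<Delta> powr s + M * E"
  proof -
    have "(\<integral>y. f (y - z) \<partial>P) - (\<integral>y. f (y - zk) \<partial>P) = (\<integral>y. f (y - z) - f (y - zk) \<partial>P)" using if1 by simp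
    then have "\<bar>(\<integral>y. f (y - z) \<partial>P) - (\<integral>y. f (y - zk) \<partial>P)\<bar> \<le> (\<integral>y. \<bar>f (y - z) - f (y - zk)\<bar> \<partial>P)"
      using integral_norm_bound[of P "\<lambda>y. f (y - z) - f (y - zk)"] by simp
    also have "\<dots> \<le> (\<integral>y. M * \<Delta> powr s + M * J y \<partial>P)" using mod iJ if1 by (intro integral_mono) auto
    also have "\<dots> = M * \<Delta> powr s + M * E" using iJ by (simp add: E_def Y.prob_space)
    finally show ?thesis .
  qed
  have i2: "\<bar>(\<Sum>i<n. f (\<omega> i - z)) / real n - (\<Sum>i<n. f (\<omega> i - zk)) / real n\<bar> \<le> M * \<Delta> powr s + M * FJ"
  proof -
    have "\<bar>(\<Sum>i<n. f (\<omega> i - z)) - (\<Sum>i<n. f (\<omega> i - zk))\<bar> \<le> (\<Sum>i<n. \<bar>f (\<omega> i - z) - f (\<omega> i - zk)\<bar>)"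
      unfolding sum_subtractf[symmetric] by (rule sum_abs)
    also have "\<dots> \<le> (\<Sum>i<n. M * \<Delta> powr s + M * J (\<omega> i))" by (intro sum_mono mod)
    also have "\<dots> = real n * (M * \<Delta> powr s) + M * (\<Sum>i<n. J (\<omega> i))" by (simp add: sum.distrib sum_distrib_left)
    finally have "\<bar>(\<Sum>i<n. f (\<omega> i - z)) - (\<Sum>i<n. f (\<omega> i - zk))\<bar> / real n \<le> (real n * (M * \<Delta> powr s) + M * (\<Sum>i<n. J (\<omega> i))) / real n"
      by (intro divide_right_mono) auto
    moreover have "(real n * (M * \<Delta> powr s) + M * (\<Sum>i<n. J (\<omega> i))) / real n = M * \<Delta> powr s + M * FJ"
      using n by (simp add: FJ_def add_divide_distrib)
    moreover have "(\<Sum>i<n. f (\<omega> i - z)) / real n - (\<Sum>i<n. f (\<omega> i - zk)) / real n = ((\<Sum>i<n. f (\<omega> i - z)) - (\<Sum>i<n. f (\<omega> i - zk))) / real n"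
      by (simp add: diff_divide_distrib)
    ultimately show ?thesis by simp
  qed
  have i0: "\<bar>(\<Sum>i<n. f (\<omega> i - zk)) / real n - (\<integral>y. f (y - zk) \<partial>P)\<bar> \<le> \<tau>"
    using g1[OF k(1)] by (simp add: emp_def zk_def)
  have "M * FJ \<le> M * (E + \<tau>)" using eJ M_pos by (intro mult_left_mono) auto
  moreover have "M * E \<le> M * (4 * M * \<Delta>)" using EJ M_pos unfolding E_def by (intro mult_left_mono) auto
  ultimately have "M * FJ + M * E \<le> M * \<tau> + 8 * M\<^sup>2 * \<Delta>" by (simp add: power2_eq_square algebra_simps)
  then show ?thesis using i0 i1 i2 unfolding emp_def distrib_right by linarith
qed

text \<open>Union bound over the grid; the kernel takes values in [0, M] and the indicators in
  [0, 1], which explains the two exponents.\<close>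

lemma emp_grid_prob:
  assumes n: "n > 0" and t: "t \<ge> 0"
  shows "measure (Y.S n) {\<omega> \<in> space (Y.S n). \<exists>k<K.
      \<bar>emp n \<omega> (\<lambda>y. f (y - (a + real k * \<Delta>)))\<bar> \<ge> t / sqrt (real n) \<or>
      \<bar>emp n \<omega> (indicator (jump \<Delta> (a + real k * \<Delta>)))\<bar> \<ge> t / sqrt (real n)}
    \<le> real K * (2 * exp (- 2 * t\<^sup>2 / M\<^sup>2) + 2 * exp (- 2 * t\<^sup>2))"
proof -
  interpret Sn: prob_space "Y.S n" by (rule Y.prob_space_S)
  define E1 where "E1 k = {\<omega> \<in> space (Y.S n). \<bar>emp n \<omega> (\<lambda>y. f (y - (a + real k * \<Delta>)))\<bar> \<ge> t / sqrt (real n)}" for k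
  define E2 where "E2 k = {\<omega> \<in> space (Y.S n). \<bar>emp n \<omega> (indicator (jump \<Delta> (a + real k * \<Delta>)))\<bar> \<ge> t / sqrt (real n)}" for k
  have m1: "E1 k \<in> sets (Y.S n)" and m2: "E2 k \<in> sets (Y.S n)" for k unfolding E1_def E2_def by measurable
  have p1: "measure (Y.S n) (E1 k) \<le> 2 * exp (- 2 * t\<^sup>2 / M\<^sup>2)" for k
    unfolding E1_def emp_def using f_nonneg f_le M_pos by (intro Y.sample_Hoeffding n t) auto
  have p2: "measure (Y.S n) (E2 k) \<le> 2 * exp (- 2 * t\<^sup>2)" for k
  proof -
    have "measure (Y.S n) (E2 k) \<le> 2 * exp (- 2 * t\<^sup>2 / 1\<^sup>2)"
      unfolding E2_def emp_def by (rule Y.sample_Hoeffding[OF n _ _ _ t]) (auto simp: indicator_def)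
    then show ?thesis by simp
  qed
  have "{\<omega> \<in> space (Y.S n). \<exists>k<K.
      \<bar>emp n \<omega> (\<lambda>y. f (y - (a + real k * \<Delta>)))\<bar> \<ge> t / sqrt (real n) \<or>
      \<bar>emp n \<omega> (indicator (jump \<Delta> (a + real k * \<Delta>)))\<bar> \<ge> t / sqrt (real n)} = (\<Union>k\<in>{..<K}. E1 k \<union> E2 k)"
    unfolding E1_def E2_def by auto
  also have "measure (Y.S n) \<dots> \<le> (\<Sum>k<K. measure (Y.S n) (E1 k \<union> E2 k))"
    using m1 m2 by (intro Sn.finite_measure_subadditive_finite) auto
  also have "\<dots> \<le> (\<Sum>k<K. 2 * exp (- 2 * t\<^sup>2 / M\<^sup>2) + 2 * exp (- 2 * t\<^sup>2))"
  proof (rule sum_mono)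
    fix k
    have "measure (Y.S n) (E1 k \<union> E2 k) \<le> measure (Y.S n) (E1 k) + measure (Y.S n) (E2 k)"
      using m1 m2 by (intro measure_Un_le) auto
    then show "measure (Y.S n) (E1 k \<union> E2 k) \<le> 2 * exp (- 2 * t\<^sup>2 / M\<^sup>2) + 2 * exp (- 2 * t\<^sup>2)"
      using p1[of k] p2[of k] by linarith
  qed
  finally show ?thesis by simp
qed

section \<open>Splitting the noise at a finite resolution\<close>

context
  fixes N :: nat assumes N: "N > 0"
begin

definition width :: real where "width = (b - a) / real N"
definition cell :: "nat \<Rightarrow> real set" where "cell k = {a + real k * width..<a + real (Suc k) * width}"
text \<open>The mean of f (y - z) over y in the cell, written as an image under \<open>T'\<close> so
  that combinations of such means lie in the range of \<open>T'\<close>.\<close>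

definition avg :: "nat \<Rightarrow> real \<Rightarrow> real" where "avg k z = T' (indicator (cell k)) z / width"
definition rem :: "real \<Rightarrow> real \<Rightarrow> real" where
  "rem z y = f (y - z) - (\<Sum>k<N. indicator (cell k) y * avg k z)"
text \<open>The density of the signed measure P_n - P after averaging over each cell.\<close>

definition weight :: "nat \<Rightarrow> (nat \<Rightarrow> real) \<Rightarrow> real \<Rightarrow> real" where
  "weight n \<omega> y = (\<Sum>k<N. (emp n \<omega> (indicator (cell k)) / width) * indicator (cell k) y)"
definition residual :: "nat \<Rightarrow> (nat \<Rightarrow> real) \<Rightarrow> real \<Rightarrow> real" where
  "residual n \<omega> z = emp n \<omega> (rem z)"

lemma width_pos: "width > 0" using N ab by (simp add: width_def)

lemma cell_meas [measurable]: "cell k \<in> sets borel" by (simp add: cell_def)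

lemma cell_sub: "k < N \<Longrightarrow> cell k \<subseteq> {a..b}"
proof
  fix y assume k: "k < N" and y: "y \<in> cell k"
  have "real (Suc k) * width \<le> real N * width" using k width_pos by (intro mult_right_mono) auto
  also have "\<dots> = b - a" using N by (simp add: width_def)
  finally have "a + real (Suc k) * width \<le> b" by simp
  moreover have "0 \<le> real k * width" using width_pos by simp
  ultimately show "y \<in> {a..b}" using y by (auto simp: cell_def)
qed

lemma cell_disjoint: "i \<noteq> j \<Longrightarrow> cell i \<inter> cell j = {}"
proof -
  have *: "cell i \<inter> cell j = {}" if "i < j" for i j
  proof -
    have "real (Suc i) * width \<le> real j * width" using that width_pos by (intro mult_right_mono) auto
    then show ?thesis by (auto simp: cell_def)
  qed
  assume "i \<noteq> j"
  then show ?thesis using *[of i j] *[of j i] by (cases "i < j") auto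
qed

lemma cell_cover: assumes "y \<in> {a..<b}" shows "\<exists>k<N. y \<in> cell k"
proof -
  define k where "k = nat \<lfloor>(y - a) / width\<rfloor>"
  have "(y - a) / width \<ge> 0" using assms width_pos by auto
  then have k1: "real k \<le> (y - a) / width" "(y - a) / width < real k + 1"
    unfolding k_def by (auto simp: of_nat_nat)
  have "(y - a) / width < real N" using assms N ab by (simp add: width_def field_simps)
  then have "k < N" using k1 by linarith
  moreover have "y \<in> cell k" using k1 width_pos by (auto simp: cell_def field_simps)
  ultimately show ?thesis by blast
qed

lemma L2_cell: "L2 (indicator (cell k))" by (rule L2fun_bounded[where B=1]) auto

lemma ip_cell: assumes "i < N" shows "ip (indicator (cell i)) (indicator (cell j)) = (if i = j then width else 0)"
proof (cases "i = j")
  case True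
  have "ip (indicator (cell i)) (indicator (cell j)) = (\<integral>x. indicator (cell i) x \<partial>mu a b)"
    unfolding L2inner_mu True by (simp flip: indicator_inter_arith)
  also have "\<dots> = (\<integral>x. indicator (cell i) x \<partial>lborel)"
    by (rule integral_mu_lborel) (use cell_sub[OF assms] in \<open>auto simp: indicator_def\<close>)
  also have "\<dots> = width" using width_pos by (simp add: cell_def algebra_simps)
  finally show ?thesis using True by simp
next
  case False
  then have "(\<lambda>x. indicator (cell i) x * indicator (cell j) x) = (\<lambda>x. 0::real)"
    using cell_disjoint[OF False] by (intro ext) (auto split: split_indicator)
  then show ?thesis using False unfolding L2inner_mu by (simp only:) simp
qed

lemma avg_bounds: assumes "k < N" shows "0 \<le> avg k z" "avg k z \<le> M"
proof -
  have i: "integrable (mu a b) (\<lambda>y. indicator (cell k) y * f (y - z))" using L2fun_integrable_mult[OF L2_cell L2_slice(2)] .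
  show "0 \<le> avg k z" unfolding avg_def Tadj_mu using width_pos f_nonneg by (intro divide_nonneg_pos integral_nonneg_AE) auto
  have "T' (indicator (cell k)) z \<le> (\<integral>y. indicator (cell k) y * M \<partial>mu a b)"
    unfolding Tadj_mu using L2fun_integrable[OF L2_cell] f_le i by (intro integral_mono mult_left_mono) auto
  also have "\<dots> = M * width" using ip_cell[OF assms, of k] by (simp add: L2inner_mu flip: indicator_inter_arith)
  finally show "avg k z \<le> M" using width_pos by (simp add: avg_def pos_divide_le_eq)
qed

lemma avg_meas [measurable]: "avg k \<in> borel_measurable borel"
  using L2fun_borel[OF L2_T'[OF L2_cell]] unfolding avg_def[abs_def] by measurable

lemma rem_meas [measurable]: "rem z \<in> borel_measurable borel" unfolding rem_def[abs_def] by measurable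

lemma rem_cell: assumes "k < N" "y \<in> cell k" shows "rem z y = f (y - z) - avg k z"
proof -
  have "(\<Sum>j<N. indicator (cell j) y * avg j z) = (\<Sum>j<N. if j = k then avg k z else 0)"
    using assms(2) cell_disjoint[of _ k] by (intro sum.cong) (auto simp: indicator_def)
  then show ?thesis using assms(1) by (simp add: rem_def)
qed

lemma rem_outside: assumes "\<And>k. k < N \<Longrightarrow> y \<notin> cell k" shows "rem z y = f (y - z)"
  using assms by (simp add: rem_def)

lemma rem_bd: "\<bar>rem z y\<bar> \<le> M"
proof (cases "\<exists>k<N. y \<in> cell k")
  case True
  then obtain k where k: "k < N" "y \<in> cell k" by blast
  show ?thesis using rem_cell[OF k] avg_bounds[OF k(1), of z] f_nonneg[of "y - z"] f_le[of "y - z"] by simp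
next
  case False
  then show ?thesis using rem_outside[of y z] f_bd by auto
qed

text \<open>For y in a cell, \<open>rem z y\<close> is the mean of f (y - z) - f (x - z) over x in
  the same cell, and x is within \<open>width\<close> of y; off the jump set the modulus bound
  applies to every such x.\<close>

lemma rem_modulus: assumes "y \<in> {a..<b}" shows "\<bar>rem z y\<bar> \<le> M * width powr s + M * indicator (jump width z) y"
proof (cases "y \<in> jump width z")
  case True
  then show ?thesis using rem_bd[of z y] M_pos by (simp add: add_increasing)
next
  case False
  obtain k where k: "k < N" "y \<in> cell k" using cell_cover[OF assms] by blast
  define c where "c = M * width powr s"
  have w: "(\<integral>x. indicator (cell k) x \<partial>mu a b) = width"
    using ip_cell[OF k(1), of k] by (simp add: L2inner_mu flip: indicator_inter_arith)
  have ii: "integrable (mu a b) (indicator (cell k) :: real \<Rightarrow> real)" by (rule L2fun_integrable[OF L2_cell])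
  have i: "integrable (mu a b) (\<lambda>x. indicator (cell k) x * f (x - z))" using L2fun_integrable_mult[OF L2_cell L2_slice(2)] .
  have "f (y - z) * width - T' (indicator (cell k)) z = (\<integral>x. f (y - z) * indicator (cell k) x - indicator (cell k) x * f (x - z) \<partial>mu a b)"
    using ii i w by (simp add: Tadj_mu)
  then have "\<bar>f (y - z) * width - T' (indicator (cell k)) z\<bar> \<le> (\<integral>x. \<bar>f (y - z) * indicator (cell k) x - indicator (cell k) x * f (x - z)\<bar> \<partial>mu a b)"
    using integral_norm_bound[of "mu a b" "\<lambda>x. f (y - z) * indicator (cell k) x - indicator (cell k) x * f (x - z)"] by simp
  also have "\<dots> \<le> (\<integral>x. c * indicator (cell k) x \<partial>mu a b)"
  proof (rule integral_mono)
    fix x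
    show "\<bar>f (y - z) * indicator (cell k) x - indicator (cell k) x * f (x - z)\<bar> \<le> c * indicator (cell k) x"
    proof (cases "x \<in> cell k")
      case True
      have "\<bar>y - z - (x - z)\<bar> \<le> width" using True k(2) by (auto simp: cell_def abs_le_iff algebra_simps)
      from f_modulus_jump[OF this] show ?thesis using True False by (simp add: c_def)
    qed simp
  qed (use ii i in auto)
  also have "\<dots> = c * width" using w by simp
  finally have "\<bar>f (y - z) * width - T' (indicator (cell k)) z\<bar> / width \<le> c" using width_pos by (simp add: pos_divide_le_eq)
  moreover have "\<bar>f (y - z) * width - T' (indicator (cell k)) z\<bar> / width = \<bar>rem z y\<bar>"
  proof -
    have "rem z y = (f (y - z) * width - T' (indicator (cell k)) z) / width"
      using width_pos by (simp add: rem_cell[OF k] avg_def diff_divide_distrib)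
    then show ?thesis using width_pos by (simp add: abs_divide)
  qed
  ultimately show ?thesis using False by (simp add: c_def)
qed

text \<open>Near the jumps \<open>rem\<close> may stay of order \<open>M\<close>, but only on a set
  of small probability. Its mean square therefore tends to 0 with the cell width, uniformly in
  z.\<close>

lemma rem_second_moment: "(\<integral>y. (rem z y)\<^sup>2 \<partial>P) \<le> M\<^sup>2 * (2 * (width powr s)\<^sup>2 + 8 * M * width)"
proof -
  define J where "J = (indicator (jump width z) :: real \<Rightarrow> real)"
  have [measurable]: "J \<in> borel_measurable borel" unfolding J_def by measurable
  have iJ: "integrable P J" by (rule Y.bounded_integrable[where c=1]) (auto simp: J_def indicator_def)
  have "(\<integral>y. (rem z y)\<^sup>2 \<partial>P) \<le> (\<integral>y. 2 * (M * width powr s)\<^sup>2 + 2 * M\<^sup>2 * J y \<partial>P)"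
  proof (rule integral_mono_AE)
    have "\<bar>(rem z y)\<^sup>2\<bar> \<le> M\<^sup>2" for y using power_mono[OF rem_bd[of z y], of 2] by simp
    then show "integrable P (\<lambda>y. (rem z y)\<^sup>2)" by (intro Y.bounded_integrable) auto
    show "integrable P (\<lambda>y. 2 * (M * width powr s)\<^sup>2 + 2 * M\<^sup>2 * J y)" using iJ by auto
    show "AE y in P. (rem z y)\<^sup>2 \<le> 2 * (M * width powr s)\<^sup>2 + 2 * M\<^sup>2 * J y"
      using AE_P
    proof eventually_elim
      case (elim y)
      have "(rem z y)\<^sup>2 \<le> (M * width powr s + M * J y)\<^sup>2"
        using power_mono[OF rem_modulus[OF elim, of z], of 2] by (simp add: J_def)
      also have "\<dots> \<le> 2 * (M * width powr s)\<^sup>2 + 2 * (M * J y)\<^sup>2"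
        using sum_squares_bound[of "M * width powr s" "M * J y"] by (simp add: power2_sum)
      also have "(M * J y)\<^sup>2 = M\<^sup>2 * J y" by (auto simp: J_def indicator_def power_mult_distrib)
      finally show ?case by simp
    qed
  qed
  also have "\<dots> = 2 * (M * width powr s)\<^sup>2 + 2 * M\<^sup>2 * measure P (jump width z)"
    using iJ by (simp add: Y.prob_space) (simp add: J_def Ymeasure_def)
  also have "\<dots> \<le> 2 * (M * width powr s)\<^sup>2 + 2 * M\<^sup>2 * (4 * M * width)"
    using measure_jump[of width z] width_pos by (intro add_left_mono mult_left_mono) auto
  finally show ?thesis by (simp add: power_mult_distrib algebra_simps)
qed

lemma weight_L2: "L2 (weight n \<omega>)" unfolding weight_def[abs_def] by (intro L2fun_sum L2fun_scale L2_cell)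

lemma T'_weight: "T' (weight n \<omega>) z = (\<Sum>k<N. emp n \<omega> (indicator (cell k)) * avg k z)"
proof -
  have "T' (weight n \<omega>) z = (\<Sum>k<N. T' (\<lambda>y. (emp n \<omega> (indicator (cell k)) / width) * indicator (cell k) y) z)"
    unfolding weight_def[abs_def] by (rule T'_sum) (intro L2fun_scale L2_cell)
  then show ?thesis by (simp only: T'_scale) (simp add: avg_def)
qed

text \<open>Exact for every sample: the linear functional \<open>emp n \<omega>\<close> is applied
  to the decomposition of f (y - z) into cell means and \<open>rem\<close>.\<close>

lemma emp_split: "emp n \<omega> (\<lambda>y. f (y - z)) = T' (weight n \<omega>) z + residual n \<omega> z"
proof -
  have iI: "integrable P (\<lambda>y. indicator (cell k) y * avg k z)" for k
    by (rule Y.bounded_integrable[where c="\<bar>avg k z\<bar>"]) (auto simp: indicator_def)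
  have if1: "integrable P (\<lambda>y. f (y - z))" by (rule Y.bounded_integrable[where c=M]) (auto simp: f_bd)
  have 1: "(\<integral>y. rem z y \<partial>P) = (\<integral>y. f (y - z) \<partial>P) - (\<Sum>k<N. (\<integral>y. indicator (cell k) y \<partial>P) * avg k z)"
  proof -
    have "(\<integral>y. rem z y \<partial>P) = (\<integral>y. f (y - z) \<partial>P) - (\<integral>y. (\<Sum>k<N. indicator (cell k) y * avg k z) \<partial>P)"
      unfolding rem_def by (rule Bochner_Integration.integral_diff[OF if1]) (intro Bochner_Integration.integrable_sum iI)
    also have "(\<integral>y. (\<Sum>k<N. indicator (cell k) y * avg k z) \<partial>P) = (\<Sum>k<N. \<integral>y. indicator (cell k) y * avg k z \<partial>P)"
      by (rule Bochner_Integration.integral_sum) (rule iI)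
    finally show ?thesis by (simp only: integral_mult_left_zero)
  qed
  have 2: "(\<Sum>i<n. rem z (\<omega> i)) / real n = (\<Sum>i<n. f (\<omega> i - z)) / real n - (\<Sum>k<N. (\<Sum>i<n. indicator (cell k) (\<omega> i)) / real n * avg k z)"
  proof -
    have "(\<Sum>i<n. \<Sum>k<N. indicator (cell k) (\<omega> i) * avg k z) = (\<Sum>k<N. (\<Sum>i<n. indicator (cell k) (\<omega> i)) * avg k z)"
      by (subst sum.swap) (simp add: sum_distrib_right)
    then have "(\<Sum>i<n. rem z (\<omega> i)) = (\<Sum>i<n. f (\<omega> i - z)) - (\<Sum>k<N. (\<Sum>i<n. indicator (cell k) (\<omega> i)) * avg k z)"
      by (simp only: rem_def sum_subtractf)
    then show ?thesis by (simp only: diff_divide_distrib sum_divide_distrib[of "\<lambda>k. _ k * avg k z"] times_divide_eq_left)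
  qed
  show ?thesis unfolding T'_weight residual_def unfolding emp_def 1 2
    by (simp only: left_diff_distrib sum_subtractf)
qed

text \<open>Needed to exchange the expectation with the integral over \<open>z\<close>. Solving
  \<open>emp_split\<close> for the residual expresses it through functions whose joint measurability
  is immediate.\<close>

lemma residual_joint: "(\<lambda>(\<omega>, z). residual n \<omega> z) \<in> borel_measurable (Y.S n \<Otimes>\<^sub>M mu a b)"
proof -
  have i: "(\<lambda>x. x) \<in> mu a b \<rightarrow>\<^sub>M borel" by (rule borel_imp_mu) simp
  have z: "(\<lambda>p. snd p) \<in> borel_measurable (Y.S n \<Otimes>\<^sub>M mu a b)" by (rule measurable_compose[OF measurable_snd i])
  have w: "(\<lambda>p. g (fst p)) \<in> borel_measurable (Y.S n \<Otimes>\<^sub>M mu a b)" if "g \<in> borel_measurable (Y.S n)" for g :: "_ \<Rightarrow> real"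
    by (rule measurable_compose[OF measurable_fst that])
  have "(\<lambda>p. (\<Sum>i<n. f (fst p i - snd p)) / real n - A \<phi> (snd p) - (\<Sum>k<N. emp n (fst p) (indicator (cell k)) * avg k (snd p)))
      \<in> borel_measurable (Y.S n \<Otimes>\<^sub>M mu a b)"
  proof (intro borel_measurable_diff borel_measurable_divide borel_measurable_sum borel_measurable_times borel_measurable_const)
    show "(\<lambda>p. f (fst p i - snd p)) \<in> borel_measurable (Y.S n \<Otimes>\<^sub>M mu a b)" if "i \<in> {..<n}" for i
      using that by (intro measurable_compose[OF _ f_meas] borel_measurable_diff z w Y.coord_measurable) auto
    show "(\<lambda>p. A \<phi> (snd p)) \<in> borel_measurable (Y.S n \<Otimes>\<^sub>M mu a b)"
      by (rule measurable_compose[OF z L2fun_borel[OF L2_A[OF phi_L2]]])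
    show "(\<lambda>p. emp n (fst p) (indicator (cell k))) \<in> borel_measurable (Y.S n \<Otimes>\<^sub>M mu a b)" for k
      by (rule w) measurable
    show "(\<lambda>p. avg k (snd p)) \<in> borel_measurable (Y.S n \<Otimes>\<^sub>M mu a b)" for k
      by (rule measurable_compose[OF z avg_meas])
  qed
  moreover have "residual n \<omega> z = (\<Sum>i<n. f (\<omega> i - z)) / real n - A \<phi> z - (\<Sum>k<N. emp n \<omega> (indicator (cell k)) * avg k z)" for \<omega> z
    using emp_split[of n \<omega> z] unfolding T'_weight A_phi by (simp add: emp_def[of _ _ "\<lambda>y. f (y - z)"])
  ultimately show ?thesis by (simp add: case_prod_beta')
qed

lemma residual_L2: "L2 (residual n \<omega>)"
proof -
  have "residual n \<omega> = (\<lambda>z. (\<Sum>i<n. (1 / real n) * f (\<omega> i - z)) - A \<phi> z - T' (weight n \<omega>) z)"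
    using emp_split[of n \<omega>] by (intro ext) (simp add: emp_def[of _ _ "\<lambda>y. f (y - _)"] A_phi sum_divide_distrib algebra_simps)
  then show ?thesis by (simp only:) (intro L2fun_diff L2fun_sum L2fun_scale L2_slice L2_A phi_L2 L2_T' weight_L2)
qed

text \<open>The indicators of the cells are orthogonal with squared norm
  \<open>width\<close>.\<close>

lemma nm_weight: "(nm (weight n \<omega>))\<^sup>2 = (\<Sum>k<N. (emp n \<omega> (indicator (cell k)))\<^sup>2) / width"
proof -
  have "(nm (weight n \<omega>))\<^sup>2 = ip (weight n \<omega>) (weight n \<omega>)" by (rule L2norm_sq)
  define c where "c k = emp n \<omega> (indicator (cell k)) / width" for k
  have "ip (indicator (cell i)) (weight n \<omega>) = c i * width" if "i < N" for i
  proof -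
    have "ip (indicator (cell i)) (weight n \<omega>) = (\<Sum>k<N. c k * ip (indicator (cell i)) (indicator (cell k)))"
    proof -
      have "ip (indicator (cell i)) (weight n \<omega>) = (\<Sum>k<N. ip (indicator (cell i)) (\<lambda>y. c k * indicator (cell k) y))"
        unfolding weight_def[abs_def] c_def by (rule L2inner_sum_right) (intro L2fun_scale L2_cell)+
      then show ?thesis by (simp only: L2inner_scale_right)
    qed
    also have "\<dots> = (\<Sum>k<N. if k = i then c i * width else 0)" by (intro sum.cong) (auto simp: ip_cell that)
    finally show ?thesis using that by simp
  qed
  moreover have "ip (weight n \<omega>) (weight n \<omega>) = (\<Sum>i<N. c i * ip (indicator (cell i)) (weight n \<omega>))"
  proof -
    have "ip (\<lambda>y. \<Sum>k<N. c k * indicator (cell k) y) (weight n \<omega>) = (\<Sum>i<N. c i * ip (indicator (cell i)) (weight n \<omega>))"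
      by (subst L2inner_sum_left) (auto intro: L2fun_scale L2_cell weight_L2 simp: L2inner_scale_left)
    then show ?thesis by (simp add: weight_def[abs_def] c_def)
  qed
  ultimately have "ip (weight n \<omega>) (weight n \<omega>) = (\<Sum>i<N. c i * (c i * width))" by simp
  then show ?thesis unfolding L2norm_sq using width_pos by (simp add: c_def sum_divide_distrib power2_eq_square)
qed

text \<open>Markov's inequality for the square. The variance of a cell frequency is at most the cell
  probability divided by n; these sum to at most 1 / n, and the division by \<open>width\<close>
  brings in the factor N.\<close>

lemma weight_prob:
  assumes n: "n > 0" and tau: "\<tau> > 0"
  shows "measure (Y.S n) {\<omega> \<in> space (Y.S n). nm (weight n \<omega>) \<ge> \<tau>} \<le> real N / ((b - a) * real n * \<tau>\<^sup>2)"
proof -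
  interpret Sn: prob_space "Y.S n" by (rule Y.prob_space_S)
  have bd: "\<bar>emp n \<omega> (indicator (cell k))\<bar> \<le> 2" for \<omega> k
  proof -
    have "(\<Sum>i<n. indicator (cell k) (\<omega> i)) \<le> (\<Sum>i<n. 1 :: real)" by (intro sum_mono) (auto simp: indicator_def)
    then have "(\<Sum>i<n. indicator (cell k) (\<omega> i)) / real n \<le> (1::real)" using n by simp
    moreover have "0 \<le> (\<Sum>i<n. indicator (cell k) (\<omega> i)) / (real n)" by (intro divide_nonneg_nonneg sum_nonneg) auto
    moreover have "(\<integral>y. indicator (cell k) y \<partial>P) = measure P (cell k)" by (simp add: Ymeasure_def)
    ultimately show ?thesis unfolding emp_def using Y.prob_le_1[of "cell k"] measure_nonneg[of P "cell k"] by linarith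
  qed
  have bd2: "\<bar>(emp n \<omega> (indicator (cell k)))\<^sup>2\<bar> \<le> 4" for \<omega> k using power_mono[OF bd[of \<omega> k], of 2] by simp
  have int: "integrable (Y.S n) (\<lambda>\<omega>. (emp n \<omega> (indicator (cell k)))\<^sup>2)" for k
    by (rule Sn.integrable_const_bound[where B=4]) (use bd2 in auto)
  have v: "(\<integral>\<omega>. (emp n \<omega> (indicator (cell k)))\<^sup>2 \<partial>Y.S n) \<le> measure P (cell k) / real n" for k
  proof -
    have "(\<integral>\<omega>. (emp n \<omega> (indicator (cell k)))\<^sup>2 \<partial>Y.S n) \<le> (\<integral>y. (indicator (cell k) y)\<^sup>2 \<partial>P) / real n"
      unfolding emp_def by (rule Y.sample_variance[OF n, where c=1]) (auto simp: indicator_def)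
    also have "(\<integral>y. (indicator (cell k) y)\<^sup>2 \<partial>P) = (\<integral>y. indicator (cell k) y \<partial>P :: real)"
      by (rule Bochner_Integration.integral_cong) (auto split: split_indicator)
    also have "\<dots> = measure P (cell k)" by (simp add: Ymeasure_def)
    finally show ?thesis .
  qed
  have "(\<Sum>k<N. measure P (cell k)) = measure P (\<Union>k\<in>{..<N}. cell k)"
    by (intro Y.finite_measure_finite_Union[symmetric]) (auto simp: disjoint_family_on_def cell_disjoint Ymeasure_def)
  then have tot: "(\<Sum>k<N. measure P (cell k)) \<le> 1" by simp
  have "(\<integral>\<omega>. (nm (weight n \<omega>))\<^sup>2 \<partial>Y.S n) = (\<Sum>k<N. \<integral>\<omega>. (emp n \<omega> (indicator (cell k)))\<^sup>2 \<partial>Y.S n) / width"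
    unfolding nm_weight using int by (simp add: Bochner_Integration.integral_sum)
  also have "\<dots> \<le> (\<Sum>k<N. measure P (cell k) / real n) / width"
    using width_pos v by (intro divide_right_mono sum_mono) auto
  also have "\<dots> = (\<Sum>k<N. measure P (cell k)) / (real n * width)" by (simp add: sum_divide_distrib)
  also have "\<dots> \<le> 1 / (real n * width)" using tot width_pos by (intro divide_right_mono) auto
  also have "\<dots> = real N / ((b - a) * real n)" by (simp add: width_def)
  finally have E: "(\<integral>\<omega>. (nm (weight n \<omega>))\<^sup>2 \<partial>Y.S n) \<le> real N / ((b - a) * real n)" .
  have "{\<omega> \<in> space (Y.S n). nm (weight n \<omega>) \<ge> \<tau>} = {\<omega> \<in> space (Y.S n). (nm (weight n \<omega>))\<^sup>2 \<ge> \<tau>\<^sup>2}"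
    using tau L2norm_nonneg by (auto simp: abs_le_square_iff[symmetric])
  then have "measure (Y.S n) {\<omega> \<in> space (Y.S n). nm (weight n \<omega>) \<ge> \<tau>} \<le> (\<integral>\<omega>. (nm (weight n \<omega>))\<^sup>2 \<partial>Y.S n) / \<tau>\<^sup>2"
  proof -
    have "integrable (Y.S n) (\<lambda>\<omega>. (nm (weight n \<omega>))\<^sup>2)" unfolding nm_weight using int by simp
    from integral_Markov_inequality_measure[OF this, of "{}" "\<tau>\<^sup>2"] tau show ?thesis
      using \<open>{\<omega> \<in> space (Y.S n). nm (weight n \<omega>) \<ge> \<tau>} = _\<close> by simp
  qed
  also have "\<dots> \<le> real N / ((b - a) * real n) / \<tau>\<^sup>2" using E by (intro divide_right_mono) auto
  finally show ?thesis by (simp add: mult.assoc)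
qed

lemma nm_weight_measurable: "(\<lambda>\<omega>. nm (weight n \<omega>)) \<in> borel_measurable (Y.S n)"
proof -
  have "(\<lambda>\<omega>. sqrt ((nm (weight n \<omega>))\<^sup>2)) \<in> borel_measurable (Y.S n)" unfolding nm_weight by measurable
  then show ?thesis by (simp add: L2norm_nonneg)
qed

lemma nn_integral_residual: "(\<integral>\<^sup>+ z. ennreal ((residual n \<omega> z)\<^sup>2) \<partial>mu a b) = ennreal ((nm (residual n \<omega>))\<^sup>2)"
  using residual_L2[of n \<omega>] by (subst nn_integral_eq_integral) (auto simp: L2fun_mu L2norm_mu)

lemma nm_residual_measurable: "(\<lambda>\<omega>. nm (residual n \<omega>)) \<in> borel_measurable (Y.S n)"
proof -
  interpret mu: finite_measure "mu a b" by (rule finite_measure_mu)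
  have m: "(\<lambda>(\<omega>, z). ennreal ((residual n \<omega> z)\<^sup>2)) \<in> borel_measurable (Y.S n \<Otimes>\<^sub>M mu a b)"
    using residual_joint[of n] by (simp add: case_prod_beta')
  have "(\<lambda>\<omega>. \<integral>\<^sup>+ z. ennreal ((residual n \<omega> z)\<^sup>2) \<partial>mu a b) \<in> borel_measurable (Y.S n)"
    using mu.borel_measurable_nn_integral[OF m] by simp
  from borel_measurable_enn2real[OF this] have "(\<lambda>\<omega>. (nm (residual n \<omega>))\<^sup>2) \<in> borel_measurable (Y.S n)"
    unfolding nn_integral_residual by simp
  then have "(\<lambda>\<omega>. sqrt ((nm (residual n \<omega>))\<^sup>2)) \<in> borel_measurable (Y.S n)" by measurable
  then show ?thesis by (simp add: L2norm_nonneg)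
qed

text \<open>Tonelli reduces the mean squared norm to the variance at each fixed \<open>z\<close>,
  which is at most the second moment of \<open>rem z\<close> divided by n.\<close>

lemma residual_prob:
  assumes n: "n > 0" and tau: "\<tau> > 0"
  shows "measure (Y.S n) {\<omega> \<in> space (Y.S n). nm (residual n \<omega>) \<ge> \<tau>}
    \<le> (b - a) * (M\<^sup>2 * (2 * (width powr s)\<^sup>2 + 8 * M * width)) / (real n * \<tau>\<^sup>2)"
proof -
  interpret Sn: prob_space "Y.S n" by (rule Y.prob_space_S)
  interpret mu: finite_measure "mu a b" by (rule finite_measure_mu)
  interpret Q: pair_sigma_finite "Y.S n" "mu a b" ..
  define \<epsilon> where "\<epsilon> = M\<^sup>2 * (2 * (width powr s)\<^sup>2 + 8 * M * width)"
  have e0: "\<epsilon> \<ge> 0" unfolding \<epsilon>_def using M_pos width_pos by simp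
  have m: "(\<lambda>(\<omega>, z). ennreal ((residual n \<omega> z)\<^sup>2)) \<in> borel_measurable (Y.S n \<Otimes>\<^sub>M mu a b)"
    using residual_joint[of n] by (simp add: case_prod_beta')
  have "(\<integral>\<^sup>+ \<omega>. ennreal ((nm (residual n \<omega>))\<^sup>2) \<partial>Y.S n) = (\<integral>\<^sup>+ z. (\<integral>\<^sup>+ \<omega>. ennreal ((residual n \<omega> z)\<^sup>2) \<partial>Y.S n) \<partial>mu a b)"
    unfolding nn_integral_residual[symmetric] by (rule Q.Fubini'[OF m, symmetric])
  also have "\<dots> \<le> (\<integral>\<^sup>+ z. ennreal (\<epsilon> / real n) \<partial>mu a b)"
  proof (rule nn_integral_mono)
    fix z
    have bd: "\<bar>residual n \<omega> z\<bar> \<le> 2 * M" for \<omega>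
    proof -
      have "\<bar>\<Sum>i<n. rem z (\<omega> i)\<bar> \<le> (\<Sum>i<n. M)" by (rule order_trans[OF sum_abs sum_mono]) (rule rem_bd)
      then have "\<bar>(\<Sum>i<n. rem z (\<omega> i)) / real n\<bar> \<le> M" using n by (simp add: pos_divide_le_eq mult.commute)
      moreover have "\<bar>\<integral>y. rem z y \<partial>P\<bar> \<le> M"
      proof -
        have "\<bar>\<integral>y. rem z y \<partial>P\<bar> \<le> (\<integral>y. \<bar>rem z y\<bar> \<partial>P)" using integral_norm_bound[of P "rem z"] by simp
        also have "\<dots> \<le> (\<integral>y. M \<partial>P)" using rem_bd M_pos
          by (intro integral_mono Y.bounded_integrable[where c=M]) auto
        finally show ?thesis by (simp add: Y.prob_space)
      qed
      ultimately show ?thesis unfolding residual_def emp_def by linarith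
    qed
    have bd2: "\<bar>(residual n \<omega> z)\<^sup>2\<bar> \<le> (2 * M)\<^sup>2" for \<omega> using power_mono[OF bd[of \<omega>], of 2] by simp
    have mz: "(\<lambda>\<omega>. residual n \<omega> z) \<in> borel_measurable (Y.S n)" unfolding residual_def by measurable
    have int: "integrable (Y.S n) (\<lambda>\<omega>. (residual n \<omega> z)\<^sup>2)"
      by (rule Sn.integrable_const_bound[where B="(2 * M)\<^sup>2"]) (use bd2 mz in auto)
    have "(\<integral>\<omega>. (residual n \<omega> z)\<^sup>2 \<partial>Y.S n) \<le> (\<integral>y. (rem z y)\<^sup>2 \<partial>P) / real n"
      unfolding residual_def emp_def by (rule Y.sample_variance[OF n rem_meas rem_bd])
    also have "\<dots> \<le> \<epsilon> / real n" unfolding \<epsilon>_def by (intro divide_right_mono rem_second_moment) auto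
    finally show "(\<integral>\<^sup>+ \<omega>. ennreal ((residual n \<omega> z)\<^sup>2) \<partial>Y.S n) \<le> ennreal (\<epsilon> / real n)"
      using int by (subst nn_integral_eq_integral) (auto intro: ennreal_leI)
  qed
  also have "\<dots> = ennreal (\<epsilon> / real n * (b - a))"
    using ab e0 by (simp add: emeasure_restrict_space space_restrict_space flip: ennreal_mult)
  finally have E: "(\<integral>\<^sup>+ \<omega>. ennreal ((nm (residual n \<omega>))\<^sup>2) \<partial>Y.S n) \<le> ennreal (\<epsilon> / real n * (b - a))" .
  have mr: "(\<lambda>\<omega>. (nm (residual n \<omega>))\<^sup>2) \<in> borel_measurable (Y.S n)"
    using nm_residual_measurable by measurable
  \<comment> \<open>Integrability is a consequence of the finite bound on the extended integral,
    which is why the computation above is done with nonnegative integrals.\<close>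
  have int: "integrable (Y.S n) (\<lambda>\<omega>. (nm (residual n \<omega>))\<^sup>2)"
    using mr E by (intro integrableI_nonneg) (auto intro: le_less_trans)
  have E': "(\<integral>\<omega>. (nm (residual n \<omega>))\<^sup>2 \<partial>Y.S n) \<le> \<epsilon> / real n * (b - a)"
    using E e0 ab by (subst (asm) nn_integral_eq_integral[OF int]) (auto simp: ennreal_le_iff)
  have "{\<omega> \<in> space (Y.S n). nm (residual n \<omega>) \<ge> \<tau>} = {\<omega> \<in> space (Y.S n). (nm (residual n \<omega>))\<^sup>2 \<ge> \<tau>\<^sup>2}"
    using tau L2norm_nonneg by (auto simp: abs_le_square_iff[symmetric])
  then have "measure (Y.S n) {\<omega> \<in> space (Y.S n). nm (residual n \<omega>) \<ge> \<tau>} \<le> (\<integral>\<omega>. (nm (residual n \<omega>))\<^sup>2 \<partial>Y.S n) / \<tau>\<^sup>2"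
    using integral_Markov_inequality_measure[of "Y.S n" "\<lambda>\<omega>. (nm (residual n \<omega>))\<^sup>2" "{}" "\<tau>\<^sup>2"] tau int by simp
  also have "\<dots> \<le> \<epsilon> / real n * (b - a) / \<tau>\<^sup>2" using E' by (intro divide_right_mono) auto
  also have "\<dots> = (b - a) * \<epsilon> / (real n * \<tau>\<^sup>2)" by simp
  finally show ?thesis unfolding \<epsilon>_def .
qed

end

section \<open>The estimation error for one sample size\<close>

lemma empirical_eq_emp: "(\<Sum>i<n. f (\<omega> i - z)) / real n - A \<phi> z = emp n \<omega> (\<lambda>y. f (y - z))"
  by (simp add: emp_def A_phi)

text \<open>The parameters \<open>K\<close>, \<open>N\<close>, \<open>t\<close>,
  \<open>\<tau>1\<close>, \<open>\<tau>2\<close> are left free and tuned later. The three subtracted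
  terms bound the probabilities that the grid deviations, the weight or the residual are large; off
  these events the bias and the noise together stay below \<open>q\<close>.\<close>

lemma estimation_error_bound:
  assumes al: "\<alpha> > 0" and n: "n > 0" and K: "K > 0" and N: "N > 0" and t: "t \<ge> 0" and tau: "\<tau>1 > 0" "\<tau>2 > 0"
    and be: "\<beta> \<ge> 0" and psi: "L2 \<psi>" "nm \<psi> \<le> C"
    and conv: "(\<lambda>N. nm (\<lambda>z. \<phi> z - (\<Sum>j<N. lam j powr \<beta> * ip (T' \<psi>) (e j) * e j z))) \<longlonglongrightarrow> 0"
    and q: "B * (\<alpha> powr (min \<beta> 1) * (max 1 ((B * sqrt (b - a))\<^sup>2)) powr \<beta> * C) +
      ((1 + M) * (t / sqrt (real n)) + 2 * M * ((b - a) / real K) powr s + 8 * M\<^sup>2 * ((b - a) / real K)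
        + B * (\<tau>1 + \<tau>2 / (2 * sqrt \<alpha>))) / \<alpha> \<le> q"
  shows "measure (Y.S n) {\<omega> \<in> space (Y.S n). \<forall>z\<in>{a..b}.
      \<bar>resolvent a b f \<alpha> (\<lambda>z. (\<Sum>i<n. f (\<omega> i - z)) / real n) z - \<phi> z\<bar> \<le> q}
    \<ge> 1 - (real K * (2 * exp (- 2 * t\<^sup>2 / M\<^sup>2) + 2 * exp (- 2 * t\<^sup>2))
       + real N / ((b - a) * real n * \<tau>1\<^sup>2)
       + (b - a) * (M\<^sup>2 * (2 * (((b - a) / real N) powr s)\<^sup>2 + 8 * M * ((b - a) / real N))) / (real n * \<tau>2\<^sup>2))"
proof -
  interpret Sn: prob_space "Y.S n" by (rule Y.prob_space_S)
  define \<Delta> where "\<Delta> = (b - a) / real K"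
  define bad1 where "bad1 = {\<omega> \<in> space (Y.S n). \<exists>k<K.
      \<bar>emp n \<omega> (\<lambda>y. f (y - (a + real k * \<Delta>)))\<bar> \<ge> t / sqrt (real n) \<or>
      \<bar>emp n \<omega> (indicator (jump \<Delta> (a + real k * \<Delta>)))\<bar> \<ge> t / sqrt (real n)}"
  define bad2 where "bad2 = {\<omega> \<in> space (Y.S n). nm (weight N n \<omega>) \<ge> \<tau>1}"
  define bad3 where "bad3 = {\<omega> \<in> space (Y.S n). nm (residual N n \<omega>) \<ge> \<tau>2}"
  define good where "good = {\<omega> \<in> space (Y.S n). \<forall>z\<in>{a..b}.
      \<bar>resolvent a b f \<alpha> (\<lambda>z. (\<Sum>i<n. f (\<omega> i - z)) / real n) z - \<phi> z\<bar> \<le> q}"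
  have m1: "bad1 \<in> sets (Y.S n)" unfolding bad1_def by measurable
  have m2: "bad2 \<in> sets (Y.S n)" and m3: "bad3 \<in> sets (Y.S n)"
    unfolding bad2_def bad3_def using nm_weight_measurable[OF N] nm_residual_measurable[OF N] by measurable
  have mg: "good \<in> sets (Y.S n)"
    unfolding good_def
    using band_measurable[OF al f_cont f_zero phi_cont phi_meas, of n "\<lambda>i \<omega>. \<omega> i" "Y.S n" "\<lambda>i \<omega>. 1" "\<lambda>_. q"]
    by (simp add: Y.coord_measurable)
  have sub: "space (Y.S n) - (bad1 \<union> bad2 \<union> bad3) \<subseteq> good"
  proof
    fix \<omega> assume w: "\<omega> \<in> space (Y.S n) - (bad1 \<union> bad2 \<union> bad3)"
    have g1: "\<bar>emp n \<omega> (\<lambda>y. f (y - (a + real k * \<Delta>)))\<bar> \<le> t / sqrt (real n)"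
      and g2: "\<bar>emp n \<omega> (indicator (jump \<Delta> (a + real k * \<Delta>)))\<bar> \<le> t / sqrt (real n)" if "k < K" for k
      using w that unfolding bad1_def by (auto simp: not_le dest: less_imp_le)
    have w1: "nm (weight N n \<omega>) \<le> \<tau>1" and w2: "nm (residual N n \<omega>) \<le> \<tau>2"
      using w by (auto simp: bad2_def bad3_def)
    define h where "h z = (\<Sum>i<n. f (\<omega> i - z)) / real n" for z
    have hL: "L2 h"
    proof -
      have "h = (\<lambda>z. \<Sum>i<n. (1 / real n) * f (\<omega> i - z))" by (rule ext) (simp add: h_def sum_divide_distrib)
      then show ?thesis by (simp only:) (intro L2fun_sum L2fun_scale L2_slice)
    qed
    have hL': "L2 (\<lambda>z. h z - A \<phi> z)" by (intro L2fun_diff hL L2_A phi_L2)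
    have he: "h z - A \<phi> z = emp n \<omega> (\<lambda>y. f (y - z))" for z unfolding h_def by (rule empirical_eq_emp)
    have "\<bar>resolvent a b f \<alpha> h z - \<phi> z\<bar> \<le> q" if z: "z \<in> {a..b}" for z
    proof -
      have bias: "\<bar>resolvent a b f \<alpha> (\<lambda>z. \<alpha> * \<phi> z) z\<bar> \<le> B * (\<alpha> powr (min \<beta> 1) * (max 1 ((B * sqrt (b - a))\<^sup>2)) powr \<beta> * C)"
        using bias_bound[OF al be phi_L2 phi_cont psi(1) conv z] psi(2) B_nonneg
        by (elim order_trans) (intro mult_left_mono, auto)
      have "\<bar>resolvent a b f \<alpha> (\<lambda>z. h z - A \<phi> z) z\<bar> \<le> (\<bar>h z - A \<phi> z\<bar> + B * (nm (weight N n \<omega>) + nm (residual N n \<omega>) / (2 * sqrt \<alpha>))) / \<alpha>"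
        by (rule noise_bound[OF al hL' weight_L2[OF N] residual_L2[OF N] _ z]) (simp only: he emp_split[OF N])
      also have "\<dots> \<le> ((1 + M) * (t / sqrt (real n)) + 2 * M * \<Delta> powr s + 8 * M\<^sup>2 * \<Delta> + B * (\<tau>1 + \<tau>2 / (2 * sqrt \<alpha>))) / \<alpha>"
        using al w1 w2 B_nonneg emp_sup_grid[OF n K \<Delta>_def g1 g2 z] unfolding he
        by (intro divide_right_mono add_mono mult_left_mono) auto
      finally show ?thesis using bias q error_decomposition[OF al hL phi_L2 phi_zero, of z] unfolding \<Delta>_def by linarith
    qed
    then show "\<omega> \<in> good" using w unfolding good_def h_def[abs_def] by auto
  qed
  have "measure (Y.S n) (bad1 \<union> bad2 \<union> bad3) \<le> measure (Y.S n) bad1 + measure (Y.S n) bad2 + measure (Y.S n) bad3"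
    using m1 m2 m3 by (intro order_trans[OF measure_Un_le] add_mono order_refl) auto
  moreover have "measure (Y.S n) bad1 \<le> real K * (2 * exp (- 2 * t\<^sup>2 / M\<^sup>2) + 2 * exp (- 2 * t\<^sup>2))"
    unfolding bad1_def by (rule emp_grid_prob[OF n t])
  moreover have "measure (Y.S n) bad2 \<le> real N / ((b - a) * real n * \<tau>1\<^sup>2)"
    unfolding bad2_def by (rule weight_prob[OF N n tau(1)])
  moreover have "measure (Y.S n) bad3 \<le> (b - a) * (M\<^sup>2 * (2 * (((b - a) / real N) powr s)\<^sup>2 + 8 * M * ((b - a) / real N))) / (real n * \<tau>2\<^sup>2)"
    unfolding bad3_def using residual_prob[OF N n tau(2)] unfolding width_def[OF N] .
  moreover have "1 - measure (Y.S n) (bad1 \<union> bad2 \<union> bad3) \<le> measure (Y.S n) good"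
  proof -
    have "1 - measure (Y.S n) (bad1 \<union> bad2 \<union> bad3) = measure (Y.S n) (space (Y.S n) - (bad1 \<union> bad2 \<union> bad3))"
      using m1 m2 m3 by (intro Sn.prob_compl[symmetric]) auto
    also have "\<dots> \<le> measure (Y.S n) good" using sub mg by (intro Sn.finite_measure_mono)
    finally show ?thesis .
  qed
  ultimately show ?thesis unfolding good_def by linarith
qed

end

section \<open>Joint laws are determined by linear combinations\<close>

text \<open>Divided by their common mass, the weights are probability densities, and the assumptions
  \<open>ceq\<close> and \<open>seq\<close> say that \<open>X\<close> and \<open>Y\<close> have the
  same characteristic function under them. Nonnegativity of the weights is what brings the
  uniqueness theorem for laws into play; mass 0 is treated apart.\<close>

lemma weighted_law_unique:
  fixes X :: "'a \<Rightarrow> real" and Y :: "'b \<Rightarrow> real" and w :: "'a \<Rightarrow> real" and v :: "'b \<Rightarrow> real"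
  assumes "prob_space M1" "prob_space M2"
    and [measurable]: "X \<in> borel_measurable M1" "Y \<in> borel_measurable M2"
      "w \<in> borel_measurable M1" "v \<in> borel_measurable M2" "D \<in> sets borel"
    and w0: "\<And>x. 0 \<le> w x" "\<And>x. w x \<le> C" and v0: "\<And>x. 0 \<le> v x" "\<And>x. v x \<le> C"
    and ceq: "\<And>t. (\<integral>x. w x * cos (t * X x) \<partial>M1) = (\<integral>x. v x * cos (t * Y x) \<partial>M2)"
    and seq: "\<And>t. (\<integral>x. w x * sin (t * X x) \<partial>M1) = (\<integral>x. v x * sin (t * Y x) \<partial>M2)"
  shows "(\<integral>x. w x * indicator D (X x) \<partial>M1) = (\<integral>x. v x * indicator D (Y x) \<partial>M2)"
proof -
  interpret M1: prob_space M1 by fact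
  interpret M2: prob_space M2 by fact
  have wi: "integrable M1 w" by (rule M1.integrable_const_bound[where B=C]) (use w0 in auto)
  have vi: "integrable M2 v" by (rule M2.integrable_const_bound[where B=C]) (use v0 in auto)
  define m where "m = (\<integral>x. w x \<partial>M1)"
  have m2: "m = (\<integral>x. v x \<partial>M2)" using ceq[of 0] by (simp add: m_def)
  have m0: "m \<ge> 0" unfolding m_def using w0 by (intro integral_nonneg_AE) auto
  show ?thesis
  proof (cases "m = 0")
    case True
    have "AE x in M1. w x = 0" using True wi w0 unfolding m_def by (subst integral_nonneg_eq_0_iff_AE[symmetric]) auto
    then have "(\<integral>x. w x * indicator D (X x) \<partial>M1) = 0" by (intro integral_eq_zero_AE) auto
    moreover have "AE x in M2. v x = 0" using True vi v0 unfolding m2 by (subst integral_nonneg_eq_0_iff_AE[symmetric]) auto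
    then have "(\<integral>x. v x * indicator D (Y x) \<partial>M2) = 0" by (intro integral_eq_zero_AE) auto
    ultimately show ?thesis by simp
  next
    case False
    then have mp: "m > 0" using m0 by simp
    \<comment> \<open>Stated for an arbitrary space because it is used for \<open>M1\<close> and for
      \<open>M2\<close>, which have different types.\<close>
    have gen: "real_distribution (distr (density N (\<lambda>x. ennreal (u x / m))) borel Z) \<and>
        (\<forall>t. Re (char (distr (density N (\<lambda>x. ennreal (u x / m))) borel Z) t) = (\<integral>x. u x * cos (t * Z x) \<partial>N) / m) \<and>
        (\<forall>t. Im (char (distr (density N (\<lambda>x. ennreal (u x / m))) borel Z) t) = (\<integral>x. u x * sin (t * Z x) \<partial>N) / m) \<and>
        measure (distr (density N (\<lambda>x. ennreal (u x / m))) borel Z) D = (\<integral>x. u x * indicator D (Z x) \<partial>N) / m"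
      if N: "prob_space N" and [measurable]: "u \<in> borel_measurable N" "Z \<in> borel_measurable N"
        and u0: "\<And>x. 0 \<le> u x" and uC: "\<And>x. u x \<le> C" and um: "(\<integral>x. u x \<partial>N) = m" for N :: "'c measure" and u Z
    proof (intro conjI allI)
      interpret N: prob_space N by fact
      have ui: "integrable N u" by (rule N.integrable_const_bound[where B=C]) (use u0 uC in auto)
      let ?d = "density N (\<lambda>x. ennreal (u x / m))"
      have "emeasure ?d (space ?d) = (\<integral>\<^sup>+ x. ennreal (u x / m) \<partial>N)"
        by (subst emeasure_density) (auto intro!: nn_integral_cong)
      also have "\<dots> = ennreal (\<integral>x. u x / m \<partial>N)" using ui u0 mp by (intro nn_integral_eq_integral) auto
      also have "\<dots> = 1" using um mp by simp
      finally have ps: "prob_space ?d" by (rule prob_spaceI)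
      interpret dd: prob_space ?d by (rule ps)
      show "real_distribution (distr ?d borel Z)"
        by (intro real_distribution.intro real_distribution_axioms.intro dd.prob_space_distr) auto
      have ch: "char (distr ?d borel Z) t = (\<integral>x. (u x / m) *\<^sub>R iexp (t * Z x) \<partial>N)" for t
        unfolding char_def using u0 mp by (subst integral_distr, simp, simp, subst integral_density) auto
      have ic: "integrable N (\<lambda>x. (u x / m) *\<^sub>R iexp (t * Z x))" for t
        by (rule N.integrable_const_bound[where B="C / m"])
           (use u0 uC mp in \<open>auto simp: norm_mult divide_right_mono intro!: AE_I2\<close>)
      show "Re (char (distr ?d borel Z) t) = (\<integral>x. u x * cos (t * Z x) \<partial>N) / m" for t
        unfolding ch integral_Re[OF ic, symmetric] by (simp add: Re_exp)
      show "Im (char (distr ?d borel Z) t) = (\<integral>x. u x * sin (t * Z x) \<partial>N) / m" for t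
        unfolding ch integral_Im[OF ic, symmetric] by (simp add: Im_exp)
      have "measure (distr ?d borel Z) D = (\<integral>x. indicator D x \<partial>distr ?d borel Z)" by simp
      also have "\<dots> = (\<integral>x. (u x / m) *\<^sub>R indicator D (Z x) \<partial>N)"
        using u0 mp by (subst integral_distr, simp, simp, subst integral_density) auto
      finally show "measure (distr ?d borel Z) D = (\<integral>x. u x * indicator D (Z x) \<partial>N) / m" by simp
    qed
    note g1 = gen[OF assms(1) assms(5,3) w0 m_def[symmetric]]
    note g2 = gen[OF assms(2) assms(6,4) v0 m2[symmetric]]
    have "char (distr (density M1 (\<lambda>x. ennreal (w x / m))) borel X) = char (distr (density M2 (\<lambda>x. ennreal (v x / m))) borel Y)"
      by (rule ext, rule complex_eqI) (simp_all add: g1 g2 ceq seq)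
    then have "distr (density M1 (\<lambda>x. ennreal (w x / m))) borel X = distr (density M2 (\<lambda>x. ennreal (v x / m))) borel Y"
      using g1 g2 by (intro Levy_uniqueness) auto
    then have "(\<integral>x. w x * indicator D (X x) \<partial>M1) / m = (\<integral>x. v x * indicator D (Y x) \<partial>M2) / m"
      using g1 g2 by metis
    then show ?thesis using mp by simp
  qed
qed

text \<open>Induction on the number k of coordinates that have been moved from the argument of a
  cosine into indicators of the sets \<open>D i\<close>. For k = 0 the assumption on linear
  combinations applies; for k = n and phase 0 the cosine is 1 and the integral is the desired
  probability.\<close>

lemma joint_law_unique:
  fixes X :: "nat \<Rightarrow> 'a \<Rightarrow> real" and Y :: "nat \<Rightarrow> 'b \<Rightarrow> real"
  assumes p1: "prob_space M1" and p2: "prob_space M2"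
    and Xm: "\<And>i. i < n \<Longrightarrow> X i \<in> borel_measurable M1" and Ym: "\<And>i. i < n \<Longrightarrow> Y i \<in> borel_measurable M2"
    and lin: "\<And>c. distr M1 borel (\<lambda>x. \<Sum>i<n. c i * X i x) = distr M2 borel (\<lambda>x. \<Sum>i<n. c i * Y i x)"
    and D: "\<And>i. i < n \<Longrightarrow> D i \<in> sets borel"
  shows "measure M1 {x \<in> space M1. \<forall>i<n. X i x \<in> D i} = measure M2 {x \<in> space M2. \<forall>i<n. Y i x \<in> D i}"
proof -
  interpret M1: prob_space M1 by fact
  interpret M2: prob_space M2 by fact
  \<comment> \<open>The phase \<theta> makes one real family suffice: sines are cosines shifted by
    pi / 2.\<close>
  define \<Phi> where "\<Phi> k \<theta> c z = (\<Prod>i<k. indicator (D i) (z i)) * cos (\<theta> + (\<Sum>i\<in>{k..<n}. c i * z i))"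
    for k \<theta> c and z :: "nat \<Rightarrow> real"
  define Pd where "Pd k z = (\<Prod>i<k. indicator (D i) (z i) :: real)" for k and z :: "nat \<Rightarrow> real"
  have key: "k \<le> n \<Longrightarrow> (\<integral>x. \<Phi> k \<theta> c (\<lambda>i. X i x) \<partial>M1) = (\<integral>x. \<Phi> k \<theta> c (\<lambda>i. Y i x) \<partial>M2)" for k \<theta> c
  proof (induction k arbitrary: \<theta> c)
    case 0
    have m1: "(\<lambda>x. \<Sum>i<n. c i * X i x) \<in> borel_measurable M1" and m2: "(\<lambda>x. \<Sum>i<n. c i * Y i x) \<in> borel_measurable M2"
      using Xm Ym by (auto intro!: borel_measurable_sum borel_measurable_times)
    have "(\<integral>x. \<Phi> 0 \<theta> c (\<lambda>i. X i x) \<partial>M1) = (\<integral>u. cos (\<theta> + u) \<partial>distr M1 borel (\<lambda>x. \<Sum>i<n. c i * X i x))"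
      using m1 by (subst integral_distr) (auto simp: \<Phi>_def atLeast0LessThan)
    also have "\<dots> = (\<integral>x. \<Phi> 0 \<theta> c (\<lambda>i. Y i x) \<partial>M2)"
      unfolding lin using m2 by (subst integral_distr) (auto simp: \<Phi>_def atLeast0LessThan)
    finally show ?case .
  next
    case (Suc k)
    then have k: "k < n" and IH: "\<And>\<theta> c. (\<integral>x. \<Phi> k \<theta> c (\<lambda>i. X i x) \<partial>M1) = (\<integral>x. \<Phi> k \<theta> c (\<lambda>i. Y i x) \<partial>M2)" by auto
    have split: "{k..<n} = insert k {Suc k..<n}" using k by auto
    have sum_upd: "(\<Sum>i\<in>{k..<n}. (c(k := t)) i * z i) = t * z k + (\<Sum>i\<in>{Suc k..<n}. c i * z i)"
      for c t and z :: "nat \<Rightarrow> real"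
      unfolding split by simp
    have pd01: "0 \<le> Pd k z" "Pd k z \<le> 1" for z :: "nat \<Rightarrow> real"
      unfolding Pd_def by (auto intro: prod_nonneg prod_le_1)
    \<comment> \<open>Adding 1 to the cosine makes the weight nonnegative, as
      \<open>weighted_law_unique\<close> requires; the summand is removed again by
      \<open>ex\<close>.\<close>
    define W where "W \<theta> c z = Pd k z * (1 + cos (\<theta> + (\<Sum>i\<in>{Suc k..<n}. c i * z i)))"
      for \<theta> c and z :: "nat \<Rightarrow> real"
    have W0: "0 \<le> W \<theta> c z" "W \<theta> c z \<le> 2" for \<theta> c and z :: "nat \<Rightarrow> real"
    proof -
      let ?g = "\<theta> + (\<Sum>i\<in>{Suc k..<n}. c i * z i)"
      have c2: "0 \<le> 1 + cos ?g" "1 + cos ?g \<le> 2" using cos_ge_minus_one[of ?g] cos_le_one[of ?g] by linarith+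
      show "0 \<le> W \<theta> c z" using c2 pd01[of z] by (simp add: W_def)
      show "W \<theta> c z \<le> 2" using mult_mono[OF pd01(2)[of z] c2(2)] c2 by (simp add: W_def)
    qed
    have PdX [measurable]: "(\<lambda>x. Pd k (\<lambda>i. X i x)) \<in> borel_measurable M1"
      unfolding Pd_def
    proof (rule borel_measurable_prod)
      fix i assume "i \<in> {..<k}"
      then have i: "i < n" using k by simp
      show "(\<lambda>x. indicator (D i) (X i x)) \<in> borel_measurable M1"
        by (rule measurable_compose[OF Xm[OF i] borel_measurable_indicator[OF D[OF i]]])
    qed
    have PdY [measurable]: "(\<lambda>x. Pd k (\<lambda>i. Y i x)) \<in> borel_measurable M2"
      unfolding Pd_def
    proof (rule borel_measurable_prod)
      fix i assume "i \<in> {..<k}"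
      then have i: "i < n" using k by simp
      show "(\<lambda>x. indicator (D i) (Y i x)) \<in> borel_measurable M2"
        by (rule measurable_compose[OF Ym[OF i] borel_measurable_indicator[OF D[OF i]]])
    qed
    have SX [measurable]: "(\<lambda>x. \<Sum>i\<in>{j..<n}. c i * X i x) \<in> borel_measurable M1" for j c
      using Xm by (intro borel_measurable_sum borel_measurable_times) auto
    have SY [measurable]: "(\<lambda>x. \<Sum>i\<in>{j..<n}. c i * Y i x) \<in> borel_measurable M2" for j c
      using Ym by (intro borel_measurable_sum borel_measurable_times) auto
    have WX [measurable]: "(\<lambda>x. W \<theta> c (\<lambda>i. X i x)) \<in> borel_measurable M1" for \<theta> c unfolding W_def[abs_def] by measurable
    have WY [measurable]: "(\<lambda>x. W \<theta> c (\<lambda>i. Y i x)) \<in> borel_measurable M2" for \<theta> c unfolding W_def[abs_def] by measurable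
    have FX [measurable]: "(\<lambda>x. \<Phi> k \<theta> c (\<lambda>i. X i x)) \<in> borel_measurable M1" for \<theta> c
      unfolding \<Phi>_def[abs_def] Pd_def[symmetric] by measurable
    have FY [measurable]: "(\<lambda>x. \<Phi> k \<theta> c (\<lambda>i. Y i x)) \<in> borel_measurable M2" for \<theta> c
      unfolding \<Phi>_def[abs_def] Pd_def[symmetric] by measurable
    have Fb: "\<bar>\<Phi> k \<theta> c z\<bar> \<le> 1" for \<theta> c and z :: "nat \<Rightarrow> real"
      unfolding \<Phi>_def Pd_def[symmetric] abs_mult using pd01[of z] abs_cos_le_one by (intro mult_le_one) auto
    have iX: "integrable M1 (\<lambda>x. \<Phi> k \<theta> c (\<lambda>i. X i x))" for \<theta> c by (rule M1.integrable_const_bound[where B=1]) (use Fb in auto)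
    have iY: "integrable M2 (\<lambda>x. \<Phi> k \<theta> c (\<lambda>i. Y i x))" for \<theta> c by (rule M2.integrable_const_bound[where B=1]) (use Fb in auto)
    \<comment> \<open>The product-to-sum formulas bring the factor in the k-th coordinate back into
      the argument of the cosine, where the induction hypothesis covers it.\<close>
    have wc: "W \<theta> c z * cos (t * z k) = \<Phi> k 0 ((\<lambda>_. 0)(k := t)) z + (1 / 2) * \<Phi> k \<theta> (c(k := t)) z + (1 / 2) * \<Phi> k \<theta> (c(k := - t)) z"
      for \<theta> c t and z :: "nat \<Rightarrow> real"
    proof -
      define g where "g = \<theta> + (\<Sum>i\<in>{Suc k..<n}. c i * z i)"
      have e1: "\<Phi> k 0 ((\<lambda>_. 0)(k := t)) z = Pd k z * cos (t * z k)" unfolding \<Phi>_def sum_upd Pd_def by simp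
      have e2: "\<Phi> k \<theta> (c(k := u)) z = Pd k z * cos (g + u * z k)" for u
        unfolding \<Phi>_def sum_upd Pd_def g_def by (simp add: algebra_simps)
      show ?thesis unfolding e1 e2 W_def g_def[symmetric] by (simp add: cos_add cos_diff algebra_simps)
    qed
    have ws: "W \<theta> c z * sin (t * z k) = \<Phi> k (- (pi / 2)) ((\<lambda>_. 0)(k := t)) z + (1 / 2) * \<Phi> k (\<theta> - pi / 2) (c(k := t)) z + (- 1 / 2) * \<Phi> k (\<theta> - pi / 2) (c(k := - t)) z"
      for \<theta> c t and z :: "nat \<Rightarrow> real"
    proof -
      define g where "g = \<theta> + (\<Sum>i\<in>{Suc k..<n}. c i * z i)"
      have cs: "cos (u - pi / 2) = sin u" for u :: real by (simp add: cos_diff)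
      have e1: "\<Phi> k (- (pi / 2)) ((\<lambda>_. 0)(k := t)) z = Pd k z * sin (t * z k)"
        unfolding \<Phi>_def sum_upd Pd_def using cs[of "t * z k"] by simp
      have e2: "\<Phi> k (\<theta> - pi / 2) (c(k := u)) z = Pd k z * sin (g + u * z k)" for u
        unfolding \<Phi>_def sum_upd Pd_def g_def using cs[of "\<theta> + (\<Sum>i\<in>{Suc k..<n}. c i * z i) + u * z k"] by (simp add: algebra_simps)
      show ?thesis unfolding e1 e2 W_def g_def[symmetric] by (simp add: sin_add sin_diff algebra_simps)
    qed
    have ind: "(\<integral>x. W \<theta> c (\<lambda>i. X i x) * indicator (D k) (X k x) \<partial>M1) = (\<integral>x. W \<theta> c (\<lambda>i. Y i x) * indicator (D k) (Y k x) \<partial>M2)" for \<theta> c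
    proof (rule weighted_law_unique[OF p1 p2 Xm[OF k] Ym[OF k] WX WY D[OF k] W0 W0])
      show "(\<integral>x. W \<theta> c (\<lambda>i. X i x) * cos (t * X k x) \<partial>M1) = (\<integral>x. W \<theta> c (\<lambda>i. Y i x) * cos (t * Y k x) \<partial>M2)" for t
        unfolding wc[of \<theta> c "\<lambda>i. X i x" t for x] wc[of \<theta> c "\<lambda>i. Y i x" t for x]
        using iX iY IH by simp
      show "(\<integral>x. W \<theta> c (\<lambda>i. X i x) * sin (t * X k x) \<partial>M1) = (\<integral>x. W \<theta> c (\<lambda>i. Y i x) * sin (t * Y k x) \<partial>M2)" for t
        unfolding ws[of \<theta> c "\<lambda>i. X i x" t for x] ws[of \<theta> c "\<lambda>i. Y i x" t for x]
        using iX iY IH by simp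
    qed
    \<comment> \<open>\<open>W 0 (\<lambda>_. 0)\<close> is twice the bare product of indicators, so
      half of it is the summand to be removed.\<close>
    have ex: "\<Phi> (Suc k) \<theta> c z = W \<theta> c z * indicator (D k) (z k) - (1 / 2) * (W 0 (\<lambda>_. 0) z * indicator (D k) (z k))"
      for \<theta> c and z :: "nat \<Rightarrow> real"
      unfolding \<Phi>_def W_def Pd_def by (simp add: algebra_simps)
    have jX: "integrable M1 (\<lambda>x. W \<theta> c (\<lambda>i. X i x) * indicator (D k) (X k x))" for \<theta> c
      using Xm[OF k] D[OF k] W0 by (intro M1.integrable_const_bound[where B=2]) (auto simp: indicator_def)
    have jY: "integrable M2 (\<lambda>x. W \<theta> c (\<lambda>i. Y i x) * indicator (D k) (Y k x))" for \<theta> c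
      using Ym[OF k] D[OF k] W0 by (intro M2.integrable_const_bound[where B=2]) (auto simp: indicator_def)
    show ?case
      unfolding ex[of \<theta> c "\<lambda>i. X i x" for x] ex[of \<theta> c "\<lambda>i. Y i x" for x]
      using jX jY ind by simp
  qed
  have "measure N {x \<in> space N. \<forall>i<n. Z i x \<in> D i} = (\<integral>x. \<Phi> n 0 (\<lambda>_. 0) (\<lambda>i. Z i x) \<partial>N)"
    if "\<And>i. i < n \<Longrightarrow> Z i \<in> borel_measurable N" for N :: "'c measure" and Z
  proof -
    define E where "E = {x \<in> space N. \<forall>i\<in>{..<n}. Z i x \<in> D i}"
    have "E \<in> sets N" unfolding E_def
    proof (rule sets.sets_Collect_countable_All')
      fix i assume "i \<in> {..<n}"
      then have [measurable]: "Z i \<in> borel_measurable N" "D i \<in> sets borel" using that D by auto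
      show "{x \<in> space N. Z i x \<in> D i} \<in> sets N" by measurable
    qed simp
    then have "measure N E = (\<integral>x. indicator E x \<partial>N)" using sets.sets_into_space[of E N] by (simp add: Int_absorb2)
    also have "\<dots> = (\<integral>x. \<Phi> n 0 (\<lambda>_. 0) (\<lambda>i. Z i x) \<partial>N)"
    proof (rule Bochner_Integration.integral_cong[OF refl])
      fix x assume x: "x \<in> space N"
      show "indicator E x = \<Phi> n 0 (\<lambda>_. 0) (\<lambda>i. Z i x)"
      proof (cases "x \<in> E")
        case True
        then have "(\<Prod>i<n. indicator (D i) (Z i x)) = (1 :: real)" unfolding E_def by (intro prod.neutral) auto
        then show ?thesis using True by (simp add: \<Phi>_def)
      next
        case False
        then obtain i where i: "i \<in> {..<n}" "Z i x \<notin> D i" using x unfolding E_def by blast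
        then have "(\<Prod>i<n. indicator (D i) (Z i x)) = (0 :: real)" by (intro prod_zero bexI[of _ i]) auto
        then show ?thesis using False by (simp add: \<Phi>_def)
      qed
    qed
    finally show ?thesis unfolding E_def Ball_def lessThan_iff .
  qed
  from this[OF Xm] this[OF Ym] key[of n 0 "\<lambda>_. 0"] show ?thesis by simp
qed

section \<open>Uniqueness of the law of the supremum\<close>

lemma SUP_abs_le_iff:
  fixes g :: "real \<Rightarrow> real"
  assumes "a < b" "continuous_on {a..b} g"
  shows "(SUP t\<in>{a..b}. \<bar>g t\<bar>) \<le> x \<longleftrightarrow> (\<forall>t\<in>{a..b}. \<bar>g t\<bar> \<le> x)"
proof -
  have "bdd_above ((\<lambda>t. \<bar>g t\<bar>) ` {a..b})"
    using assms by (intro bounded_imp_bdd_above compact_imp_bounded compact_continuous_image continuous_intros) auto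
  then show ?thesis using assms by (subst cSUP_le_iff) auto
qed

lemma continuous_abs_le_dense:
  fixes g :: "real \<Rightarrow> real"
  assumes ab: "a < b" and g: "continuous_on {a..b} g" and d: "\<And>t. t \<in> \<rat> \<inter> {a<..<b} \<Longrightarrow> \<bar>g t\<bar> \<le> x" and t: "t \<in> {a..b}"
  shows "\<bar>g t\<bar> \<le> x"
proof -
  have "closed {t \<in> {a..b}. \<bar>g t\<bar> \<le> x}" using g by (intro continuous_on_closed_Collect_le continuous_intros) auto
  moreover have "\<rat> \<inter> {a<..<b} \<subseteq> {t \<in> {a..b}. \<bar>g t\<bar> \<le> x}" using d by auto
  ultimately have "closure (\<rat> \<inter> {a<..<b}) \<subseteq> {t \<in> {a..b}. \<bar>g t\<bar> \<le> x}" by (rule closure_minimal[rotated])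
  moreover have "{a..b} \<subseteq> closure (\<rat> \<inter> {a<..<b})"
  proof
    fix t assume t: "t \<in> {a..b}"
    show "t \<in> closure (\<rat> \<inter> {a<..<b})" unfolding closure_approachable
    proof (intro allI impI)
      fix e :: real assume "e > 0"
      then have "max a (t - e) < min b (t + e)" using t ab by auto
      then obtain u where "u \<in> \<rat>" "max a (t - e) < u" "u < min b (t + e)" using Rats_dense_in_real by blast
      then show "\<exists>y\<in>\<rat> \<inter> {a<..<b}. dist y t < e" by (intro bexI[of _ u]) (auto simp: dist_real_def)
    qed
  qed
  ultimately show ?thesis using t by auto
qed

text \<open>By path continuity the event is the decreasing limit of events on finitely many rational
  points, and those are covered by \<open>joint_law_unique\<close>. The two processes may live on
  spaces of different type.\<close>

lemma gp_sup_dist_unique: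
  fixes M1 :: "'a measure" and M2 :: "'b measure"
  assumes ab: "a < b" and g1: "centered_gp a b K M1 G1" and g2: "centered_gp a b K M2 G2"
  shows "measure M1 {\<omega> \<in> space M1. (SUP t\<in>{a..b}. \<bar>G1 t \<omega>\<bar>) \<le> x} = measure M2 {\<omega> \<in> space M2. (SUP t\<in>{a..b}. \<bar>G2 t \<omega>\<bar>) \<le> x}"
proof -
  define q where "q = from_nat_into (\<rat> \<inter> {a<..<b})"
  have ne: "\<rat> \<inter> {a<..<b} \<noteq> {}" using Rats_dense_in_real[OF ab] by auto
  have cq: "countable (\<rat> \<inter> {a<..<b})" by (simp add: countable_rat)
  have rq: "range q = \<rat> \<inter> {a<..<b}" unfolding q_def by (rule range_from_nat_into[OF ne cq])
  have qab: "q i \<in> {a..b}" for i using rq by (metis Int_iff greaterThanLessThan_subseteq_atLeastAtMost_iff order_refl rangeI subsetD)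
  have lim: "(\<lambda>n. measure N {\<omega> \<in> space N. \<forall>i<n. G (q i) \<omega> \<in> {-x..x}}) \<longlonglongrightarrow> measure N {\<omega> \<in> space N. (SUP t\<in>{a..b}. \<bar>G t \<omega>\<bar>) \<le> x}"
    if gp: "centered_gp a b K N G" for N :: "'c measure" and G
  proof -
    interpret N: prob_space N using gp by (simp add: centered_gp_def)
    have Gm: "G (q i) \<in> borel_measurable N" for i using gp qab by (simp add: centered_gp_def)
    have Gc: "continuous_on {a..b} (\<lambda>t. G t \<omega>)" if "\<omega> \<in> space N" for \<omega> using gp that by (simp add: centered_gp_def)
    define A where "A n = {\<omega> \<in> space N. \<forall>i\<in>{..<n}. G (q i) \<omega> \<in> {-x..x}}" for n
    have Am: "A n \<in> sets N" for n unfolding A_def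
    proof (rule sets.sets_Collect_countable_All')
      fix i show "{\<omega> \<in> space N. G (q i) \<omega> \<in> {-x..x}} \<in> sets N" using Gm[of i] by measurable
    qed simp
    have "(\<lambda>n. measure N (A n)) \<longlonglongrightarrow> measure N (\<Inter>n. A n)"
      using Am by (intro N.finite_Lim_measure_decseq) (auto simp: decseq_def A_def)
    moreover have "(\<Inter>n. A n) = {\<omega> \<in> space N. (SUP t\<in>{a..b}. \<bar>G t \<omega>\<bar>) \<le> x}"
    proof (rule set_eqI)
      fix \<omega>
      have "(SUP t\<in>{a..b}. \<bar>G t \<omega>\<bar>) \<le> x \<longleftrightarrow> (\<forall>i. G (q i) \<omega> \<in> {-x..x})" if w: "\<omega> \<in> space N"
      proof -
        have "(\<forall>t\<in>{a..b}. \<bar>G t \<omega>\<bar> \<le> x) \<longleftrightarrow> (\<forall>i. \<bar>G (q i) \<omega>\<bar> \<le> x)"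
        proof
          assume i: "\<forall>i. \<bar>G (q i) \<omega>\<bar> \<le> x"
          have "\<bar>G t \<omega>\<bar> \<le> x" if "t \<in> \<rat> \<inter> {a<..<b}" for t using i that unfolding rq[symmetric] by auto
          then show "\<forall>t\<in>{a..b}. \<bar>G t \<omega>\<bar> \<le> x" using continuous_abs_le_dense[OF ab Gc[OF w]] by blast
        qed (use qab in auto)
        then show ?thesis unfolding SUP_abs_le_iff[OF ab Gc[OF w]] by (simp add: abs_le_iff minus_le_iff conj_commute)
      qed
      moreover have "\<omega> \<in> (\<Inter>n. A n) \<longleftrightarrow> \<omega> \<in> space N \<and> (\<forall>i. G (q i) \<omega> \<in> {-x..x})"
      proof -
        have "(\<forall>n. \<forall>i\<in>{..<n}. Q i) \<longleftrightarrow> (\<forall>i. Q i)" for Q :: "nat \<Rightarrow> bool" by (metis lessI lessThan_iff)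
        then show ?thesis unfolding A_def by simp
      qed
      ultimately show "\<omega> \<in> (\<Inter>n. A n) \<longleftrightarrow> \<omega> \<in> {\<omega> \<in> space N. (SUP t\<in>{a..b}. \<bar>G t \<omega>\<bar>) \<le> x}" by auto
    qed
    ultimately show ?thesis by (simp add: A_def lessThan_def)
  qed
  have "measure M1 {\<omega> \<in> space M1. \<forall>i<n. G1 (q i) \<omega> \<in> {-x..x}} = measure M2 {\<omega> \<in> space M2. \<forall>i<n. G2 (q i) \<omega> \<in> {-x..x}}" for n
  proof (rule joint_law_unique)
    show "distr M1 borel (\<lambda>x. \<Sum>i<n. c i * G1 (q i) x) = distr M2 borel (\<lambda>x. \<Sum>i<n. c i * G2 (q i) x)" for c
      using g1 g2 qab by (simp add: centered_gp_def)
  qed (use g1 g2 qab in \<open>auto simp: centered_gp_def\<close>)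
  then show ?thesis using lim[OF g1] lim[OF g2] LIMSEQ_unique by simp
qed

section \<open>Gram-Schmidt factorization of a covariance\<close>

text \<open>Step k removes from every vector its component along the current k-th vector, including
  from that vector itself, which becomes null. If it is null already, division by zero gives 0 and
  the step changes nothing, so degenerate covariances need no separate treatment.\<close>

primrec gs :: "'a measure \<Rightarrow> (nat \<Rightarrow> 'a \<Rightarrow> real) \<Rightarrow> nat \<Rightarrow> nat \<Rightarrow> 'a \<Rightarrow> real" where
  "gs N v 0 = v"
| "gs N v (Suc k) = (\<lambda>i x. gs N v k i x -
     ((\<integral>y. gs N v k i y * gs N v k k y \<partial>N) / (\<integral>y. gs N v k k y * gs N v k k y \<partial>N)) * gs N v k k x)"

text \<open>\<open>L\<close> is a Cholesky factor: step k lowers the Gram entry (i, j) by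
  \<open>L i k * L j k\<close>, and after step i nothing is left of the i-th vector. Hence every
  \<open>n > i\<close> gives the same sum.\<close>

lemma covariance_factorization:
  fixes v :: "nat \<Rightarrow> 'a \<Rightarrow> real"
  assumes vm: "\<And>i. v i \<in> borel_measurable N" and v2: "\<And>i. integrable N (\<lambda>x. (v i x)\<^sup>2)"
  obtains L :: "nat \<Rightarrow> nat \<Rightarrow> real" where "\<And>i k. i < k \<Longrightarrow> L i k = 0"
    and "\<And>i j n. i < n \<Longrightarrow> (\<integral>x. v i x * v j x \<partial>N) = (\<Sum>k<n. L i k * L j k)"
proof -
  define V where "V = gs N v"
  have V: "V k i \<in> borel_measurable N \<and> integrable N (\<lambda>x. (V k i x)\<^sup>2)" for k i
  proof (induction k arbitrary: i)
    case 0 show ?case using vm v2 by (simp add: V_def)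
  next
    case (Suc k)
    define c where "c = (\<integral>y. V k i y * V k k y \<partial>N) / (\<integral>y. V k k y * V k k y \<partial>N)"
    have e: "V (Suc k) i = (\<lambda>x. V k i x - c * V k k x)" by (simp add: V_def c_def)
    have p: "integrable N (\<lambda>x. V k i x * V k k x)" using Suc by (intro integrable_mult_of_squares) auto
    have "integrable N (\<lambda>x. (V k i x)\<^sup>2 - 2 * c * (V k i x * V k k x) + c\<^sup>2 * (V k k x)\<^sup>2)"
      using Suc p by auto
    moreover have "(V k i x - c * V k k x)\<^sup>2 = (V k i x)\<^sup>2 - 2 * c * (V k i x * V k k x) + c\<^sup>2 * (V k k x)\<^sup>2" for x
      by (simp add: power2_eq_square algebra_simps)
    moreover have "V k i \<in> borel_measurable N" "V k k \<in> borel_measurable N" using Suc by auto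
    ultimately show ?case unfolding e by simp
  qed
  define g where "g k i j = (\<integral>x. V k i x * V k j x \<partial>N)" for k i j
  have int: "integrable N (\<lambda>x. V k i x * V k j x)" for k i j using V by (intro integrable_mult_of_squares) auto
  have sym: "g k i j = g k j i" for k i j by (simp add: g_def mult.commute)
  have nn: "g k i i \<ge> 0" for k i unfolding g_def by (intro integral_nonneg_AE) auto
  have CS: "(g k i j)\<^sup>2 \<le> g k i i * g k j j" for k i j
    using Cauchy_Schwarz_integral[of "V k i" N "V k j"] V by (simp add: g_def power2_eq_square)
  have step: "g (Suc k) i j = g k i j - g k i k * g k j k / g k k k" for k i j
  proof -
    define c where "c i = g k i k / g k k k" for i
    have e: "V (Suc k) i x = V k i x - c i * V k k x" for i x by (simp add: V_def c_def g_def)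
    have "g (Suc k) i j = (\<integral>x. V k i x * V k j x - c j * (V k i x * V k k x) - c i * (V k j x * V k k x) + c i * c j * (V k k x * V k k x) \<partial>N)"
      unfolding g_def e by (rule Bochner_Integration.integral_cong) (auto simp: algebra_simps)
    also have "\<dots> = g k i j - c j * g k i k - c i * g k j k + c i * c j * g k k k"
      using int by (simp add: g_def)
    also have "\<dots> = g k i j - g k i k * g k j k / g k k k"
      by (cases "g k k k = 0") (auto simp: c_def)
    finally show ?thesis .
  qed
  have zero: "i < k \<Longrightarrow> g k i i = 0" for i k
  proof (induction k)
    case (Suc k)
    show ?case
    proof (cases "i = k")
      case True then show ?thesis unfolding step by (cases "g k k k = 0") auto
    next
      case False
      then have "g k i i = 0" using Suc by auto
      moreover from this have "g k i k = 0" using CS[of k i k] by simp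
      ultimately show ?thesis unfolding step by simp
    qed
  qed simp
  define L where "L i k = g k i k / sqrt (g k k k)" for i k
  have LL: "L i k * L j k = g k i k * g k j k / g k k k" for i j k using nn[of k k] by (simp add: L_def)
  have tele: "g 0 i j = (\<Sum>k<n. L i k * L j k) + g n i j" for i j n
    by (induction n) (auto simp: step LL)
  show ?thesis
  proof
    fix i k :: nat assume "i < k"
    then have "g k i k = 0" using CS[of k i k] zero by simp
    then show "L i k = 0" by (simp add: L_def)
  next
    fix i j n :: nat assume "i < n"
    then have "g n i j = 0" using CS[of n i j] zero by simp
    then show "(\<integral>x. v i x * v j x \<partial>N) = (\<Sum>k<n. L i k * L j k)" using tele[of i j n] by (simp add: g_def V_def)
  qed
qed

section \<open>Centred normal laws\<close>

text \<open>Parametrized by the variance and written exactly as the law in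
  \<open>centered_gp\<close>, which can thus be folded to it. Variance 0 occurs for degenerate
  linear combinations.\<close>

definition nlaw :: "real \<Rightarrow> real measure" where
  "nlaw v = (if v = 0 then return borel 0 else density lborel (\<lambda>x. ennreal (normal_density 0 (sqrt v) x)))"

lemma real_distribution_nlaw: assumes "v \<ge> 0" shows "real_distribution (nlaw v)"
  unfolding nlaw_def
  by (intro real_distribution.intro real_distribution_axioms.intro)
     (use assms in \<open>auto intro!: prob_space_return prob_space_normal_density\<close>)

lemma char_nlaw: assumes v: "v \<ge> 0" shows "char (nlaw v) t = complex_of_real (exp (- (v * t\<^sup>2) / 2))"
proof (cases "v = 0")
  case True
  then show ?thesis by (simp add: nlaw_def char_def integral_return)
next
  case False
  define \<sigma> where "\<sigma> = sqrt v"
  have s: "\<sigma> > 0" "\<sigma>\<^sup>2 = v" using False v by (auto simp: \<sigma>_def)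
  have "char (nlaw v) t = (\<integral>x. normal_density 0 \<sigma> x *\<^sub>R iexp (t * x) \<partial>lborel)"
    using False unfolding char_def nlaw_def \<sigma>_def by (simp, subst integral_density) auto
  also have "\<dots> = \<bar>\<sigma>\<bar> *\<^sub>R (\<integral>x. normal_density 0 \<sigma> (0 + \<sigma> * x) *\<^sub>R iexp (t * (0 + \<sigma> * x)) \<partial>lborel)"
    using s by (intro lborel_integral_real_affine) auto
  also have "\<dots> = (\<integral>x. \<sigma> *\<^sub>R (normal_density 0 \<sigma> (0 + \<sigma> * x) *\<^sub>R iexp (t * (0 + \<sigma> * x))) \<partial>lborel)"
    using s by (simp only: integral_scaleR_right abs_of_pos)
  also have "\<dots> = (\<integral>x. std_normal_density x *\<^sub>R iexp ((t * \<sigma>) * x) \<partial>lborel)"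
  proof (rule Bochner_Integration.integral_cong[OF refl])
    fix x
    have "\<sigma> * normal_density 0 \<sigma> (0 + \<sigma> * x) = std_normal_density x"
      using s(1) by (simp add: normal_density_def power_mult_distrib real_sqrt_mult)
    then show "\<sigma> *\<^sub>R (normal_density 0 \<sigma> (0 + \<sigma> * x) *\<^sub>R iexp (t * (0 + \<sigma> * x))) = std_normal_density x *\<^sub>R iexp ((t * \<sigma>) * x)"
      by (simp add: mult.assoc)
  qed
  also have "\<dots> = char std_normal_distribution (t * \<sigma>)"
    unfolding char_def by (subst integral_density) auto
  also have "\<dots> = complex_of_real (exp (- (v * t\<^sup>2) / 2))"
    using s by (simp add: char_std_normal_distribution power_mult_distrib mult.commute)
  finally show ?thesis .
qed

lemma nlaw_eqI:
  assumes "real_distribution N" "v \<ge> 0" "\<And>t. char N t = complex_of_real (exp (- (v * t\<^sup>2) / 2))"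
  shows "N = nlaw v"
  by (rule Levy_uniqueness[OF assms(1) real_distribution_nlaw[OF assms(2)]]) (use assms char_nlaw in auto)

text \<open>High moments are needed because the variance of an increment is only bounded by a
  possibly small power of the distance.\<close>

lemma nlaw_moment:
  assumes N: "prob_space N" and X [measurable]: "X \<in> borel_measurable N" and law: "distr N borel X = nlaw v" and v: "v \<ge> 0" and p: "p > 0"
  shows "integrable N (\<lambda>x. X x ^ (2 * p))" "(\<integral>x. X x ^ (2 * p) \<partial>N) = fact (2 * p) / (2 ^ p * fact p) * v ^ p"
proof -
  have *: "integrable (nlaw v) (\<lambda>x. x ^ (2 * p)) \<and> (\<integral>x. x ^ (2 * p) \<partial>nlaw v) = fact (2 * p) / (2 ^ p * fact p) * v ^ p"
  proof (cases "v = 0")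
    case True
    interpret R: prob_space "return borel (0::real)" by (rule prob_space_return) simp
    have "integrable (return borel (0::real)) (\<lambda>x. x ^ (2 * p))"
      by (rule R.integrable_const_bound[where B=0]) (use p in \<open>auto simp: AE_return zero_power\<close>)
    then show ?thesis using p True by (simp add: nlaw_def integral_return zero_power)
  next
    case False
    have s: "sqrt v > 0" "(sqrt v)\<^sup>2 = v" using False v by auto
    note m = normal_moment_even[OF s(1), of 0 p]
    have "integrable (nlaw v) (\<lambda>x. x ^ (2 * p))"
      using m False unfolding nlaw_def has_bochner_integral_iff
      by (simp, subst integrable_density) auto
    moreover have "(\<integral>x. x ^ (2 * p) \<partial>nlaw v) = fact (2 * p) / ((2 / v) ^ p * fact p)"
      using m False v unfolding nlaw_def has_bochner_integral_iff
      by (simp, subst integral_density) auto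
    ultimately show ?thesis using False by (simp add: power_divide)
  qed
  show "integrable N (\<lambda>x. X x ^ (2 * p))"
    using * unfolding law[symmetric] by (subst (asm) integrable_distr_eq) auto
  show "(\<integral>x. X x ^ (2 * p) \<partial>N) = fact (2 * p) / (2 ^ p * fact p) * v ^ p"
    using conjunct2[OF *] unfolding law[symmetric] by (subst (asm) integral_distr) auto
qed

text \<open>Dominated convergence of the characteristic functions. It carries the laws over from
  dyadic points to all points of the interval.\<close>

lemma nlaw_limit:
  assumes N: "prob_space N" and Xm [measurable]: "\<And>m. X m \<in> borel_measurable N" "Z \<in> borel_measurable N"
    and law: "\<And>m. distr N borel (X m) = nlaw (v m)" and v: "\<And>m. v m \<ge> 0" "v \<longlonglongrightarrow> w"
    and conv: "AE x in N. (\<lambda>m. X m x) \<longlonglongrightarrow> Z x"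
  shows "distr N borel Z = nlaw w"
proof (rule nlaw_eqI)
  interpret prob_space N by fact
  show "real_distribution (distr N borel Z)"
    by (intro real_distribution.intro real_distribution_axioms.intro prob_space_distr) auto
  show w0: "w \<ge> 0" using v by (intro LIMSEQ_le_const[OF v(2)]) auto
  fix t
  have ch: "char (distr N borel U) t = (\<integral>x. iexp (t * U x) \<partial>N)" if "U \<in> borel_measurable N" for U
    unfolding char_def using that by (subst integral_distr) auto
  have "(\<lambda>m. \<integral>x. iexp (t * X m x) \<partial>N) \<longlonglongrightarrow> (\<integral>x. iexp (t * Z x) \<partial>N)"
  proof (rule integral_dominated_convergence[where w="\<lambda>_. 1"])
    show "AE x in N. (\<lambda>m. iexp (t * X m x)) \<longlonglongrightarrow> iexp (t * Z x)"
      using conv by eventually_elim (auto intro!: tendsto_intros)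
  qed auto
  then have "(\<lambda>m. char (nlaw (v m)) t) \<longlonglongrightarrow> char (distr N borel Z) t"
    using ch[OF Xm(1)] ch[OF Xm(2)] law by simp
  then have "(\<lambda>m. complex_of_real (exp (- (v m * t\<^sup>2) / 2))) \<longlonglongrightarrow> char (distr N borel Z) t"
    using char_nlaw[OF v(1)] by simp
  moreover have "(\<lambda>m. complex_of_real (exp (- (v m * t\<^sup>2) / 2))) \<longlonglongrightarrow> complex_of_real (exp (- (w * t\<^sup>2) / 2))"
    by (intro tendsto_intros v) simp
  ultimately show "char (distr N borel Z) t = complex_of_real (exp (- (w * t\<^sup>2) / 2))" by (rule LIMSEQ_unique)
qed

section \<open>A Gaussian field on a countable set\<close>

text \<open>The space has the type over which \<open>gauss_sup_quantile\<close> quantifies, so a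
  process built on it is an instance of that quantifier.\<close>

abbreviation white_noise :: "(nat \<Rightarrow> real) measure" where
  "white_noise \<equiv> \<Pi>\<^sub>M i\<in>UNIV. std_normal_distribution"

lemma prob_space_std_normal: "prob_space std_normal_distribution"
  by (rule prob_space_normal_density) simp

lemma prob_space_white_noise: "prob_space white_noise"
  by (intro prob_space_PiM prob_space_std_normal)

lemma white_noise_coord [measurable]: "(\<lambda>\<omega>. \<omega> k) \<in> borel_measurable white_noise"
  using measurable_component_singleton[of k UNIV "\<lambda>_. std_normal_distribution"] by simp

text \<open>Independence turns the characteristic function of the sum into a product of Gaussian
  ones.\<close>

lemma white_noise_lin:
  assumes J: "finite J"
  shows "distr white_noise borel (\<lambda>\<omega>. \<Sum>k\<in>J. c k * \<omega> k) = nlaw (\<Sum>k\<in>J. (c k)\<^sup>2)"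
proof (rule nlaw_eqI)
  interpret W: prob_space white_noise by (rule prob_space_white_noise)
  show "real_distribution (distr white_noise borel (\<lambda>\<omega>. \<Sum>k\<in>J. c k * \<omega> k))"
    by (intro real_distribution.intro real_distribution_axioms.intro W.prob_space_distr) auto
  show "(\<Sum>k\<in>J. (c k)\<^sup>2) \<ge> 0" by (intro sum_nonneg) auto
  fix t
  have "W.indep_vars (\<lambda>_. std_normal_distribution) (\<lambda>i \<omega>. \<omega> i) UNIV"
    by (rule indep_vars_PiM_coordinates[OF prob_space_std_normal]) simp
  then have "W.indep_vars (\<lambda>_. borel) (\<lambda>i \<omega>. c i * \<omega> i) UNIV"
    by (rule W.indep_vars_compose2) simp
  then have ind: "W.indep_vars (\<lambda>_. borel) (\<lambda>i \<omega>. c i * \<omega> i) J" by (rule W.indep_vars_subset) simp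
  have one: "char (distr white_noise borel (\<lambda>\<omega>. c k * \<omega> k)) t = complex_of_real (exp (- ((c k)\<^sup>2 * t\<^sup>2) / 2))" for k
  proof -
    have d: "distr white_noise std_normal_distribution (\<lambda>\<omega>. \<omega> k) = std_normal_distribution"
      by (rule distr_PiM_component[where M="\<lambda>_. std_normal_distribution"]) (auto intro: prob_space_std_normal)
    have "char (distr white_noise borel (\<lambda>\<omega>. c k * \<omega> k)) t = (\<integral>\<omega>. iexp ((t * c k) * \<omega> k) \<partial>white_noise)"
      unfolding char_def by (subst integral_distr) (auto simp: mult.assoc)
    also have "\<dots> = (\<integral>x. iexp ((t * c k) * x) \<partial>distr white_noise std_normal_distribution (\<lambda>\<omega>. \<omega> k))"
      by (rule integral_distr[symmetric]) (auto intro: measurable_component_singleton)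
    also have "\<dots> = char std_normal_distribution (t * c k)" unfolding d char_def ..
    finally show ?thesis by (simp add: char_std_normal_distribution power_mult_distrib mult.commute)
  qed
  have "char (distr white_noise borel (\<lambda>\<omega>. \<Sum>k\<in>J. c k * \<omega> k)) t = (\<Prod>k\<in>J. complex_of_real (exp (- ((c k)\<^sup>2 * t\<^sup>2) / 2)))"
    unfolding W.char_distr_sum[OF ind] one ..
  also have "\<dots> = complex_of_real (exp (\<Sum>k\<in>J. - ((c k)\<^sup>2 * t\<^sup>2) / 2))" using J by (simp add: exp_sum)
  also have "(\<Sum>k\<in>J. - ((c k)\<^sup>2 * t\<^sup>2) / 2) = - ((\<Sum>k\<in>J. (c k)\<^sup>2) * t\<^sup>2) / 2"
    by (simp add: sum_negf sum_divide_distrib sum_distrib_right)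
  finally show "char (distr white_noise borel (\<lambda>\<omega>. \<Sum>k\<in>J. c k * \<omega> k)) t = complex_of_real (exp (- ((\<Sum>k\<in>J. (c k)\<^sup>2) * t\<^sup>2) / 2))" .
qed

text \<open>Since the Cholesky factor is triangular, each variable is a finite combination of the
  white noise and no convergence is involved.\<close>

lemma gaussian_on_countable:
  fixes V :: "'s \<Rightarrow> 'a \<Rightarrow> real"
  assumes S: "countable S" "S \<noteq> {}" and Vm: "\<And>x. x \<in> S \<Longrightarrow> V x \<in> borel_measurable N"
    and V2: "\<And>x. x \<in> S \<Longrightarrow> integrable N (\<lambda>y. (V x y)\<^sup>2)"
  obtains g :: "'s \<Rightarrow> (nat \<Rightarrow> real) \<Rightarrow> real" where "\<And>x. g x \<in> borel_measurable white_noise"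
    and "\<And>(I::nat set) x c. finite I \<Longrightarrow> x ` I \<subseteq> S \<Longrightarrow> distr white_noise borel (\<lambda>\<omega>. \<Sum>i\<in>I. c i * g (x i) \<omega>)
        = nlaw (\<Sum>i\<in>I. \<Sum>j\<in>I. c i * c j * (\<integral>y. V (x i) y * V (x j) y \<partial>N))"
proof -
  define \<tau> where "\<tau> = from_nat_into S"
  define ix where "ix = to_nat_on S"
  have tS: "\<tau> i \<in> S" for i unfolding \<tau>_def using S by (intro from_nat_into)
  have ti: "x \<in> S \<Longrightarrow> \<tau> (ix x) = x" for x unfolding \<tau>_def ix_def using S by simp
  obtain L :: "nat \<Rightarrow> nat \<Rightarrow> real" where L0: "\<And>i k. i < k \<Longrightarrow> L i k = 0"
    and LL: "\<And>i j n. i < n \<Longrightarrow> (\<integral>y. V (\<tau> i) y * V (\<tau> j) y \<partial>N) = (\<Sum>k<n. L i k * L j k)"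
    using covariance_factorization[of "\<lambda>i. V (\<tau> i)" N] Vm[OF tS] V2[OF tS] by metis
  define g where "g x \<omega> = (\<Sum>k\<le>ix x. L (ix x) k * \<omega> k)" for x and \<omega> :: "nat \<Rightarrow> real"
  have gn: "g x \<omega> = (\<Sum>k<n. L (ix x) k * \<omega> k)" if "ix x < n" for x \<omega> n
    unfolding g_def using that L0 by (intro sum.mono_neutral_left) auto
  show ?thesis
  proof
    show "g x \<in> borel_measurable white_noise" for x unfolding g_def[abs_def] by measurable
    fix I :: "nat set" and x :: "nat \<Rightarrow> 's" and c :: "nat \<Rightarrow> real"
    assume I: "finite I" and x: "x ` I \<subseteq> S"
    \<comment> \<open>Exceeds every index that occurs; inserting 0 keeps the maximum defined for
      empty \<open>I\<close>.\<close>
    define n where "n = Suc (Max (insert 0 ((\<lambda>i. ix (x i)) ` I)))"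
    have n: "ix (x i) < n" if "i \<in> I" for i
      unfolding n_def less_Suc_eq_le using I that by (intro Max_ge) auto
    define d where "d k = (\<Sum>i\<in>I. c i * L (ix (x i)) k)" for k
    have "(\<Sum>i\<in>I. c i * g (x i) \<omega>) = (\<Sum>k<n. d k * \<omega> k)" for \<omega>
    proof -
      have "(\<Sum>i\<in>I. c i * g (x i) \<omega>) = (\<Sum>i\<in>I. \<Sum>k<n. c i * L (ix (x i)) k * \<omega> k)"
        by (intro sum.cong refl) (simp add: gn[OF n] sum_distrib_left mult.assoc)
      also have "\<dots> = (\<Sum>k<n. d k * \<omega> k)" by (subst sum.swap) (simp add: d_def sum_distrib_right)
      finally show ?thesis .
    qed
    then have "distr white_noise borel (\<lambda>\<omega>. \<Sum>i\<in>I. c i * g (x i) \<omega>) = nlaw (\<Sum>k<n. (d k)\<^sup>2)"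
      using white_noise_lin[of "{..<n}" d] by simp
    also have "(\<Sum>k<n. (d k)\<^sup>2) = (\<Sum>i\<in>I. \<Sum>j\<in>I. c i * c j * (\<integral>y. V (x i) y * V (x j) y \<partial>N))"
    proof -
      have "(\<Sum>k<n. (d k)\<^sup>2) = (\<Sum>k<n. \<Sum>i\<in>I. \<Sum>j\<in>I. c i * c j * (L (ix (x i)) k * L (ix (x j)) k))"
        by (intro sum.cong refl) (simp add: d_def power2_eq_square sum_product mult_ac)
      also have "\<dots> = (\<Sum>i\<in>I. \<Sum>k<n. \<Sum>j\<in>I. c i * c j * (L (ix (x i)) k * L (ix (x j)) k))" by (rule sum.swap)
      also have "\<dots> = (\<Sum>i\<in>I. \<Sum>j\<in>I. \<Sum>k<n. c i * c j * (L (ix (x i)) k * L (ix (x j)) k))"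
        by (intro sum.cong refl sum.swap)
      also have "\<dots> = (\<Sum>i\<in>I. \<Sum>j\<in>I. c i * c j * (\<integral>y. V (x i) y * V (x j) y \<partial>N))"
      proof (intro sum.cong refl)
        fix i j assume ij: "i \<in> I" "j \<in> I"
        have "(\<integral>y. V (x i) y * V (x j) y \<partial>N) = (\<Sum>k<n. L (ix (x i)) k * L (ix (x j)) k)"
          using LL[OF n[OF ij(1)], of "ix (x j)"] ti x ij by (simp add: image_subset_iff)
        then show "(\<Sum>k<n. c i * c j * (L (ix (x i)) k * L (ix (x j)) k)) = c i * c j * (\<integral>y. V (x i) y * V (x j) y \<partial>N)"
          by (simp add: sum_distrib_left)
      qed
      finally show ?thesis .
    qed
    finally show "distr white_noise borel (\<lambda>\<omega>. \<Sum>i\<in>I. c i * g (x i) \<omega>)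
        = nlaw (\<Sum>i\<in>I. \<Sum>j\<in>I. c i * c j * (\<integral>y. V (x i) y * V (x j) y \<partial>N))" .
  qed
qed

section \<open>Continuous versions by dyadic approximation\<close>

lemma geometric_steps:
  fixes u :: "nat \<Rightarrow> real"
  assumes r: "0 < \<rho>" "\<rho> < 1" and st: "\<And>m. m \<ge> m0 \<Longrightarrow> \<bar>u (Suc m) - u m\<bar> \<le> \<rho> ^ m"
  shows "convergent u" and "m \<ge> m0 \<Longrightarrow> \<bar>lim u - u m\<bar> \<le> \<rho> ^ m / (1 - \<rho>)"
proof -
  \<comment> \<open>The exact geometric sum is kept, as the induction would not close with the
    cruder bound \<open>\<rho> ^ m / (1 - \<rho>)\<close>.\<close>
  have tele: "\<bar>u (m + k) - u m\<bar> \<le> \<rho> ^ m * (1 - \<rho> ^ k) / (1 - \<rho>)" if "m \<ge> m0" for m k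
  proof (induction k)
    case (Suc k)
    have "\<bar>u (m + Suc k) - u m\<bar> \<le> \<rho> ^ (m + k) + \<rho> ^ m * (1 - \<rho> ^ k) / (1 - \<rho>)"
      using st[of "m + k"] Suc that by simp
    also have "\<dots> = \<rho> ^ m * (1 - \<rho> ^ Suc k) / (1 - \<rho>)" using r by (simp add: power_add field_simps)
    finally show ?case .
  qed simp
  have bd: "\<bar>u n - u m\<bar> \<le> \<rho> ^ m / (1 - \<rho>)" if "m \<ge> m0" "n \<ge> m" for m n
  proof -
    have "\<bar>u n - u m\<bar> \<le> \<rho> ^ m * (1 - \<rho> ^ (n - m)) / (1 - \<rho>)" using tele[OF that(1), of "n - m"] that by simp
    also have "\<dots> \<le> \<rho> ^ m * 1 / (1 - \<rho>)" using r by (intro divide_right_mono mult_left_mono) auto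
    finally show ?thesis by simp
  qed
  have "(\<lambda>m. \<rho> ^ m / (1 - \<rho>)) \<longlonglongrightarrow> 0 / (1 - \<rho>)" using r by (intro tendsto_intros LIMSEQ_power_zero) auto
  then have z: "(\<lambda>m. \<rho> ^ m / (1 - \<rho>)) \<longlonglongrightarrow> 0" by simp
  have "Cauchy u"
  proof (rule CauchyI')
    fix e :: real assume "e > 0"
    then have "eventually (\<lambda>m. \<rho> ^ m / (1 - \<rho>) < e) sequentially" by (rule order_tendstoD[OF z])
    then obtain m1 where m1: "\<And>m. m \<ge> m1 \<Longrightarrow> \<rho> ^ m / (1 - \<rho>) < e" by (auto simp: eventually_sequentially)
    show "\<exists>M. \<forall>m\<ge>M. \<forall>n>m. dist (u m) (u n) < e"
    proof (intro exI[of _ "max m0 m1"] allI impI)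
      fix m n assume "max m0 m1 \<le> m" "m < n"
      then show "dist (u m) (u n) < e" using bd[of m n] m1[of m] by (simp add: dist_real_def abs_minus_commute)
    qed
  qed
  then show c: "convergent u" by (rule Cauchy_convergent)
  assume m: "m \<ge> m0"
  have "(\<lambda>n. \<bar>u n - u m\<bar>) \<longlonglongrightarrow> \<bar>lim u - u m\<bar>" using c by (intro tendsto_intros) (simp add: convergent_LIMSEQ_iff)
  then show "\<bar>lim u - u m\<bar> \<le> \<rho> ^ m / (1 - \<rho>)" using bd[OF m] by (intro LIMSEQ_le_const2) auto
qed

definition dyad :: "real \<Rightarrow> real \<Rightarrow> nat \<Rightarrow> nat \<Rightarrow> real" where
  "dyad a b m i = a + (b - a) * real i / 2 ^ m"

text \<open>For t in [a,b], the index of the largest dyadic point of level m that is at most t; it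
  equals \<open>2 ^ m\<close> at t = b.\<close>

definition dix :: "real \<Rightarrow> real \<Rightarrow> nat \<Rightarrow> real \<Rightarrow> nat" where
  "dix a b m t = nat \<lfloor>2 ^ m * ((t - a) / (b - a))\<rfloor>"

context
  fixes a b :: real assumes ab: "a < b"
begin

lemma dyad_in: "i \<le> 2 ^ m \<Longrightarrow> dyad a b m i \<in> {a..b}"
proof -
  assume i: "i \<le> 2 ^ m"
  have "real i \<le> 2 ^ m" using i by (metis of_nat_le_iff of_nat_numeral of_nat_power)
  then have "(b - a) * (real i / 2 ^ m) \<le> (b - a) * 1" using ab by (intro mult_left_mono) auto
  then show ?thesis using ab by (simp add: dyad_def)
qed

lemma dyad_Suc: "dyad a b (Suc m) (2 * i) = dyad a b m i"
  by (simp add: dyad_def)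

lemma dyad_step: "\<bar>dyad a b m (Suc i) - dyad a b m i\<bar> = (b - a) / 2 ^ m"
  using ab by (simp add: dyad_def field_simps)

lemma dix_bounds: assumes "t \<in> {a..b}"
  shows "real (dix a b m t) \<le> 2 ^ m * ((t - a) / (b - a))" "2 ^ m * ((t - a) / (b - a)) < real (dix a b m t) + 1"
    "dix a b m t \<le> 2 ^ m"
proof -
  have "0 \<le> 2 ^ m * ((t - a) / (b - a))" using assms ab by simp
  then show 1: "real (dix a b m t) \<le> 2 ^ m * ((t - a) / (b - a))" "2 ^ m * ((t - a) / (b - a)) < real (dix a b m t) + 1"
    unfolding dix_def by (auto simp: of_nat_nat)
  have "2 ^ m * ((t - a) / (b - a)) \<le> 2 ^ m * 1" using assms ab by (intro mult_left_mono) (auto simp: field_simps)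
  then have "real (dix a b m t) \<le> 2 ^ m" using 1 by linarith
  then show "dix a b m t \<le> 2 ^ m" by (metis of_nat_le_iff of_nat_numeral of_nat_power)
qed

text \<open>Halving the mesh doubles the rescaled position. By \<open>dyad_Suc\<close> the
  approximation of t therefore stays where it is or moves by one step of the finer grid.\<close>

lemma dix_Suc: assumes "t \<in> {a..b}" shows "dix a b (Suc m) t = 2 * dix a b m t \<or> dix a b (Suc m) t = Suc (2 * dix a b m t)"
proof -
  have "real (dix a b (Suc m) t) < real (2 * dix a b m t + 2)" "real (2 * dix a b m t) < real (dix a b (Suc m) t + 1)"
    using dix_bounds[OF assms, of m] dix_bounds[OF assms, of "Suc m"] by auto
  then show ?thesis unfolding of_nat_less_iff by linarith
qed

lemma dix_near: assumes t: "t \<in> {a..b}" and u: "u \<in> {a..b}" and d: "\<bar>t - u\<bar> \<le> (b - a) / 2 ^ m"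
  shows "dix a b m t = dix a b m u \<or> dix a b m t = Suc (dix a b m u) \<or> dix a b m u = Suc (dix a b m t)"
proof -
  define p where "p x = 2 ^ m * ((x - a) / (b - a))" for x
  have "p t - p u = (t - u) * (2 ^ m / (b - a))" by (simp add: p_def field_simps diff_divide_distrib)
  then have "\<bar>p t - p u\<bar> = \<bar>t - u\<bar> * (2 ^ m / (b - a))" using ab by (simp add: abs_mult)
  also have "\<dots> \<le> (b - a) / 2 ^ m * (2 ^ m / (b - a))" using ab d by (intro mult_right_mono) auto
  also have "\<dots> = 1" using ab by simp
  finally have "\<bar>p t - p u\<bar> \<le> 1" .
  then have "real (dix a b m t) < real (dix a b m u + 2)" "real (dix a b m u) < real (dix a b m t + 2)"
    using dix_bounds[OF t, of m] dix_bounds[OF u, of m] unfolding p_def by auto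
  then show ?thesis unfolding of_nat_less_iff by linarith
qed

lemma dyad_dix_tendsto: assumes t: "t \<in> {a..b}" shows "(\<lambda>m. dyad a b m (dix a b m t)) \<longlonglongrightarrow> t"
proof -
  have "\<bar>dyad a b m (dix a b m t) - t\<bar> \<le> (b - a) / 2 ^ m" for m
  proof -
    define x where "x = 2 ^ m * ((t - a) / (b - a))"
    have "dyad a b m (dix a b m t) - t = (real (dix a b m t) - x) * ((b - a) / 2 ^ m)"
      using ab by (simp add: dyad_def x_def field_simps)
    then have "\<bar>dyad a b m (dix a b m t) - t\<bar> = \<bar>real (dix a b m t) - x\<bar> * ((b - a) / 2 ^ m)" using ab by (simp add: abs_mult)
    also have "\<dots> \<le> 1 * ((b - a) / 2 ^ m)"
      using dix_bounds[OF t, of m] ab unfolding x_def[symmetric] by (intro mult_right_mono) auto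
    finally show ?thesis by simp
  qed
  moreover have "(\<lambda>m. (b - a) / 2 ^ m) \<longlonglongrightarrow> 0" by (rule LIMSEQ_divide_realpow_zero) simp
  ultimately have "(\<lambda>m. dyad a b m (dix a b m t) - t) \<longlonglongrightarrow> 0"
    by (intro Lim_null_comparison[of "\<lambda>m. dyad a b m (dix a b m t) - t" "\<lambda>m. (b - a) / 2 ^ m"] always_eventually allI) (simp_all only: real_norm_def)
  then show ?thesis by (simp add: LIM_zero_iff)
qed

text \<open>Only increments between neighbouring dyadic points enter. By Borel-Cantelli they are
  almost surely at most \<open>\<rho> ^ m\<close> from some level on; then the values at the dyadic
  approximations of t converge geometrically, and points at distance below the mesh have equal or
  neighbouring approximations.\<close>

lemma continuous_version:
  fixes g :: "real \<Rightarrow> 'w \<Rightarrow> real"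
  assumes N: "prob_space N" and gm: "\<And>x. g x \<in> borel_measurable N"
    and q: "even q" "q > 0" and C: "C \<ge> 0"
    and mom: "\<And>m i. i < 2 ^ m \<Longrightarrow> integrable N (\<lambda>\<omega>. (g (dyad a b m (Suc i)) \<omega> - g (dyad a b m i) \<omega>) ^ q) \<and>
      (\<integral>\<omega>. (g (dyad a b m (Suc i)) \<omega> - g (dyad a b m i) \<omega>) ^ q \<partial>N) \<le> C / 4 ^ m"
  obtains X :: "real \<Rightarrow> 'w \<Rightarrow> real" where "\<And>t. t \<in> {a..b} \<Longrightarrow> X t \<in> borel_measurable N"
    and "\<And>\<omega>. continuous_on {a..b} (\<lambda>t. X t \<omega>)"
    and "AE \<omega> in N. \<forall>t\<in>{a..b}. (\<lambda>m. g (dyad a b m (dix a b m t)) \<omega>) \<longlonglongrightarrow> X t \<omega>"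
proof -
  interpret prob_space N by fact
  \<comment> \<open>Markov's inequality for each of \<open>2 ^ m\<close> increments gives, up to the
    factor \<open>C\<close>, 2^m 4^-m (4/3)^m = (2/3)^m, which is summable. Any value of
    \<open>\<rho> ^ q\<close> strictly between 1/2 and 1 would do.\<close>
  define \<rho> where "\<rho> = root q (3 / 4)"
  have rq: "\<rho> ^ q = 3 / 4" unfolding \<rho>_def using q by simp
  have r: "0 < \<rho>" "\<rho> < 1" unfolding \<rho>_def using q by auto
  define \<Delta> where "\<Delta> m i \<omega> = g (dyad a b m (Suc i)) \<omega> - g (dyad a b m i) \<omega>" for m i \<omega>
  have Dm [measurable]: "\<Delta> m i \<in> borel_measurable N" for m i unfolding \<Delta>_def[abs_def] using gm by measurable
  define E where "E m = {\<omega> \<in> space N. \<exists>i\<in>{..<2 ^ m}. \<Delta> m i \<omega> ^ q \<ge> (\<rho> ^ m) ^ q}" for m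
  have Em [measurable]: "E m \<in> sets N" for m unfolding E_def by measurable
  have PE: "measure N (E m) \<le> C * (2 / 3) ^ m" for m
  proof -
    have "measure N (E m) = measure N (\<Union>i\<in>{..<2 ^ m}. {\<omega> \<in> space N. \<Delta> m i \<omega> ^ q \<ge> (\<rho> ^ m) ^ q})"
      by (rule arg_cong[where f="measure N"]) (auto simp: E_def)
    also have "\<dots> \<le> (\<Sum>i<2 ^ m. measure N {\<omega> \<in> space N. \<Delta> m i \<omega> ^ q \<ge> (\<rho> ^ m) ^ q})"
      by (rule finite_measure_subadditive_finite) auto
    also have "\<dots> \<le> (\<Sum>i<(2::nat) ^ m. C / 4 ^ m / (\<rho> ^ m) ^ q)"
    proof (rule sum_mono)
      fix i assume "i \<in> {..<(2::nat) ^ m}"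
      then have i: "i < 2 ^ m" by simp
      note mi = mom[OF i, folded \<Delta>_def]
      have "measure N {\<omega> \<in> space N. \<Delta> m i \<omega> ^ q \<ge> (\<rho> ^ m) ^ q} \<le> (\<integral>\<omega>. \<Delta> m i \<omega> ^ q \<partial>N) / (\<rho> ^ m) ^ q"
        by (rule integral_Markov_inequality_measure[where A="{}"]) (use mi q r in \<open>auto simp: zero_le_even_power\<close>)
      also have "\<dots> \<le> C / 4 ^ m / (\<rho> ^ m) ^ q" using mi r by (intro divide_right_mono) auto
      finally show "measure N {\<omega> \<in> space N. \<Delta> m i \<omega> ^ q \<ge> (\<rho> ^ m) ^ q} \<le> C / 4 ^ m / (\<rho> ^ m) ^ q" .
    qed
    also have "\<dots> = 2 ^ m * (C / 4 ^ m / (\<rho> ^ m) ^ q)" by simp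
    also have "(\<rho> ^ m) ^ q = (3 / 4) ^ m" by (metis rq power_mult mult.commute)
    also have "2 ^ m * (C / 4 ^ m / (3 / 4) ^ m) = C * (2 / 3) ^ m" by (simp add: power_divide)
    finally show ?thesis .
  qed
  have "AE \<omega> in N. eventually (\<lambda>m. \<omega> \<in> space N - E m) sequentially"
  proof (rule borel_cantelli_AE1)
    show "summable (\<lambda>m. measure N (E m))"
      by (rule summable_comparison_test[OF _ summable_mult[OF summable_geometric[of "2 / 3"]]]) (use PE in auto)
  qed (auto simp: emeasure_eq_measure)
  define good where "good = {\<omega>. \<exists>m0. \<forall>m\<ge>m0. \<forall>i<2 ^ m. \<bar>\<Delta> m i \<omega>\<bar> \<le> \<rho> ^ m}"
  have gAE: "AE \<omega> in N. \<omega> \<in> good"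
    using \<open>AE \<omega> in N. eventually (\<lambda>m. \<omega> \<in> space N - E m) sequentially\<close>
  proof eventually_elim
    case (elim \<omega>)
    then obtain m0 where m0: "\<And>m. m \<ge> m0 \<Longrightarrow> \<omega> \<in> space N - E m" by (auto simp: eventually_sequentially)
    have "\<bar>\<Delta> m i \<omega>\<bar> \<le> \<rho> ^ m" if "m \<ge> m0" "i < 2 ^ m" for m i
    proof (rule ccontr)
      assume "\<not> \<bar>\<Delta> m i \<omega>\<bar> \<le> \<rho> ^ m"
      then have "(\<rho> ^ m) ^ q \<le> \<bar>\<Delta> m i \<omega>\<bar> ^ q" using r by (intro power_mono) auto
      also have "\<dots> = \<Delta> m i \<omega> ^ q" using q by (simp add: power_even_abs)
      finally show False using m0[OF that(1)] that(2) by (auto simp: E_def)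
    qed
    then show ?case unfolding good_def by blast
  qed
  have gs: "{\<omega> \<in> space N. \<omega> \<in> good} \<in> sets N" unfolding good_def mem_Collect_eq by measurable
  define s where "s t m \<omega> = g (dyad a b m (dix a b m t)) \<omega>" for t m \<omega>
  \<comment> \<open>The value 0 off the good event makes every path continuous, as
    \<open>centered_gp\<close> demands, and not just almost every one.\<close>
  define X where "X t \<omega> = (if \<omega> \<in> good then lim (\<lambda>m. s t m \<omega>) else 0)" for t \<omega>
  have step: "\<bar>s t (Suc m) \<omega> - s t m \<omega>\<bar> \<le> \<rho> ^ m"
    if m0: "\<forall>m\<ge>m0. \<forall>i<2 ^ m. \<bar>\<Delta> m i \<omega>\<bar> \<le> \<rho> ^ m" and t: "t \<in> {a..b}" and m: "m \<ge> m0" for t m m0 \<omega>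
    using dix_Suc[OF t, of m]
  proof
    assume "dix a b (Suc m) t = 2 * dix a b m t"
    then show ?thesis using r by (simp add: s_def dyad_Suc)
  next
    assume e: "dix a b (Suc m) t = Suc (2 * dix a b m t)"
    then have "s t (Suc m) \<omega> - s t m \<omega> = \<Delta> (Suc m) (2 * dix a b m t) \<omega>" by (simp add: s_def \<Delta>_def dyad_Suc)
    moreover have "2 * dix a b m t < 2 ^ Suc m" using dix_bounds(3)[OF t, of "Suc m"] e by simp
    then have "\<bar>\<Delta> (Suc m) (2 * dix a b m t) \<omega>\<bar> \<le> \<rho> ^ Suc m" using m0 m by (meson le_SucI)
    moreover have "\<rho> ^ Suc m \<le> \<rho> ^ m" using r by (intro power_decreasing) auto
    ultimately show ?thesis by linarith
  qed
  show ?thesis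
  proof
    have tend: "(\<lambda>m. s t m \<omega>) \<longlonglongrightarrow> X t \<omega>" if w: "\<omega> \<in> good" and t: "t \<in> {a..b}" for t \<omega>
    proof -
      obtain m0 where m0: "\<forall>m\<ge>m0. \<forall>i<2 ^ m. \<bar>\<Delta> m i \<omega>\<bar> \<le> \<rho> ^ m" using w unfolding good_def by blast
      have "convergent (\<lambda>m. s t m \<omega>)" by (rule geometric_steps(1)[OF r]) (rule step[OF m0 t])
      then show ?thesis using w by (simp add: X_def convergent_LIMSEQ_iff)
    qed
    show "AE \<omega> in N. \<forall>t\<in>{a..b}. (\<lambda>m. g (dyad a b m (dix a b m t)) \<omega>) \<longlonglongrightarrow> X t \<omega>"
      using gAE by eventually_elim (use tend in \<open>auto simp: s_def\<close>)
    show "X t \<in> borel_measurable N" if t: "t \<in> {a..b}" for t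
    proof -
      have sm: "s t m \<in> borel_measurable N" for m unfolding s_def[abs_def] by (rule gm)
      have "(\<lambda>\<omega>. indicator good \<omega> * s t m \<omega>) \<in> borel_measurable N" for m
      proof -
        have "(\<lambda>\<omega>. if \<omega> \<in> good then s t m \<omega> else 0) \<in> borel_measurable N"
          using sm gs by (intro measurable_If) auto
        moreover have "(\<lambda>\<omega>. if \<omega> \<in> good then s t m \<omega> else 0) = (\<lambda>\<omega>. indicator good \<omega> * s t m \<omega>)" by (auto simp: indicator_def)
        ultimately show ?thesis by simp
      qed
      moreover have "(\<lambda>m. indicator good \<omega> * s t m \<omega>) \<longlonglongrightarrow> X t \<omega>" for \<omega>
        using tend[OF _ t, of \<omega>] by (cases "\<omega> \<in> good") (auto simp: X_def)
      ultimately show ?thesis by (rule borel_measurable_LIMSEQ_real[rotated])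
    qed
    show "continuous_on {a..b} (\<lambda>t. X t \<omega>)" for \<omega>
    proof (cases "\<omega> \<in> good")
      case False
      then show ?thesis by (simp add: X_def)
    next
      case True
      then obtain m0 where m0: "\<forall>m\<ge>m0. \<forall>i<2 ^ m. \<bar>\<Delta> m i \<omega>\<bar> \<le> \<rho> ^ m" unfolding good_def by blast
      \<comment> \<open>One step between neighbouring dyadic points, plus the two tails
        \<open>\<rho> ^ m / (1 - \<rho>)\<close> from level m to the limit.\<close>
      define c where "c = 1 + 2 / (1 - \<rho>)"
      have mod: "\<bar>X t \<omega> - X u \<omega>\<bar> \<le> c * \<rho> ^ m"
        if t: "t \<in> {a..b}" and u: "u \<in> {a..b}" and d: "\<bar>t - u\<bar> \<le> (b - a) / 2 ^ m" and m: "m \<ge> m0" for t u m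
      proof -
        have X: "\<bar>X v \<omega> - s v m \<omega>\<bar> \<le> \<rho> ^ m / (1 - \<rho>)" if v: "v \<in> {a..b}" for v
          using geometric_steps(2)[OF r, of m0 "\<lambda>m. s v m \<omega>", OF step[OF m0 v] m] True by (simp add: X_def)
        have inc: "\<bar>g (dyad a b m (Suc i)) \<omega> - g (dyad a b m i) \<omega>\<bar> \<le> \<rho> ^ m" if "i < 2 ^ m" for i
          using m0 m that by (simp add: \<Delta>_def)
        have "\<bar>s t m \<omega> - s u m \<omega>\<bar> \<le> \<rho> ^ m"
          using dix_near[OF t u d]
        proof (elim disjE)
          assume "dix a b m t = dix a b m u" then show ?thesis using r by (simp add: s_def)
        next
          assume e: "dix a b m t = Suc (dix a b m u)"
          then have "dix a b m u < 2 ^ m" using dix_bounds(3)[OF t, of m] by simp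
          from inc[OF this] show ?thesis by (simp add: s_def e)
        next
          assume e: "dix a b m u = Suc (dix a b m t)"
          then have "dix a b m t < 2 ^ m" using dix_bounds(3)[OF u, of m] by simp
          from inc[OF this] show ?thesis by (simp add: s_def e abs_minus_commute)
        qed
        then have "\<bar>X t \<omega> - X u \<omega>\<bar> \<le> \<rho> ^ m + \<rho> ^ m / (1 - \<rho>) + \<rho> ^ m / (1 - \<rho>)" using X[OF t] X[OF u] by linarith
        then show ?thesis by (simp add: c_def algebra_simps)
      qed
      show ?thesis unfolding continuous_on_iff
      proof (intro ballI allI impI)
        fix t e :: real assume t: "t \<in> {a..b}" and e: "e > 0"
        have "(\<lambda>m. c * \<rho> ^ m) \<longlonglongrightarrow> c * 0" using r by (intro tendsto_intros LIMSEQ_power_zero) auto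
        then have "eventually (\<lambda>m. c * \<rho> ^ m < e) sequentially" using e by (intro order_tendstoD(2)) auto
        then have "eventually (\<lambda>m. c * \<rho> ^ m < e \<and> m \<ge> m0) sequentially" using eventually_ge_at_top by (rule eventually_conj)
        then obtain m where m: "c * \<rho> ^ m < e" "m \<ge> m0" by (auto simp: eventually_sequentially)
        show "\<exists>d>0. \<forall>u\<in>{a..b}. dist u t < d \<longrightarrow> dist (X u \<omega>) (X t \<omega>) < e"
        proof (intro exI[of _ "(b - a) / 2 ^ m"] conjI ballI impI)
          show "0 < (b - a) / 2 ^ m" using ab by simp
          fix u assume u: "u \<in> {a..b}" "dist u t < (b - a) / 2 ^ m"
          then have "\<bar>X u \<omega> - X t \<omega>\<bar> \<le> c * \<rho> ^ m" using mod[OF u(1) t _ m(2)] by (simp add: dist_real_def)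
          then show "dist (X u \<omega>) (X t \<omega>) < e" using m(1) by (simp add: dist_real_def)
        qed
      qed
    qed
  qed
qed

text \<open>Representing the covariance by inner products of bounded functions makes it positive
  semidefinite by construction and continuous by Cauchy-Schwarz; continuity identifies the laws at
  points that are not dyadic.\<close>

lemma centered_gp_exists:
  fixes V :: "real \<Rightarrow> 'a \<Rightarrow> real"
  assumes P: "prob_space P" and Vm [measurable]: "\<And>t. V t \<in> borel_measurable P" and Vb: "\<And>t y. \<bar>V t y\<bar> \<le> Mb"
    and inc: "\<And>t u. t \<in> {a..b} \<Longrightarrow> u \<in> {a..b} \<Longrightarrow> (\<integral>y. (V t y - V u y)\<^sup>2 \<partial>P) \<le> C * \<bar>t - u\<bar> powr \<kappa>"
    and k: "\<kappa> > 0"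
  shows "\<exists>X. centered_gp a b (\<lambda>s t. \<integral>y. V s y * V t y \<partial>P) white_noise X"
proof -
  interpret P: prob_space P by fact
  interpret W: prob_space white_noise by (rule prob_space_white_noise)
  define K where "K s t = (\<integral>y. V s y * V t y \<partial>P)" for s t
  have Mb0: "Mb \<ge> 0" using Vb[of 0 undefined] by linarith
  have Vi: "integrable P (\<lambda>y. V s y * V t y)" for s t
    using Vb Mb0 by (intro P.integrable_const_bound[where B="Mb * Mb"]) (auto simp: abs_mult intro!: mult_mono)
  have Di: "integrable P (\<lambda>y. (V s y - V t y)\<^sup>2)" for s t
    using Vi by (simp add: power2_eq_square algebra_simps)
  have Ksym: "K s t = K t s" for s t by (simp add: K_def mult.commute)
  have Kinc: "(\<integral>y. (V s y - V t y)\<^sup>2 \<partial>P) = K s s - 2 * K s t + K t t" for s t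
  proof -
    have "(\<integral>y. (V s y - V t y)\<^sup>2 \<partial>P) = (\<integral>y. V s y * V s y - 2 * (V s y * V t y) + V t y * V t y \<partial>P)"
      by (rule Bochner_Integration.integral_cong) (auto simp: power2_eq_square algebra_simps)
    then show ?thesis unfolding K_def using Vi by simp
  qed
  have C0: "C \<ge> 0"
  proof -
    have "0 \<le> (\<integral>y. (V a y - V b y)\<^sup>2 \<partial>P)" by simp
    also have "\<dots> \<le> C * \<bar>a - b\<bar> powr \<kappa>" using ab by (intro inc) auto
    finally show ?thesis using ab by (simp add: zero_le_mult_iff)
  qed
  define S where "S = (\<lambda>(m, i). dyad a b m i) ` (UNIV \<times> UNIV) \<inter> {a..b}"
  have S: "countable S" unfolding S_def by (intro countable_Int1 countable_image) auto
  have "dyad a b 0 0 \<in> S" unfolding S_def using dyad_in[of 0 0] by force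
  then have Sne: "S \<noteq> {}" by blast
  have dS: "i \<le> 2 ^ m \<Longrightarrow> dyad a b m i \<in> S" for m i unfolding S_def using dyad_in by force
  have V2: "integrable P (\<lambda>y. (V x y)\<^sup>2)" for x using Vi[of x x] by (simp add: power2_eq_square)
  obtain g where gm: "\<And>x. g x \<in> borel_measurable white_noise"
    and gl: "\<And>(I::nat set) x c. finite I \<Longrightarrow> x ` I \<subseteq> S \<Longrightarrow> distr white_noise borel (\<lambda>\<omega>. \<Sum>i\<in>I. c i * g (x i) \<omega>)
        = nlaw (\<Sum>i\<in>I. \<Sum>j\<in>I. c i * c j * K (x i) (x j))"
  proof (rule gaussian_on_countable[of S V P, OF S Sne Vm V2])
    fix g assume 1: "\<And>x. g x \<in> borel_measurable white_noise"
      and 2: "\<And>(I::nat set) x c. finite I \<Longrightarrow> x ` I \<subseteq> S \<Longrightarrow> distr white_noise borel (\<lambda>\<omega>. \<Sum>i\<in>I. c i * g (x i) \<omega>)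
        = nlaw (\<Sum>i\<in>I. \<Sum>j\<in>I. c i * c j * (\<integral>y. V (x i) y * V (x j) y \<partial>P))"
    show thesis by (rule that[OF 1 2[folded K_def]])
  qed
  have gdiff: "distr white_noise borel (\<lambda>\<omega>. g x \<omega> - g y \<omega>) = nlaw (\<integral>z. (V x z - V y z)\<^sup>2 \<partial>P)" if "x \<in> S" "y \<in> S" for x y
  proof -
    have "distr white_noise borel (\<lambda>\<omega>. \<Sum>i\<in>{0, 1::nat}. (if i = 0 then 1 else - 1) * g (if i = 0 then x else y) \<omega>)
        = nlaw (\<Sum>i\<in>{0, 1::nat}. \<Sum>j\<in>{0, 1::nat}. (if i = 0 then 1 else - 1) * (if j = 0 then 1 else - 1) * K (if i = 0 then x else y) (if j = 0 then x else y))"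
      by (rule gl) (use that in auto)
    then show ?thesis unfolding Kinc using Ksym[of x y] by (simp add: algebra_simps)
  qed
  \<comment> \<open>The moment of order 2p of an increment is a constant times the p-th power of its
    variance, hence at most of the order of the distance to the power p \<kappa>. That exponent is
    at least 2, which gives the factor \<open>4 ^ m\<close> in
    \<open>continuous_version\<close>.\<close>
  define p where "p = nat \<lceil>2 / \<kappa>\<rceil>"
  have pk: "real p * \<kappa> \<ge> 2"
  proof -
    have "2 / \<kappa> \<le> real p" unfolding p_def by (simp add: real_nat_ceiling_ge)
    then show ?thesis using k by (simp add: field_simps)
  qed
  then have p0: "p > 0" using k by (cases p) auto
  define A where "A = fact (2 * p) / (2 ^ p * fact p) * (C ^ p * (b - a) powr (real p * \<kappa>))"
  have A0: "A \<ge> 0" unfolding A_def using C0 by simp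
  obtain X where Xm: "\<And>t. t \<in> {a..b} \<Longrightarrow> X t \<in> borel_measurable white_noise"
    and Xc: "\<And>\<omega>. continuous_on {a..b} (\<lambda>t. X t \<omega>)"
    and Xl: "AE \<omega> in white_noise. \<forall>t\<in>{a..b}. (\<lambda>m. g (dyad a b m (dix a b m t)) \<omega>) \<longlonglongrightarrow> X t \<omega>"
  proof (rule continuous_version[OF prob_space_white_noise gm, of "2 * p" A])
    fix m i :: nat assume i: "i < 2 ^ m"
    define v where "v = (\<integral>z. (V (dyad a b m (Suc i)) z - V (dyad a b m i) z)\<^sup>2 \<partial>P)"
    have v0: "v \<ge> 0" by (simp add: v_def)
    have l: "distr white_noise borel (\<lambda>\<omega>. g (dyad a b m (Suc i)) \<omega> - g (dyad a b m i) \<omega>) = nlaw v"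
      unfolding v_def using i by (intro gdiff dS) auto
    have dm: "(\<lambda>\<omega>. g (dyad a b m (Suc i)) \<omega> - g (dyad a b m i) \<omega>) \<in> borel_measurable white_noise"
      using gm by (intro borel_measurable_diff)
    note mo = nlaw_moment[OF prob_space_white_noise dm l v0 p0]
    have "v \<le> C * ((b - a) / 2 ^ m) powr \<kappa>"
      unfolding v_def using inc[of "dyad a b m (Suc i)" "dyad a b m i"] i dyad_in[of "Suc i" m] dyad_in[of i m] by (simp add: dyad_step)
    then have "v ^ p \<le> (C * ((b - a) / 2 ^ m) powr \<kappa>) ^ p" using v0 by (intro power_mono)
    also have "\<dots> = C ^ p * ((b - a) / 2 ^ m) powr (real p * \<kappa>)"
      using ab by (simp add: power_mult_distrib powr_power mult.commute)
    also have "((b - a) / 2 ^ m) powr (real p * \<kappa>) = (b - a) powr (real p * \<kappa>) / (2 ^ m) powr (real p * \<kappa>)"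
      using ab by (simp add: powr_divide)
    also have "C ^ p * \<dots> \<le> C ^ p * ((b - a) powr (real p * \<kappa>) / 4 ^ m)"
    proof -
      have "(4::real) ^ m = (2 ^ m) powr 2" by (simp add: powr_numeral power_mult[symmetric] power2_eq_square power_mult_distrib[symmetric])
      also have "\<dots> \<le> (2 ^ m) powr (real p * \<kappa>)" using pk by (intro powr_mono) auto
      finally show ?thesis using C0 ab by (intro mult_left_mono divide_left_mono) auto
    qed
    finally have "v ^ p \<le> C ^ p * ((b - a) powr (real p * \<kappa>) / 4 ^ m)" .
    then have "fact (2 * p) / (2 ^ p * fact p) * v ^ p \<le> fact (2 * p) / (2 ^ p * fact p) * (C ^ p * ((b - a) powr (real p * \<kappa>) / 4 ^ m))"
      by (intro mult_left_mono) auto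
    also have "\<dots> = A / 4 ^ m" by (simp add: A_def)
    finally show "integrable white_noise (\<lambda>\<omega>. (g (dyad a b m (Suc i)) \<omega> - g (dyad a b m i) \<omega>) ^ (2 * p)) \<and>
      (\<integral>\<omega>. (g (dyad a b m (Suc i)) \<omega> - g (dyad a b m i) \<omega>) ^ (2 * p) \<partial>white_noise) \<le> A / 4 ^ m"
      using mo by simp
  qed (use p0 A0 in auto)
  \<comment> \<open>Cauchy-Schwarz bounds the change of \<open>K\<close> in one argument by the root
    of the variance of the increment.\<close>
  have Klim: "(\<lambda>m. K (x m) (y m)) \<longlonglongrightarrow> K s t"
    if x: "x \<longlonglongrightarrow> s" "\<And>m. x m \<in> {a..b}" "s \<in> {a..b}" and y: "y \<longlonglongrightarrow> t" "\<And>m. y m \<in> {a..b}" "t \<in> {a..b}" for x y s t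
  proof -
    have Kb: "\<bar>K u w - K u' w\<bar> \<le> sqrt (C * \<bar>u - u'\<bar> powr \<kappa>) * Mb" if "u \<in> {a..b}" "u' \<in> {a..b}" for u u' w
    proof -
      have "K u w - K u' w = (\<integral>y. (V u y - V u' y) * V w y \<partial>P)" unfolding K_def using Vi by (simp add: left_diff_distrib)
      then have "(K u w - K u' w)\<^sup>2 \<le> (\<integral>y. (V u y - V u' y)\<^sup>2 \<partial>P) * (\<integral>y. (V w y)\<^sup>2 \<partial>P)"
        using Cauchy_Schwarz_integral[of "\<lambda>y. V u y - V u' y" P "V w"] Di V2 by simp
      also have "\<dots> \<le> (C * \<bar>u - u'\<bar> powr \<kappa>) * Mb\<^sup>2"
      proof (intro mult_mono inc that)
        have "(\<integral>y. (V w y)\<^sup>2 \<partial>P) \<le> (\<integral>y. Mb\<^sup>2 \<partial>P)"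
        proof (rule integral_mono)
          show "(V w y)\<^sup>2 \<le> Mb\<^sup>2" for y using power_mono[OF Vb[of w y], of 2] by simp
        qed (use V2 in auto)
        then show "(\<integral>y. (V w y)\<^sup>2 \<partial>P) \<le> Mb\<^sup>2" by (simp add: P.prob_space)
      qed (use C0 in auto)
      finally have "sqrt ((K u w - K u' w)\<^sup>2) \<le> sqrt ((C * \<bar>u - u'\<bar> powr \<kappa>) * Mb\<^sup>2)" by (rule real_sqrt_le_mono)
      then show ?thesis using Mb0 by (simp add: real_sqrt_mult)
    qed
    have z: "(\<lambda>m. sqrt (C * \<bar>x m - s\<bar> powr \<kappa>) * Mb) \<longlonglongrightarrow> 0" if "x \<longlonglongrightarrow> s" for x :: "nat \<Rightarrow> real" and s
    proof -
      have "(\<lambda>m. \<bar>x m - s\<bar>) \<longlonglongrightarrow> 0" using that by (simp add: LIM_zero_iff tendsto_rabs_zero_iff)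
      then have "(\<lambda>m. \<bar>x m - s\<bar> powr \<kappa>) \<longlonglongrightarrow> 0 powr \<kappa>" using k by (intro tendsto_powr2) auto
      then have "(\<lambda>m. sqrt (C * \<bar>x m - s\<bar> powr \<kappa>) * Mb) \<longlonglongrightarrow> sqrt (C * 0 powr \<kappa>) * Mb"
        by (intro tendsto_mult tendsto_real_sqrt tendsto_const)
      then show ?thesis by simp
    qed
    have bd: "\<bar>K (x m) (y m) - K s t\<bar> \<le> sqrt (C * \<bar>x m - s\<bar> powr \<kappa>) * Mb + sqrt (C * \<bar>y m - t\<bar> powr \<kappa>) * Mb" for m
      using Kb[OF x(2)[of m] x(3), of "y m"] Kb[OF y(2)[of m] y(3), of s] Ksym[of s "y m"] Ksym[of s t] by linarith
    have "(\<lambda>m. sqrt (C * \<bar>x m - s\<bar> powr \<kappa>) * Mb + sqrt (C * \<bar>y m - t\<bar> powr \<kappa>) * Mb) \<longlonglongrightarrow> 0 + 0"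
      by (intro tendsto_add z x(1) y(1))
    then have "(\<lambda>m. K (x m) (y m) - K s t) \<longlonglongrightarrow> 0"
      using bd by (intro Lim_null_comparison[of "\<lambda>m. K (x m) (y m) - K s t" "\<lambda>m. sqrt (C * \<bar>x m - s\<bar> powr \<kappa>) * Mb + sqrt (C * \<bar>y m - t\<bar> powr \<kappa>) * Mb"] always_eventually allI)
        (simp_all only: real_norm_def add_0)
    then show ?thesis by (simp add: LIM_zero_iff)
  qed
  have "centered_gp a b K white_noise X"
    unfolding centered_gp_def Let_def nlaw_def[symmetric]
  proof (intro conjI ballI allI impI)
    show "prob_space white_noise" by (rule prob_space_white_noise)
    show "X t \<in> borel_measurable white_noise" if "t \<in> {a..b}" for t using Xm[OF that] .
    show "continuous_on {a..b} (\<lambda>t. X t \<omega>)" for \<omega> by (rule Xc)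
    fix I :: "nat set" and t c :: "nat \<Rightarrow> real"
    assume I: "finite I" and t: "\<forall>i\<in>I. t i \<in> {a..b}"
    define x where "x m i = dyad a b m (dix a b m (t i))" for m i
    have xin: "x m i \<in> {a..b}" if "i \<in> I" for m i unfolding x_def using t that dyad_in[OF dix_bounds(3)] by blast
    have xS: "x m i \<in> S" if "i \<in> I" for m i unfolding x_def using t that dS[OF dix_bounds(3)] by blast
    have xl: "(\<lambda>m. x m i) \<longlonglongrightarrow> t i" if "i \<in> I" for i unfolding x_def using t that dyad_dix_tendsto by blast
    show "distr white_noise borel (\<lambda>\<omega>. \<Sum>i\<in>I. c i * X (t i) \<omega>) = nlaw (\<Sum>i\<in>I. \<Sum>j\<in>I. c i * c j * K (t i) (t j))"
    proof (rule nlaw_limit[where X="\<lambda>m \<omega>. \<Sum>i\<in>I. c i * g (x m i) \<omega>" and v="\<lambda>m. \<Sum>i\<in>I. \<Sum>j\<in>I. c i * c j * K (x m i) (x m j)"])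
      show "prob_space white_noise" by (rule prob_space_white_noise)
      show "(\<lambda>\<omega>. \<Sum>i\<in>I. c i * g (x m i) \<omega>) \<in> borel_measurable white_noise" for m using gm by measurable
      show "(\<lambda>\<omega>. \<Sum>i\<in>I. c i * X (t i) \<omega>) \<in> borel_measurable white_noise"
        using Xm t by (intro borel_measurable_sum borel_measurable_times) auto
      show "distr white_noise borel (\<lambda>\<omega>. \<Sum>i\<in>I. c i * g (x m i) \<omega>) = nlaw (\<Sum>i\<in>I. \<Sum>j\<in>I. c i * c j * K (x m i) (x m j))" for m
        using xS by (intro gl I) auto
      show "0 \<le> (\<Sum>i\<in>I. \<Sum>j\<in>I. c i * c j * K (x m i) (x m j))" for m
      proof -
        have "(\<Sum>i\<in>I. \<Sum>j\<in>I. c i * c j * K (x m i) (x m j)) = (\<integral>y. (\<Sum>i\<in>I. \<Sum>j\<in>I. c i * c j * (V (x m i) y * V (x m j) y)) \<partial>P)"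
          unfolding K_def using Vi by (simp add: Bochner_Integration.integral_sum)
        also have "\<dots> = (\<integral>y. (\<Sum>i\<in>I. c i * V (x m i) y)\<^sup>2 \<partial>P)"
          by (rule Bochner_Integration.integral_cong) (auto simp: power2_eq_square sum_product mult_ac)
        finally show ?thesis by simp
      qed
      show "(\<lambda>m. \<Sum>i\<in>I. \<Sum>j\<in>I. c i * c j * K (x m i) (x m j)) \<longlonglongrightarrow> (\<Sum>i\<in>I. \<Sum>j\<in>I. c i * c j * K (t i) (t j))"
        using t xl xin by (intro tendsto_sum tendsto_mult tendsto_const Klim) auto
      show "AE \<omega> in white_noise. (\<lambda>m. \<Sum>i\<in>I. c i * g (x m i) \<omega>) \<longlonglongrightarrow> (\<Sum>i\<in>I. c i * X (t i) \<omega>)"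
        using Xl by eventually_elim (use t in \<open>auto simp: x_def intro!: tendsto_intros\<close>)
    qed
  qed
  then show ?thesis unfolding K_def by blast
qed

end

section \<open>The quantile of the Gaussian supremum\<close>

text \<open>The density is at most 1 / sqrt (2 pi v) \<le> 1 / sqrt v, and the interval has length 2
  x.\<close>

lemma nlaw_Icc_le:
  assumes v: "v > 0" and x: "x \<ge> 0"
  shows "measure (nlaw v) {-x..x} \<le> 2 * x / sqrt v"
proof -
  interpret real_distribution "nlaw v" using v by (intro real_distribution_nlaw) simp
  have nd: "normal_density 0 (sqrt v) y \<le> 1 / sqrt v" for y
  proof -
    have "normal_density 0 (sqrt v) y = (1 / sqrt (2 * pi * v)) * exp (- (y\<^sup>2) / (2 * v))"
      using v by (simp add: normal_density_def)
    also have "\<dots> \<le> (1 / sqrt (2 * pi * v)) * 1" using v by (intro mult_left_mono) auto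
    also have "\<dots> \<le> 1 / sqrt v"
    proof -
      have "1 * v \<le> (2 * pi) * v" using v pi_ge_two by (intro mult_right_mono) auto
      then show ?thesis using v by (simp add: frac_le)
    qed
    finally show ?thesis .
  qed
  have "emeasure (nlaw v) {-x..x} = (\<integral>\<^sup>+ y. ennreal (normal_density 0 (sqrt v) y) * indicator {-x..x} y \<partial>lborel)"
    using v unfolding nlaw_def by (simp add: emeasure_density)
  also have "\<dots> \<le> (\<integral>\<^sup>+ y. ennreal (1 / sqrt v) * indicator {-x..x} y \<partial>lborel)"
    using nd by (intro nn_integral_mono mult_right_mono ennreal_leI) auto
  also have "\<dots> = ennreal (1 / sqrt v) * ennreal (2 * x)" using x by (simp add: nn_integral_cmult_indicator)
  also have "\<dots> = ennreal (2 * x / sqrt v)" using x v by (simp flip: ennreal_mult)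
  finally show ?thesis using x v unfolding emeasure_eq_measure by (subst (asm) ennreal_le_iff) auto
qed

lemma gp_sup_measurable:
  assumes ab: "a < b" and gp: "centered_gp a b K N G"
  shows "{\<omega> \<in> space N. (SUP t\<in>{a..b}. \<bar>G t \<omega>\<bar>) \<le> x} \<in> sets N"
proof -
  have Gm: "G t \<in> borel_measurable N" if "t \<in> {a..b}" for t using gp that by (simp add: centered_gp_def)
  have Gc: "continuous_on {a..b} (\<lambda>t. G t \<omega>)" if "\<omega> \<in> space N" for \<omega> using gp that by (simp add: centered_gp_def)
  have "{\<omega> \<in> space N. (SUP t\<in>{a..b}. \<bar>G t \<omega>\<bar>) \<le> x} = {\<omega> \<in> space N. \<forall>t\<in>\<rat> \<inter> {a<..<b}. \<bar>G t \<omega>\<bar> \<le> x}"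
  proof (rule Collect_cong, rule conj_cong[OF refl])
    fix \<omega> assume w: "\<omega> \<in> space N"
    show "(SUP t\<in>{a..b}. \<bar>G t \<omega>\<bar>) \<le> x \<longleftrightarrow> (\<forall>t\<in>\<rat> \<inter> {a<..<b}. \<bar>G t \<omega>\<bar> \<le> x)"
      unfolding SUP_abs_le_iff[OF ab Gc[OF w]]
      using continuous_abs_le_dense[OF ab Gc[OF w]] by (meson IntD2 greaterThanLessThan_iff atLeastAtMost_iff less_imp_le)
  qed
  also have "\<dots> \<in> sets N"
  proof (rule sets.sets_Collect_countable_All')
    fix t assume "t \<in> \<rat> \<inter> {a<..<b}"
    then have [measurable]: "G t \<in> borel_measurable N" by (intro Gm) auto
    show "{\<omega> \<in> space N. \<bar>G t \<omega>\<bar> \<le> x} \<in> sets N" by measurable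
  qed (simp add: countable_rat)
  finally show ?thesis .
qed

text \<open>If the supremum is at most x with probability 1 - \<gamma> or more, so is the single
  value |G t|; but a centred normal variable of variance \<open>K t t\<close> falls into [-x, x]
  with probability at most 2 x / sqrt (K t t).\<close>

lemma gauss_sup_quantile_ge:
  fixes N :: "(nat \<Rightarrow> real) measure"
  assumes ab: "a < b" and gp: "centered_gp a b K N G" and t: "t \<in> {a..b}" and v: "K t t > 0" and ga: "0 < \<gamma>" "\<gamma> < 1"
  shows "gauss_sup_quantile a b K \<gamma> \<ge> sqrt (K t t) * ((1 - \<gamma>) / 2)"
proof -
  interpret N: prob_space N using gp by (simp add: centered_gp_def)
  define F where "F x = measure N {\<omega> \<in> space N. (SUP t\<in>{a..b}. \<bar>G t \<omega>\<bar>) \<le> x}" for x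
  define Q where "Q = {x. F x \<ge> 1 - \<gamma>}"
  \<comment> \<open>The given process makes the universal condition in the description non-vacuous,
    so at most one number satisfies it. Equality of the laws of all suprema shows that
    \<open>Inf Q\<close> does.\<close>
  have q: "gauss_sup_quantile a b K \<gamma> = Inf Q"
    unfolding gauss_sup_quantile_def
  proof (rule the_equality)
    show "\<forall>(M::(nat \<Rightarrow> real) measure) G'. centered_gp a b K M G' \<longrightarrow>
        Inf Q = Inf {x. measure M {\<omega>\<in>space M. (SUP t\<in>{a..b}. \<bar>G' t \<omega>\<bar>) \<le> x} \<ge> 1 - \<gamma>}"
    proof (intro allI impI)
      fix M' :: "(nat \<Rightarrow> real) measure" and G' assume c: "centered_gp a b K M' G'"
      show "Inf Q = Inf {x. measure M' {\<omega>\<in>space M'. (SUP t\<in>{a..b}. \<bar>G' t \<omega>\<bar>) \<le> x} \<ge> 1 - \<gamma>}"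
        unfolding Q_def F_def gp_sup_dist_unique[OF ab gp c] ..
    qed
    fix c assume "\<forall>(M::(nat \<Rightarrow> real) measure) G'. centered_gp a b K M G' \<longrightarrow>
        c = Inf {x. measure M {\<omega>\<in>space M. (SUP t\<in>{a..b}. \<bar>G' t \<omega>\<bar>) \<le> x} \<ge> 1 - \<gamma>}"
    then show "c = Inf Q" unfolding Q_def F_def using gp by blast
  qed
  have Gc: "continuous_on {a..b} (\<lambda>t. G t \<omega>)" if "\<omega> \<in> space N" for \<omega> using gp that by (simp add: centered_gp_def)
  note sm = gp_sup_measurable[OF ab gp]
  have "(\<lambda>n. F (real n)) \<longlonglongrightarrow> measure N (\<Union>n. {\<omega> \<in> space N. (SUP t\<in>{a..b}. \<bar>G t \<omega>\<bar>) \<le> real n})"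
    unfolding F_def using sm by (intro N.finite_Lim_measure_incseq) (auto simp: incseq_def elim: order_trans)
  also have "(\<Union>n. {\<omega> \<in> space N. (SUP t\<in>{a..b}. \<bar>G t \<omega>\<bar>) \<le> real n}) = space N"
    using real_arch_simple by blast
  finally have "(\<lambda>n. F (real n)) \<longlonglongrightarrow> 1" by (simp add: N.prob_space)
  then have "eventually (\<lambda>n. F (real n) > 1 - \<gamma>) sequentially" using ga by (intro order_tendstoD(1)) auto
  then obtain n where "F (real n) > 1 - \<gamma>" by (auto simp: eventually_sequentially)
  \<comment> \<open>A lower bound of \<open>Q\<close> passes to its infimum only if \<open>Q\<close>
    is nonempty; this holds because every path is bounded.\<close>
  then have ne: "Q \<noteq> {}" unfolding Q_def by (auto intro: less_imp_le)
  have Gm: "G t \<in> borel_measurable N" using gp t by (simp add: centered_gp_def)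
  have law: "distr N borel (G t) = nlaw (K t t)"
  proof -
    have "\<forall>(I::nat set) (t::nat \<Rightarrow> real) (c::nat \<Rightarrow> real). finite I \<longrightarrow> (\<forall>i\<in>I. t i \<in> {a..b}) \<longrightarrow>
        distr N borel (\<lambda>\<omega>. \<Sum>i\<in>I. c i * G (t i) \<omega>) = nlaw (\<Sum>i\<in>I. \<Sum>j\<in>I. c i * c j * K (t i) (t j))"
      using gp unfolding centered_gp_def Let_def nlaw_def[symmetric] by blast
    from this[rule_format, of "{0}" "\<lambda>_. t" "\<lambda>_. 1"] show ?thesis using t by simp
  qed
  have "sqrt (K t t) * ((1 - \<gamma>) / 2) \<le> x" if "x \<in> Q" for x
  proof -
    have "1 - \<gamma> \<le> F x" using that by (simp add: Q_def)
    also have "F x \<le> measure N {\<omega> \<in> space N. G t \<omega> \<in> {-x..x}}"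
      unfolding F_def
    proof (rule N.finite_measure_mono)
      show "{\<omega> \<in> space N. (SUP t\<in>{a..b}. \<bar>G t \<omega>\<bar>) \<le> x} \<subseteq> {\<omega> \<in> space N. G t \<omega> \<in> {-x..x}}"
      proof
        fix \<omega> assume "\<omega> \<in> {\<omega> \<in> space N. (SUP t\<in>{a..b}. \<bar>G t \<omega>\<bar>) \<le> x}"
        then have w: "\<omega> \<in> space N" and "(SUP t\<in>{a..b}. \<bar>G t \<omega>\<bar>) \<le> x" by auto
        then have "\<bar>G t \<omega>\<bar> \<le> x" unfolding SUP_abs_le_iff[OF ab Gc[OF w]] using t by blast
        then show "\<omega> \<in> {\<omega> \<in> space N. G t \<omega> \<in> {-x..x}}" using w by (simp add: abs_le_iff)
      qed
      show "{\<omega> \<in> space N. G t \<omega> \<in> {-x..x}} \<in> sets N" using Gm by measurable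
    qed
    also have "\<dots> = measure (nlaw (K t t)) {-x..x}"
      unfolding law[symmetric] using Gm by (subst measure_distr) (auto intro!: arg_cong[where f="measure N"])
    finally have le: "1 - \<gamma> \<le> measure (nlaw (K t t)) {-x..x}" .
    have x0: "x \<ge> 0"
    proof (rule ccontr)
      assume "\<not> x \<ge> 0"
      then have "{-x..x} = {}" by auto
      then show False using le ga by simp
    qed
    have "1 - \<gamma> \<le> 2 * x / sqrt (K t t)" using le nlaw_Icc_le[OF v x0] by linarith
    then show ?thesis using v by (simp add: field_simps)
  qed
  then show ?thesis unfolding q by (intro cInf_greatest[OF ne])
qed

section \<open>Nondegeneracy of the Gaussian process in the model\<close>

context decon
begin

lemma cov_G2_P: "cov_G2 a b f \<phi> = (\<lambda>u v. \<integral>y. f (y - u) * f (y - v) \<partial>P)"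
proof (intro ext)
  fix u v
  show "cov_G2 a b f \<phi> u v = (\<integral>y. f (y - u) * f (y - v) \<partial>P)"
    unfolding cov_G2_def by (subst integral_P(1)) (auto simp: mult.assoc)
qed

text \<open>Off the jump set the increment is at most \<open>M * d powr s\<close>, and the jump set
  has probability of order d. As d \<le> b - a, both d^(2s) and d are at most a constant times d^s,
  which leaves the exponent s for the path construction.\<close>

lemma increment_bound:
  assumes "t \<in> {a..b}" "u \<in> {a..b}"
  shows "(\<integral>y. (f (y - t) - f (y - u))\<^sup>2 \<partial>P) \<le> (2 * M\<^sup>2 * (b - a) powr s + 8 * M ^ 3 * (b - a) powr (1 - s)) * \<bar>t - u\<bar> powr s"
proof -
  define d where "d = \<bar>t - u\<bar>"
  have d: "0 \<le> d" "d \<le> b - a" using assms by (auto simp: d_def)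
  define J where "J = (indicator (jump d t) :: real \<Rightarrow> real)"
  have [measurable]: "J \<in> borel_measurable borel" unfolding J_def by measurable
  have iJ: "integrable P J" by (rule Y.bounded_integrable[where c=1]) (auto simp: J_def indicator_def)
  have "(\<integral>y. (f (y - t) - f (y - u))\<^sup>2 \<partial>P) \<le> (\<integral>y. 2 * (M * d powr s)\<^sup>2 + 2 * M\<^sup>2 * J y \<partial>P)"
  proof (rule integral_mono)
    have "\<bar>(f (y - t) - f (y - u))\<^sup>2\<bar> \<le> M\<^sup>2" for y using power_mono[OF f_diff_le[of "y - t" "y - u"], of 2] by simp
    then show "integrable P (\<lambda>y. (f (y - t) - f (y - u))\<^sup>2)" by (intro Y.bounded_integrable) auto
    show "integrable P (\<lambda>y. 2 * (M * d powr s)\<^sup>2 + 2 * M\<^sup>2 * J y)" using iJ by auto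
    fix y
    have "\<bar>f (y - t) - f (y - u)\<bar> \<le> M * d powr s + M * J y" unfolding J_def by (rule f_modulus_jump) (simp add: d_def abs_minus_commute)
    then have "(f (y - t) - f (y - u))\<^sup>2 \<le> (M * d powr s + M * J y)\<^sup>2" using power_mono[of "\<bar>f (y - t) - f (y - u)\<bar>" _ 2] by simp
    also have "\<dots> \<le> 2 * (M * d powr s)\<^sup>2 + 2 * (M * J y)\<^sup>2"
      using sum_squares_bound[of "M * d powr s" "M * J y"] by (simp add: power2_sum)
    also have "(M * J y)\<^sup>2 = M\<^sup>2 * J y" by (auto simp: J_def indicator_def power_mult_distrib)
    finally show "(f (y - t) - f (y - u))\<^sup>2 \<le> 2 * (M * d powr s)\<^sup>2 + 2 * M\<^sup>2 * J y" by simp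
  qed
  also have "\<dots> = 2 * (M * d powr s)\<^sup>2 + 2 * M\<^sup>2 * measure P (jump d t)"
    using iJ by (simp add: Y.prob_space) (simp add: J_def Ymeasure_def)
  also have "\<dots> \<le> 2 * (M * d powr s)\<^sup>2 + 2 * M\<^sup>2 * (4 * M * d)"
    using measure_jump[OF d(1), of t] by (intro add_left_mono mult_left_mono) auto
  also have "\<dots> = 2 * M\<^sup>2 * (d powr s * d powr s) + 8 * M ^ 3 * d"
    by (simp add: power_mult_distrib power2_eq_square power3_eq_cube)
  also have "\<dots> \<le> 2 * M\<^sup>2 * ((b - a) powr s * d powr s) + 8 * M ^ 3 * ((b - a) powr (1 - s) * d powr s)"
  proof (intro add_mono mult_left_mono)
    show "d powr s * d powr s \<le> (b - a) powr s * d powr s" using d s by (intro mult_right_mono powr_mono2) auto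
    show "d \<le> (b - a) powr (1 - s) * d powr s"
    proof (cases "d = 0")
      case False
      then have "d = d powr (1 - s) * d powr s" using d by (simp flip: powr_add)
      also have "\<dots> \<le> (b - a) powr (1 - s) * d powr s" using d s by (intro mult_right_mono powr_mono2) auto
      finally show ?thesis .
    qed simp
  qed (use M_pos in auto)
  finally show ?thesis by (simp add: d_def algebra_simps)
qed

lemma cov_gp_exists: "\<exists>X. centered_gp a b (cov_G2 a b f \<phi>) white_noise X"
  unfolding cov_G2_P
  by (rule centered_gp_exists[OF ab Y.prob_space_axioms _ _ increment_bound s(1), where Mb=M])
     (auto simp: f_bd measurable_cong_sets[OF Y.sets_P refl])

text \<open>By Cauchy-Schwarz against the constant 1, the unit mass of r gives |r|^2 \<ge> 1 / (b -
  a). As |r|^2 is the inner product of \<phi> and \<open>A \<phi>\<close>, it is an average of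
  \<open>A \<phi>\<close> under the density \<phi>, so the maximum of \<open>A \<phi>\<close> is at
  least as large. The bounds for the quantile and for the norm of T* both rest on this
  point.\<close>

lemma signal_point: "\<exists>t\<in>{a..b}. A \<phi> t \<ge> 1 / (b - a)"
proof -
  have rL: "L2 r" by (rule L2_T[OF phi_L2])
  have "(\<integral>y. r y \<partial>lborel) = 1"
    using nn_integral_r r_nonneg by (intro integral_eq_nn_integral[THEN trans]) auto
  then have r1: "(\<integral>y. r y \<partial>mu a b) = 1" using integral_mu_lborel[OF r_zero] by simp
  have "(\<integral>y. r y * 1 \<partial>mu a b)\<^sup>2 \<le> (\<integral>y. (r y)\<^sup>2 \<partial>mu a b) * (\<integral>y. 1\<^sup>2 \<partial>mu a b)"
    using rL finite_measure.integrable_const[OF finite_measure_mu] by (intro Cauchy_Schwarz_integral) (auto simp: L2fun_mu)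
  also have "(\<integral>y. 1\<^sup>2 \<partial>mu a b) = b - a" using ab by (simp add: measure_mu space_restrict_space)
  also have "(\<integral>y. (r y)\<^sup>2 \<partial>mu a b) = ip r r" by (simp add: L2inner_mu power2_eq_square)
  also have "\<dots> = ip \<phi> (A \<phi>)" using T_adjoint[OF phi_L2 rL] by (simp add: A_eq)
  finally have ge: "1 / (b - a) \<le> ip \<phi> (A \<phi>)" using r1 ab by (simp add: field_simps)
  obtain t where t: "t \<in> {a..b}" "\<And>u. u \<in> {a..b} \<Longrightarrow> A \<phi> u \<le> A \<phi> t"
    using continuous_attains_sup[OF compact_Icc _ A_cont[OF phi_L2]] ab by auto
  have "ip \<phi> (A \<phi>) \<le> (\<integral>u. \<phi> u * A \<phi> t \<partial>mu a b)"
    unfolding L2inner_mu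
    using t phi_nonneg L2fun_integrable_mult[OF phi_L2 L2_A[OF phi_L2]] L2fun_integrable[OF phi_L2]
    by (intro integral_mono mult_left_mono) (auto simp: space_restrict_space)
  also have "\<dots> = A \<phi> t" using integral_mu_lborel[OF phi_zero] phi_int by simp
  finally show ?thesis using ge t(1) by (intro bexI[of _ t]) auto
qed

text \<open>At the point t of \<open>signal_point\<close> the variance is the second moment of f (Y
  - t), which is at least the squared mean \<open>A \<phi> t\<close>; its root is therefore at least
  1 / (b - a).\<close>

lemma quantile_ge:
  assumes ga: "0 < \<gamma>" "\<gamma> < 1"
  shows "gauss_sup_quantile a b (cov_G2 a b f \<phi>) \<gamma> \<ge> (1 - \<gamma>) / (2 * (b - a))"
proof -
  obtain t where t: "t \<in> {a..b}" "A \<phi> t \<ge> 1 / (b - a)" using signal_point by blast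
  obtain X where X: "centered_gp a b (cov_G2 a b f \<phi>) white_noise X" using cov_gp_exists by blast
  have fm: "(\<lambda>y. f (y - t)) \<in> borel_measurable P" by (simp add: measurable_cong_sets[OF Y.sets_P refl])
  have "\<bar>(f (y - t))\<^sup>2\<bar> \<le> M\<^sup>2" for y using power_mono[OF f_bd[of "y - t"], of 2] by simp
  then have "integrable P (\<lambda>y. (f (y - t))\<^sup>2)" by (intro Y.bounded_integrable[where c="M\<^sup>2"]) auto
  then have "(\<integral>y. f (y - t) * 1 \<partial>P)\<^sup>2 \<le> (\<integral>y. (f (y - t))\<^sup>2 \<partial>P) * (\<integral>y. 1\<^sup>2 \<partial>P)"
    by (intro Cauchy_Schwarz_integral fm) auto
  then have "(A \<phi> t)\<^sup>2 \<le> cov_G2 a b f \<phi> t t"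
    by (simp add: A_phi cov_G2_P Y.prob_space power2_eq_square)
  moreover have "(1 / (b - a))\<^sup>2 \<le> (A \<phi> t)\<^sup>2" using t ab by (intro power_mono) auto
  ultimately have c: "(1 / (b - a))\<^sup>2 \<le> cov_G2 a b f \<phi> t t" by linarith
  moreover have "0 < (1 / (b - a))\<^sup>2" using ab by simp
  ultimately have pos: "cov_G2 a b f \<phi> t t > 0" by linarith
  have "sqrt ((1 / (b - a))\<^sup>2) \<le> sqrt (cov_G2 a b f \<phi> t t)" using c by (rule real_sqrt_le_mono)
  then have "1 / (b - a) \<le> sqrt (cov_G2 a b f \<phi> t t)" using ab by simp
  then have "1 / (b - a) * ((1 - \<gamma>) / 2) \<le> sqrt (cov_G2 a b f \<phi> t t) * ((1 - \<gamma>) / 2)" using ga by (intro mult_right_mono) auto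
  also have "\<dots> \<le> gauss_sup_quantile a b (cov_G2 a b f \<phi>) \<gamma>" by (rule gauss_sup_quantile_ge[OF ab X t(1) pos ga])
  finally show ?thesis by (simp add: mult.commute)
qed

section \<open>Lower bounds for the radii of the bands\<close>

text \<open>Test function r / |r|: its image under \<open>T'\<close> is \<open>A \<phi>\<close>
  divided by |r| \<le> \<open>B\<close>, evaluated at the point of \<open>signal_point\<close>. The
  assumption \<open>bdd\<close> makes the supremum over the unit ball an actual upper bound.\<close>

lemma Tadj_norm_ge:
  assumes bdd: "bdd_above ((\<lambda>\<psi>. supnorm a b (Tadj a b f \<psi>)) ` {\<psi>. L2fun a b \<psi> \<and> L2norm a b \<psi> \<le> 1})"
  shows "Tadj_norm_2inf a b f \<ge> 1 / ((b - a) * B)"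
proof -
  obtain t where t: "t \<in> {a..b}" "A \<phi> t \<ge> 1 / (b - a)" using signal_point by blast
  have rL: "L2 r" by (rule L2_T[OF phi_L2])
  have nr: "nm r \<le> B"
    unfolding B_def using ab r_nonneg r_le by (intro L2norm_bounded) auto
  have npos: "nm r > 0"
  proof (rule ccontr)
    assume "\<not> nm r > 0"
    then have "nm r = 0" using L2norm_nonneg[of a b r] by simp
    then have "A \<phi> t = 0" using A_bound_T[OF phi_L2, of t] by simp
    moreover have "1 / (b - a) > 0" using ab by simp
    ultimately show False using t by simp
  qed
  define \<psi> where "\<psi> y = (1 / nm r) * r y" for y
  have pL: "L2 \<psi>" unfolding \<psi>_def by (rule L2fun_scale[OF rL])
  have pn: "nm \<psi> = 1" unfolding \<psi>_def L2norm_scale using npos by simp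
  have "1 / ((b - a) * B) \<le> 1 / ((b - a) * nm r)" using nr npos ab by (intro divide_left_mono mult_left_mono) (auto intro: mult_pos_pos)
  also have "\<dots> = (1 / nm r) * (1 / (b - a))" by simp
  also have "\<dots> \<le> (1 / nm r) * A \<phi> t" using t npos by (intro mult_left_mono) auto
  also have "\<dots> = T' \<psi> t" unfolding \<psi>_def T'_scale by (simp add: A_eq)
  also have "\<dots> \<le> supnorm a b (T' \<psi>)"
    unfolding supnorm_def
    by (rule cSUP_upper2[OF _ t(1)]) (use T'_bound[OF pL] in \<open>auto intro!: bdd_aboveI[where M="B * nm \<psi>"]\<close>)
  also have "\<dots> \<le> Tadj_norm_2inf a b f"
    unfolding Tadj_norm_2inf_def by (rule cSUP_upper[OF _ bdd]) (use pL pn in auto)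
  finally show ?thesis .
qed

text \<open>\<open>f\<close> has mass 1 on an interval of length b - a.\<close>

lemma f_sup_ge: "(SUP x. \<bar>f x\<bar>) \<ge> 1 / (b - a)"
proof -
  have bdd: "bdd_above (range (\<lambda>x. \<bar>f x\<bar>))" using f_bd by (intro bdd_aboveI[where M=M]) auto
  define F where "F = (SUP x. \<bar>f x\<bar>)"
  have le: "f x \<le> F" for x unfolding F_def by (rule cSUP_upper2[OF bdd UNIV_I[of x]]) simp
  have "1 = integral\<^sup>L (mu a b) f" using integral_mu_lborel[OF f_zero] f_int by simp
  also have "\<dots> \<le> (\<integral>x. F \<partial>mu a b)"
    using le L2fun_integrable[OF L2fun_bounded[OF f_meas f_bd]] finite_measure.integrable_const[OF finite_measure_mu]
    by (intro integral_mono) auto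
  also have "\<dots> = (b - a) * F" using ab by (simp add: measure_mu space_restrict_space)
  finally show ?thesis using ab by (simp add: F_def field_simps)
qed

text \<open>Makes the supremum in \<open>supnorm\<close> a genuine one, so that it can be compared
  with numbers.\<close>

lemma resolvent_bounded:
  assumes al: "\<alpha> > 0"
  shows "\<exists>c. \<forall>z\<in>{a..b}. \<bar>resolvent a b f \<alpha> (\<lambda>z. (\<Sum>i<n. v i * f (y i - z)) / real n) z\<bar> \<le> c"
proof -
  define h where "h z = (\<Sum>i<n. v i * f (y i - z)) / real n" for z
  have hL: "L2 h"
  proof -
    have "h = (\<lambda>z. \<Sum>i<n. (v i / real n) * f (y i - z))" by (rule ext) (simp add: h_def sum_divide_distrib)
    then show ?thesis by (simp only:) (intro L2fun_sum L2fun_scale L2_slice)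
  qed
  have hb: "\<bar>h z\<bar> \<le> (\<Sum>i<n. \<bar>v i\<bar> * M) / real n" for z
  proof -
    have "\<bar>\<Sum>i<n. v i * f (y i - z)\<bar> \<le> (\<Sum>i<n. \<bar>v i\<bar> * M)"
      by (rule order_trans[OF sum_abs sum_mono]) (auto simp: abs_mult f_bd intro!: mult_left_mono)
    then show ?thesis by (simp add: h_def divide_right_mono)
  qed
  have "\<bar>resolvent a b f \<alpha> h z\<bar> \<le> ((\<Sum>i<n. \<bar>v i\<bar> * M) / real n + B * nm (T (resolvent a b f \<alpha> h))) / \<alpha>" if "z \<in> {a..b}" for z
    using solves_sup_bound[OF al resolvent_solves(1)[OF al hL] that] hb[of z] al
    by (elim order_trans) (intro divide_right_mono, auto)
  then show ?thesis unfolding h_def by blast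
qed

lemma supnorm_nu_le_iff:
  assumes al: "\<alpha> > 0"
  shows "supnorm a b (nu_eps a b f \<alpha> n y v) \<le> x \<longleftrightarrow>
    (\<forall>z\<in>{a..b}. \<bar>resolvent a b f \<alpha> (\<lambda>z. (\<Sum>i<n. v i * f (y i - z)) / real n) z - 0\<bar> \<le> x)"
proof -
  obtain c where "\<forall>z\<in>{a..b}. \<bar>resolvent a b f \<alpha> (\<lambda>z. (\<Sum>i<n. v i * f (y i - z)) / real n) z\<bar> \<le> c"
    using resolvent_bounded[OF al, of v y n] by blast
  then have "bdd_above ((\<lambda>z. \<bar>resolvent a b f \<alpha> (\<lambda>z. (\<Sum>i<n. v i * f (y i - z)) / real n) z\<bar>) ` {a..b})"
    by (intro bdd_aboveI[where M=c]) auto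
  then show ?thesis using ab unfolding supnorm_def nu_eps_def by (subst cSUP_le_iff) auto
qed

lemma supnorm_nu_nonneg: assumes al: "\<alpha> > 0" shows "supnorm a b (nu_eps a b f \<alpha> n y v) \<ge> 0"
proof -
  have "\<bar>resolvent a b f \<alpha> (\<lambda>z. (\<Sum>i<n. v i * f (y i - z)) / real n) a - 0\<bar> \<le> supnorm a b (nu_eps a b f \<alpha> n y v)"
    using supnorm_nu_le_iff[OF al, of n y v "supnorm a b (nu_eps a b f \<alpha> n y v)"] ab by auto
  then show ?thesis by linarith
qed

lemma in_band_iff: "in_band a b \<phi> c q \<longleftrightarrow> (\<forall>z\<in>{a..b}. \<bar>c z - \<phi> z\<bar> \<le> q)"
  unfolding in_band_def by (intro ball_cong refl) (auto simp: abs_le_iff)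

text \<open>The coverage event for a deterministic radius. It involves the observations but not the
  signs, so that one estimate serves both bands.\<close>

definition near :: "real \<Rightarrow> nat \<Rightarrow> real \<Rightarrow> (nat \<Rightarrow> real) set" where
  "near \<alpha> n q = {\<omega> \<in> space (Y.S n). \<forall>z\<in>{a..b}. \<bar>phihat a b f \<alpha> n \<omega> z - \<phi> z\<bar> \<le> q}"

lemma near_sets: assumes al: "\<alpha> > 0" shows "near \<alpha> n q \<in> sets (Y.S n)"
  unfolding near_def phihat_def
  using band_measurable[OF al f_cont f_zero phi_cont phi_meas, of n "\<lambda>i \<omega>. \<omega> i" "Y.S n" "\<lambda>i \<omega>. 1" "\<lambda>_. q"]
  by (simp add: Y.coord_measurable)

lemma coverage_g_ge:
  assumes al: "\<alpha> > 0" and q: "q \<le> q_g a b f \<phi> \<alpha> \<gamma> n"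
  shows "coverage_g a b f \<phi> \<alpha> \<gamma> n \<ge> measure (Y.S n) (near \<alpha> n q)"
proof -
  interpret Sn: prob_space "Y.S n" by (rule Y.prob_space_S)
  have "coverage_g a b f \<phi> \<alpha> \<gamma> n = measure (Y.S n) (near \<alpha> n (q_g a b f \<phi> \<alpha> \<gamma> n))"
    unfolding coverage_g_def sample_Y_def near_def in_band_iff ..
  moreover have "measure (Y.S n) (near \<alpha> n q) \<le> \<dots>"
    using q by (intro Sn.finite_measure_mono near_sets[OF al]) (auto simp: near_def intro: order_trans)
  ultimately show ?thesis by simp
qed

lemma prob_space_rademacher: "prob_space rademacher"
  unfolding rademacher_def by (rule prob_space_measure_pmf)

text \<open>The lower bound for the radius holds for all signs, so the coverage event contains
  \<open>near \<alpha> n q\<close> times the whole space of signs. Most of the work is the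
  measurability of the random radius.\<close>

lemma coverage_ci_ge:
  assumes al: "\<alpha> > 0" and q: "\<And>y v. q \<le> q_ci a b f \<alpha> \<gamma> n y v"
  shows "coverage_ci a b f \<phi> \<alpha> \<gamma> n \<ge> measure (Y.S n) (near \<alpha> n q)"
proof -
  let ?R = "\<Pi>\<^sub>M i\<in>{..<n}. rademacher"
  let ?Q = "Y.S n \<Otimes>\<^sub>M ?R"
  interpret Sn: prob_space "Y.S n" by (rule Y.prob_space_S)
  interpret R: prob_space ?R by (intro prob_space_PiM prob_space_rademacher)
  interpret Q: pair_prob_space "Y.S n" ?R ..
  have sr: "sets rademacher = UNIV" unfolding rademacher_def by simp
  have ym: "(\<lambda>p. fst p i) \<in> borel_measurable ?Q" if "i < n" for i
    by (rule measurable_compose[OF measurable_fst Y.coord_measurable[OF that]])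
  have vm: "(\<lambda>p. snd p i) \<in> borel_measurable ?Q" if "i < n" for i
  proof -
    have "(\<lambda>\<omega>. \<omega> i) \<in> ?R \<rightarrow>\<^sub>M rademacher" using that by (intro measurable_component_singleton) auto
    moreover have "(\<lambda>x. x) \<in> rademacher \<rightarrow>\<^sub>M borel" unfolding rademacher_def by simp
    ultimately have "(\<lambda>\<omega>. \<omega> i) \<in> ?R \<rightarrow>\<^sub>M borel" by (rule measurable_compose)
    then show ?thesis by (rule measurable_compose[OF measurable_snd])
  qed
  \<comment> \<open>The sublevel sets of the supremum norm are band events around the zero
    function.\<close>
  have sm: "(\<lambda>p. supnorm a b (nu_eps a b f \<alpha> n (fst p) (snd p))) \<in> borel_measurable ?Q"
  proof (rule borel_measurable_iff_le[THEN iffD2], rule allI)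
    fix x :: real
    show "{p \<in> space ?Q. supnorm a b (nu_eps a b f \<alpha> n (fst p) (snd p)) \<le> x} \<in> sets ?Q"
      unfolding supnorm_nu_le_iff[OF al]
      by (rule band_measurable[OF al f_cont f_zero, where \<phi>="\<lambda>_. 0" and y="\<lambda>i p. fst p i" and v="\<lambda>i p. snd p i" and q="\<lambda>_. x"])
         (auto intro: ym vm)
  qed
  have qm: "(\<lambda>p. q_ci a b f \<alpha> \<gamma> n (fst p) (snd p)) \<in> borel_measurable ?Q"
    unfolding q_ci_def by (intro borel_measurable_add borel_measurable_times sm borel_measurable_const)
  define E where "E = {p \<in> space ?Q. \<forall>z\<in>{a..b}. \<bar>phihat a b f \<alpha> n (fst p) z - \<phi> z\<bar> \<le> q_ci a b f \<alpha> \<gamma> n (fst p) (snd p)}"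
  have Em: "E \<in> sets ?Q"
    unfolding E_def phihat_def
    using band_measurable[OF al f_cont f_zero phi_cont phi_meas ym _ qm, where v="\<lambda>i \<omega>. 1"] by simp
  have "coverage_ci a b f \<phi> \<alpha> \<gamma> n = measure ?Q E"
    unfolding coverage_ci_def sample_space_def in_band_iff E_def by (simp add: case_prod_beta')
  moreover have "measure ?Q (near \<alpha> n q \<times> space ?R) \<le> measure ?Q E"
  proof (rule Q.finite_measure_mono[OF _ Em])
    show "near \<alpha> n q \<times> space ?R \<subseteq> E"
      unfolding near_def E_def space_pair_measure using q
      by (auto intro!: order_trans[OF _ q])
  qed
  moreover have "measure ?Q (near \<alpha> n q \<times> space ?R) = measure (Y.S n) (near \<alpha> n q)"
  proof -
    have "emeasure ?Q (near \<alpha> n q \<times> space ?R) = emeasure (Y.S n) (near \<alpha> n q)"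
      using near_sets[OF al] by (subst R.emeasure_pair_measure_Times) (auto simp: R.emeasure_space_1)
    then show ?thesis by (simp add: measure_def)
  qed
  ultimately show ?thesis by simp
qed

lemma q_g_ge:
  assumes al: "\<alpha> > 0" and ga: "0 < \<gamma>" "\<gamma> < 1"
    and bdd: "bdd_above ((\<lambda>\<psi>. supnorm a b (Tadj a b f \<psi>)) ` {\<psi>. L2fun a b \<psi> \<and> L2norm a b \<psi> \<le> 1})"
  shows "(1 - \<gamma>) / (2 * (b - a)) * (1 / ((b - a) * B) / 2) / (\<alpha> powr (3/2) * sqrt (real n)) \<le> q_g a b f \<phi> \<alpha> \<gamma> n"
proof -
  have "(1 - \<gamma>) / (2 * (b - a)) * (1 / ((b - a) * B) / 2) \<le>
      gauss_sup_quantile a b (cov_G2 a b f \<phi>) \<gamma> * (Tadj_norm_2inf a b f / 2 + sqrt \<alpha>)"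
  proof (rule mult_mono[OF quantile_ge[OF ga]])
    show "1 / ((b - a) * B) / 2 \<le> Tadj_norm_2inf a b f / 2 + sqrt \<alpha>" using Tadj_norm_ge[OF bdd] al by (simp add: add_increasing2)
    have "0 \<le> (1 - \<gamma>) / (2 * (b - a))" using ga ab by simp
    then show "0 \<le> gauss_sup_quantile a b (cov_G2 a b f \<phi>) \<gamma>" using quantile_ge[OF ga] by linarith
    show "0 \<le> 1 / ((b - a) * B) / 2" using ab B_nonneg by simp
  qed
  then show ?thesis unfolding q_g_def using al by (intro divide_right_mono) auto
qed

text \<open>The random summand is bounded below by 0. In the other one, three times the supremum of
  \<open>f\<close> is at least 3 / (b - a) and the root of the logarithm at least 1, so the constant
  obtained for the Gaussian radius serves here as well.\<close>

lemma q_ci_ge: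
  assumes al: "\<alpha> > 0" and ga: "0 < \<gamma>" "\<gamma> < 1"
    and bdd: "bdd_above ((\<lambda>\<psi>. supnorm a b (Tadj a b f \<psi>)) ` {\<psi>. L2fun a b \<psi> \<and> L2norm a b \<psi> \<le> 1})"
  shows "(1 - \<gamma>) / (2 * (b - a)) * (1 / ((b - a) * B) / 2) / (\<alpha> powr (3/2) * sqrt (real n)) \<le> q_ci a b f \<alpha> \<gamma> n y v"
proof -
  have l1: "1 \<le> sqrt (2 * ln (2 / \<gamma>))"
  proof -
    have "(1::real) \<le> 2 * ln 2" using ln2_ge_two_thirds by simp
    also have "\<dots> \<le> 2 * ln (2 / \<gamma>)" using ga by (simp add: field_simps)
    finally show ?thesis by simp
  qed
  have l0: "0 \<le> 1 / ((b - a) * B) / 2" using ab B_nonneg by simp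
  have f0: "1 / (b - a) > 0" using ab by simp
  have t: "1 / ((b - a) * B) / 2 \<le> Tadj_norm_2inf a b f / 2 + sqrt \<alpha>" using Tadj_norm_ge[OF bdd] al by (simp add: add_increasing2)
  have "(1 - \<gamma>) / (2 * (b - a)) = (1 - \<gamma>) / 2 * (1 / (b - a))" by simp
  also have "\<dots> \<le> 3 * (1 / (b - a))" using ga f0 by (intro mult_right_mono) auto
  also have "\<dots> \<le> 3 * (SUP x. \<bar>f x\<bar>)" using f_sup_ge by simp
  finally have f3: "(1 - \<gamma>) / (2 * (b - a)) \<le> 3 * (SUP x. \<bar>f x\<bar>)" .
  have "(1 - \<gamma>) / (2 * (b - a)) * (1 / ((b - a) * B) / 2) * 1 \<le> 3 * (SUP x. \<bar>f x\<bar>) * (Tadj_norm_2inf a b f / 2 + sqrt \<alpha>) * sqrt (2 * ln (2 / \<gamma>))"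
  proof (intro mult_mono f3 t l1)
    show "0 \<le> 3 * (SUP x. \<bar>f x\<bar>)" using f_sup_ge f0 by linarith
    then show "0 \<le> 3 * (SUP x. \<bar>f x\<bar>) * (Tadj_norm_2inf a b f / 2 + sqrt \<alpha>)" using t l0 by (intro mult_nonneg_nonneg) linarith+
  qed (use l0 in auto)
  then have "(1 - \<gamma>) / (2 * (b - a)) * (1 / ((b - a) * B) / 2) / (\<alpha> powr (3/2) * sqrt (real n)) \<le>
      3 * (SUP x. \<bar>f x\<bar>) * (Tadj_norm_2inf a b f / 2 + sqrt \<alpha>) * sqrt (2 * ln (2 / \<gamma>)) / (\<alpha> powr (3/2) * sqrt (real n))"
    by (intro divide_right_mono) auto
  then show ?thesis unfolding q_ci_def using supnorm_nu_nonneg[OF al, of n y v] by linarith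
qed

end

section \<open>Uniform asymptotics over the class\<close>

text \<open>Extracts a spectral system together with a source element expanded in it; outside [a,b]
  the bound on \<open>f\<close> comes from its vanishing there.\<close>

lemma in_class_decon:
  assumes "a < b" "0 < s" "s \<le> 1" and c: "in_class a b M s \<beta> C \<phi> f"
  obtains lam e \<psi> where "decon a b M f lam e s \<phi>" "L2fun a b \<psi>" "L2norm a b \<psi> \<le> C"
    "(\<lambda>N. L2norm a b (\<lambda>z. \<phi> z - (\<Sum>j<N. lam j powr \<beta> * L2inner a b (Tadj a b f \<psi>) (e j) * e j z))) \<longlonglongrightarrow> 0"
    "bdd_above ((\<lambda>\<psi>. supnorm a b (Tadj a b f \<psi>)) ` {\<psi>. L2fun a b \<psi> \<and> L2norm a b \<psi> \<le> 1})"
proof -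
  from c obtain \<psi> where psi: "L2fun a b \<psi>" "L2norm a b \<psi> \<le> C" "source_condition a b f \<beta> \<phi> \<psi>"
    unfolding in_class_def by blast
  from psi(3) obtain lam e where le: "spectral_system a b f lam e"
    "(\<lambda>N. L2norm a b (\<lambda>z. \<phi> z - (\<Sum>j<N. lam j powr \<beta> * L2inner a b (Tadj a b f \<psi>) (e j) * e j z))) \<longlonglongrightarrow> 0"
    unfolding source_condition_def by blast
  have fb: "\<bar>f x\<bar> \<le> M" for x
  proof (cases "x \<in> {a..b}")
    case True then show ?thesis using c unfolding in_class_def by blast
  next
    case False
    have "\<bar>f a\<bar> \<le> M" using c assms(1) unfolding in_class_def by (meson atLeastAtMost_iff less_imp_le order_refl)
    moreover have "f x = 0" using c False unfolding in_class_def by blast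
    ultimately show ?thesis by simp
  qed
  have "decon a b M f lam e s \<phi>"
  proof unfold_locales
    show "spectral_system a b f lam e" by (rule le)
    show "\<bar>f x\<bar> \<le> M" for x by (rule fb)
  qed (use c assms(1,2,3) in \<open>auto simp: in_class_def\<close>)
  moreover have "bdd_above ((\<lambda>\<psi>. supnorm a b (Tadj a b f \<psi>)) ` {\<psi>. L2fun a b \<psi> \<and> L2norm a b \<psi> \<le> 1})"
    using c unfolding in_class_def by (elim conjE)
  ultimately show ?thesis using that psi le by blast
qed

text \<open>Since 3/2 + m \<le> 5/2, eventually \<alpha>^(5/2) sqrt n \<le> 1; take the power
  1/5.\<close>

lemma alpha_rate:
  fixes \<alpha> :: "nat \<Rightarrow> real"
  assumes pos: "\<And>n. \<alpha> n > 0" and z: "\<alpha> \<longlonglongrightarrow> 0" and m: "0 \<le> m" "m \<le> 1"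
    and r: "(\<lambda>n. \<alpha> n powr (3/2 + m) * sqrt (real n)) \<longlonglongrightarrow> 0"
  shows "eventually (\<lambda>n. real n powr (1/10) \<le> \<alpha> n powr (-1/2)) sequentially"
proof -
  have "eventually (\<lambda>n. \<alpha> n powr (3/2 + m) * sqrt (real n) < 1) sequentially" using r by (rule order_tendstoD) simp
  moreover have "eventually (\<lambda>n. \<alpha> n < 1) sequentially" using z by (rule order_tendstoD) simp
  ultimately show ?thesis using eventually_gt_at_top[of 0]
  proof eventually_elim
    case (elim n)
    have a: "\<alpha> n > 0" by (rule pos)
    have "\<alpha> n powr (5/2) \<le> \<alpha> n powr (3/2 + m)" using elim a m by (intro powr_mono') auto
    then have "\<alpha> n powr (5/2) * sqrt (real n) \<le> \<alpha> n powr (3/2 + m) * sqrt (real n)" by (intro mult_right_mono) auto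
    then have "\<alpha> n powr (5/2) * sqrt (real n) \<le> 1" using elim by linarith
    then have "sqrt (real n) \<le> \<alpha> n powr (-5/2)" using a by (simp add: powr_minus field_simps)
    then have "(sqrt (real n)) powr (1/5) \<le> (\<alpha> n powr (-5/2)) powr (1/5)" by (intro powr_mono2) auto
    moreover have "(sqrt (real n)) powr (1/5) = real n powr (1/10)" using elim by (simp add: powr_half_sqrt[symmetric] powr_powr)
    moreover have "(\<alpha> n powr (-5/2)) powr (1/5) = \<alpha> n powr (-1/2)" by (simp add: powr_powr)
    ultimately show ?case by simp
  qed
qed

lemma grid_term_tendsto:
  fixes p c :: real
  assumes "p > 0" "c > 0"
  shows "(\<lambda>n::nat. (real n powr p + 1) * (2 * exp (- c * real n powr (1/10)) + 2 * exp (- 2 * real n powr (1/10)))) \<longlonglongrightarrow> 0"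
proof (rule tendsto_sandwich[OF _ _ tendsto_const])
  \<comment> \<open>A common exponent for both exponentials.\<close>
  define d where "d = min c 2"
  have d: "d > 0" "d \<le> c" "d \<le> 2" using assms by (auto simp: d_def)
  \<comment> \<open>In the variable n^(1/10) the factor n^p is a power with exponent 10 p, rounded
    up to an integer.\<close>
  define k where "k = nat \<lceil>10 * p\<rceil>"
  define y where "y n = d * real n powr (1/10)" for n :: nat
  have "filterlim y at_top sequentially" unfolding y_def using d(1) by real_asymp
  then have lim: "(\<lambda>n. y n ^ j / exp (y n)) \<longlonglongrightarrow> 0" for j
    by (rule filterlim_compose[OF tendsto_power_div_exp_0])
  have "(\<lambda>n. 4 / d ^ k * (y n ^ k / exp (y n)) + 4 * (y n ^ 0 / exp (y n))) \<longlonglongrightarrow> 4 / d ^ k * 0 + 4 * 0"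
    by (intro tendsto_add tendsto_mult tendsto_const lim)
  then show "(\<lambda>n. 4 / d ^ k * (y n ^ k / exp (y n)) + 4 * (y n ^ 0 / exp (y n))) \<longlonglongrightarrow> 0" by simp
  show "\<forall>\<^sub>F n in sequentially. 0 \<le> (real n powr p + 1) * (2 * exp (- c * real n powr (1/10)) + 2 * exp (- 2 * real n powr (1/10)))"
    by (intro always_eventually allI mult_nonneg_nonneg add_nonneg_nonneg) auto
  show "\<forall>\<^sub>F n in sequentially. (real n powr p + 1) * (2 * exp (- c * real n powr (1/10)) + 2 * exp (- 2 * real n powr (1/10)))
      \<le> 4 / d ^ k * (y n ^ k / exp (y n)) + 4 * (y n ^ 0 / exp (y n))"
    using eventually_gt_at_top[of 0]
  proof eventually_elim
    case (elim n)
    define x where "x = real n powr (1/10)"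
    have x1: "x \<ge> 1" unfolding x_def using elim by (intro ge_one_powr_ge_zero) auto
    have "real n powr p = x powr (10 * p)" unfolding x_def by (simp add: powr_powr)
    also have "\<dots> \<le> x powr (real k)" using x1 unfolding k_def by (intro powr_mono real_nat_ceiling_ge) auto
    also have "\<dots> = x ^ k" using x1 by (intro powr_realpow) auto
    finally have np: "real n powr p \<le> x ^ k" .
    have "2 * exp (- c * x) + 2 * exp (- 2 * x) \<le> 2 * exp (- (d * x)) + 2 * exp (- (d * x))"
      using d x1 by (intro add_mono mult_left_mono) auto
    also have "\<dots> = 4 / exp (d * x)" by (simp add: exp_minus divide_inverse)
    finally have "(real n powr p + 1) * (2 * exp (- c * x) + 2 * exp (- 2 * x)) \<le> (x ^ k + 1) * (4 / exp (d * x))"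
      using np x1 by (intro mult_mono add_mono) auto
    also have "\<dots> = 4 / d ^ k * ((d * x) ^ k / exp (d * x)) + 4 * ((d * x) ^ 0 / exp (d * x))"
      using d(1) by (simp add: power_mult_distrib field_simps)
    finally show ?case by (simp only: y_def x_def)
  qed
qed

text \<open>The pairs are quantified inside \<open>eventually\<close>, so the constants may depend
  on a, b, M, s, \<beta>, C, \<kappa>, \<eta> only. The resolution N is fixed first; the other
  parameters vary with n. A quarter of \<kappa> is allotted to the bias, a quarter to the supremum
  of the empirical process, a quarter to weight and residual; each failure probability gets a third
  of \<eta>.\<close>

lemma uniform_estimation:
  fixes \<alpha> :: "nat \<Rightarrow> real"
  assumes ab: "a < b" and s: "0 < s" "s \<le> 1" and be: "0 \<le> \<beta>"
    and pos: "\<And>n. \<alpha> n > 0" and z: "\<alpha> \<longlonglongrightarrow> 0"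
    and rate: "(\<lambda>n. \<alpha> n powr (3/2 + min \<beta> 1) * sqrt (real n)) \<longlonglongrightarrow> 0"
    and ka: "\<kappa> > 0" and eta: "\<eta> > 0" and M: "M > 0"
  shows "eventually (\<lambda>n. \<forall>f \<phi> lam e \<psi>. decon a b M f lam e s \<phi> \<longrightarrow> L2fun a b \<psi> \<longrightarrow> L2norm a b \<psi> \<le> C \<longrightarrow>
      (\<lambda>N. L2norm a b (\<lambda>z. \<phi> z - (\<Sum>j<N. lam j powr \<beta> * L2inner a b (Tadj a b f \<psi>) (e j) * e j z))) \<longlonglongrightarrow> 0 \<longrightarrow>
      measure (\<Pi>\<^sub>M i\<in>{..<n}. Ymeasure a b f \<phi>) (decon.near a b f \<phi> (\<alpha> n) n (\<kappa> / (\<alpha> n powr (3/2) * sqrt (real n)))) \<ge> 1 - \<eta>) sequentially"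
proof -
  define B where "B = M * sqrt (b - a)"
  have B0: "B > 0" using M ab by (simp add: B_def)
  define cb where "cb = B * ((max 1 ((B * sqrt (b - a))\<^sup>2)) powr \<beta> * C)"
  define c2 where "c2 = 2 * M * (b - a) powr s + 8 * M\<^sup>2 * (b - a)"
  \<comment> \<open>The failure bound for the residual once \<open>\<tau>2\<close> is inserted: the
    last factor is 1 / (n \<tau>2^2), in which n cancels.\<close>
  define rem where "rem w = (b - a) * (M\<^sup>2 * (2 * (w powr s)\<^sup>2 + 8 * M * w)) * (16 * B\<^sup>2 / \<kappa>\<^sup>2)" for w :: real
  have remlim: "(\<lambda>N::nat. rem ((b - a) / real N)) \<longlonglongrightarrow> 0"
  proof -
    have w: "(\<lambda>N::nat. (b - a) / real N) \<longlonglongrightarrow> 0" by real_asymp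
    have ws: "(\<lambda>N::nat. ((b - a) / real N) powr s) \<longlonglongrightarrow> 0 powr s"
      using s ab by (intro tendsto_powr2 w tendsto_const) auto
    have "(\<lambda>N::nat. rem ((b - a) / real N)) \<longlonglongrightarrow> (b - a) * (M\<^sup>2 * (2 * (0 powr s)\<^sup>2 + 8 * M * 0)) * (16 * B\<^sup>2 / \<kappa>\<^sup>2)"
      unfolding rem_def by (intro tendsto_mult tendsto_add tendsto_power tendsto_const w ws)
    then show ?thesis by simp
  qed
  then have "eventually (\<lambda>N::nat. rem ((b - a) / real N) < \<eta> / 3) sequentially" using eta by (intro order_tendstoD(2)) auto
  then have "eventually (\<lambda>N::nat. rem ((b - a) / real N) < \<eta> / 3 \<and> N > 0) sequentially" using eventually_gt_at_top by (rule eventually_conj)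
  then obtain N :: nat where N: "rem ((b - a) / real N) < \<eta> / 3" "N > 0" by (auto simp: eventually_sequentially)
  have e1: "eventually (\<lambda>n. cb * (\<alpha> n powr (3/2 + min \<beta> 1) * sqrt (real n)) < \<kappa> / 4) sequentially"
    using ka by (intro order_tendstoD(2)[OF tendsto_mult_right_zero[OF rate]]) auto
  have e2: "eventually (\<lambda>n. (1 + M) * \<alpha> n powr (1/4) < \<kappa> / 8) sequentially"
  proof (rule order_tendstoD(2))
    have "(\<lambda>n. \<alpha> n powr (1/4)) \<longlonglongrightarrow> 0 powr (1/4)" using pos by (intro tendsto_powr2 z tendsto_const) (auto intro!: always_eventually less_imp_le)
    then show "(\<lambda>n. (1 + M) * \<alpha> n powr (1/4)) \<longlonglongrightarrow> 0" using tendsto_mult_right_zero by fastforce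
  qed (use ka in auto)
  have e3: "eventually (\<lambda>n. c2 * sqrt (\<alpha> n) < \<kappa> / 8) sequentially"
  proof (rule order_tendstoD(2))
    have "(\<lambda>n. sqrt (\<alpha> n)) \<longlonglongrightarrow> sqrt 0" by (intro tendsto_real_sqrt z)
    then show "(\<lambda>n. c2 * sqrt (\<alpha> n)) \<longlonglongrightarrow> 0" using tendsto_mult_right_zero by fastforce
  qed (use ka in auto)
  have e4: "eventually (\<lambda>n. (64 * B\<^sup>2 * real N / ((b - a) * \<kappa>\<^sup>2)) * \<alpha> n < \<eta> / 3) sequentially"
    using eta by (intro order_tendstoD(2)[OF tendsto_mult_right_zero[OF z]]) auto
  have e5: "eventually (\<lambda>n::nat. (real n powr (1 / (2 * s)) + 1) * (2 * exp (- (2 / M\<^sup>2) * real n powr (1/10)) + 2 * exp (- 2 * real n powr (1/10))) < \<eta> / 3) sequentially"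
    using eta s M by (intro order_tendstoD(2)[OF grid_term_tendsto]) auto
  have e6: "eventually (\<lambda>n. real n powr (1/10) \<le> \<alpha> n powr (-1/2)) sequentially"
    using alpha_rate[OF pos z _ _ rate] be by simp
  show ?thesis using e1 e2 e3 e4 e5 e6 eventually_gt_at_top[of 0]
  proof eventually_elim
    case (elim n)
    have n: "n > 0" using elim by simp
    define al where "al = \<alpha> n"
    have al: "al > 0" unfolding al_def by (rule pos)
    define sn where "sn = sqrt (real n)"
    have sn: "sn > 0" using n by (simp add: sn_def)
    define sa where "sa = sqrt al"
    have sa: "sa > 0" "sa * sa = al" using al by (auto simp: sa_def)
    have a32: "al powr (3/2) = al * sa"
    proof -
      have "al powr (3/2) = al powr (1 + 1/2)" by simp
      also have "\<dots> = al powr 1 * al powr (1/2)" by (rule powr_add)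
      finally show ?thesis using al by (simp add: sa_def powr_half_sqrt)
    qed
    define q where "q = \<kappa> / (al powr (3/2) * sn)"
    \<comment> \<open>Large enough that t^2 \<ge> n^(1/10), which beats the number of grid points,
      and small enough that t sqrt \<alpha> still tends to 0.\<close>
    define t where "t = al powr (-1/4)"
    have t2: "t\<^sup>2 = al powr (-1/2)" unfolding t_def by (simp add: power2_eq_square flip: powr_add)
    have tsa: "t * sa = al powr (1/4)"
    proof -
      have "t * sa = al powr (-1/4) * al powr (1/2)" using al by (simp add: t_def sa_def powr_half_sqrt)
      also have "\<dots> = al powr (1/4)" by (simp flip: powr_add)
      finally show ?thesis .
    qed
    \<comment> \<open>The grid is so fine that \<Delta>^s, and because of s \<le> 1 also \<Delta>,
      is at most of the order 1 / sqrt n.\<close>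
    define K where "K = nat \<lceil>real n powr (1 / (2 * s))\<rceil>"
    have np: "real n powr (1 / (2 * s)) \<ge> 1" using n s by (intro ge_one_powr_ge_zero) auto
    have K1: "real n powr (1 / (2 * s)) \<le> real K" "real K \<le> real n powr (1 / (2 * s)) + 1"
      unfolding K_def using np by (auto simp: real_nat_ceiling_ge)
    have K0: "K > 0" using K1 np by (cases K) auto
    define \<Delta> where "\<Delta> = (b - a) / real K"
    have D0: "\<Delta> > 0" using ab K0 by (simp add: \<Delta>_def)
    have Ds: "\<Delta> powr s \<le> (b - a) powr s / sn"
    proof -
      have "\<Delta> \<le> (b - a) / real n powr (1 / (2 * s))" unfolding \<Delta>_def using ab K1 np K0 n by (intro divide_left_mono mult_pos_pos) auto
      then have "\<Delta> powr s \<le> ((b - a) / real n powr (1 / (2 * s))) powr s" using D0 s by (intro powr_mono2) auto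
      also have "\<dots> = (b - a) powr s / (real n powr (1 / (2 * s))) powr s" using ab by (simp add: powr_divide)
      also have "(real n powr (1 / (2 * s))) powr s = sn" using s n by (simp add: powr_powr sn_def powr_half_sqrt)
      finally show ?thesis .
    qed
    have D1: "\<Delta> \<le> (b - a) / sn"
    proof -
      have "sn = real n powr (1/2)" using n by (simp add: sn_def powr_half_sqrt)
      also have "\<dots> \<le> real n powr (1 / (2 * s))" using n s by (intro powr_mono) (auto simp: field_simps)
      also have "\<dots> \<le> real K" by (rule K1)
      finally show ?thesis unfolding \<Delta>_def using ab sn by (intro divide_left_mono mult_pos_pos) auto
    qed
    \<comment> \<open>Weight and residual are each to contribute \<kappa> / 8 in units of 1 /
      (\<alpha>^(3/2) sqrt n). Because \<open>\<tau>1\<close> carries 1 / sqrt \<alpha>, the failure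
      bound for the weight is a multiple of \<alpha>.\<close>
    define \<tau>1 where "\<tau>1 = \<kappa> / (8 * B * (sa * sn))"
    define \<tau>2 where "\<tau>2 = \<kappa> / (4 * B * sn)"
    have tau: "\<tau>1 > 0" "\<tau>2 > 0" using ka B0 sa sn by (auto simp: \<tau>1_def \<tau>2_def)
    have bias: "B * (al powr (min \<beta> 1) * (max 1 ((B * sqrt (b - a))\<^sup>2)) powr \<beta> * C) \<le> (\<kappa> / 4) / (al * sa * sn)"
    proof -
      have "B * (al powr (min \<beta> 1) * (max 1 ((B * sqrt (b - a))\<^sup>2)) powr \<beta> * C) * (al * sa * sn) = cb * (al powr (3/2 + min \<beta> 1) * sn)"
        unfolding cb_def powr_add a32 by (simp add: algebra_simps)
      also have "\<dots> \<le> \<kappa> / 4" using elim(1) unfolding al_def sn_def by simp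
      finally show ?thesis using al sa sn by (simp add: pos_le_divide_eq)
    qed
    have n1: "(1 + M) * (t / sn) / al \<le> (\<kappa> / 8) / (al * sa * sn)"
    proof -
      have "(1 + M) * (t / sn) / al = ((1 + M) * (t * sa)) / (al * sa * sn)" using sa(1) by simp
      also have "\<dots> \<le> (\<kappa> / 8) / (al * sa * sn)" unfolding tsa using elim(2) al sa sn by (intro divide_right_mono) (auto simp: al_def)
      finally show ?thesis .
    qed
    have n2: "(2 * M * \<Delta> powr s + 8 * M\<^sup>2 * \<Delta>) / al \<le> (\<kappa> / 8) / (al * sa * sn)"
    proof -
      have "2 * M * \<Delta> powr s + 8 * M\<^sup>2 * \<Delta> \<le> 2 * M * ((b - a) powr s / sn) + 8 * M\<^sup>2 * ((b - a) / sn)"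
        using Ds D1 M by (intro add_mono mult_left_mono) auto
      also have "\<dots> = c2 / sn" by (simp add: c2_def add_divide_distrib)
      finally have "(2 * M * \<Delta> powr s + 8 * M\<^sup>2 * \<Delta>) / al \<le> c2 / sn / al" using al by (intro divide_right_mono) auto
      also have "\<dots> = (c2 * sa) / (al * sa * sn)" using sa(1) by simp
      also have "\<dots> \<le> (\<kappa> / 8) / (al * sa * sn)" using elim(3) al sa sn by (intro divide_right_mono) (auto simp: al_def sa_def)
      finally show ?thesis .
    qed
    have n3: "B * (\<tau>1 + \<tau>2 / (2 * sqrt al)) / al = (\<kappa> / 4) / (al * sa * sn)"
      using B0 sa(1) sn al unfolding \<tau>1_def \<tau>2_def sa_def[symmetric] by (simp add: field_simps)
    have qle: "B * (al powr (min \<beta> 1) * (max 1 ((B * sqrt (b - a))\<^sup>2)) powr \<beta> * C) +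
      ((1 + M) * (t / sqrt (real n)) + 2 * M * ((b - a) / real K) powr s + 8 * M\<^sup>2 * ((b - a) / real K)
        + B * (\<tau>1 + \<tau>2 / (2 * sqrt al))) / al \<le> q"
    proof -
      have "((1 + M) * (t / sn) + 2 * M * \<Delta> powr s + 8 * M\<^sup>2 * \<Delta> + B * (\<tau>1 + \<tau>2 / (2 * sqrt al))) / al
          = (1 + M) * (t / sn) / al + (2 * M * \<Delta> powr s + 8 * M\<^sup>2 * \<Delta>) / al + B * (\<tau>1 + \<tau>2 / (2 * sqrt al)) / al"
        by (simp add: add_divide_distrib)
      also have "\<dots> \<le> (\<kappa> / 8) / (al * sa * sn) + (\<kappa> / 8) / (al * sa * sn) + (\<kappa> / 4) / (al * sa * sn)"
        using n1 n2 n3 by linarith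
      finally have "B * (al powr (min \<beta> 1) * (max 1 ((B * sqrt (b - a))\<^sup>2)) powr \<beta> * C) +
        ((1 + M) * (t / sn) + 2 * M * \<Delta> powr s + 8 * M\<^sup>2 * \<Delta> + B * (\<tau>1 + \<tau>2 / (2 * sqrt al))) / al
         \<le> (\<kappa> / 4) / (al * sa * sn) + ((\<kappa> / 8) / (al * sa * sn) + (\<kappa> / 8) / (al * sa * sn) + (\<kappa> / 4) / (al * sa * sn))"
        using bias by linarith
      also have "\<dots> = (3 * \<kappa> / 4) / (al * sa * sn)" by (simp add: add_divide_distrib[symmetric])
      also have "\<dots> \<le> q" unfolding q_def a32 using ka al sa sn by (intro divide_right_mono) auto
      finally show ?thesis unfolding \<Delta>_def sn_def .
    qed
    have p1: "real K * (2 * exp (- 2 * t\<^sup>2 / M\<^sup>2) + 2 * exp (- 2 * t\<^sup>2)) \<le> \<eta> / 3"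
    proof -
      have tn: "real n powr (1/10) \<le> t\<^sup>2" unfolding t2 al_def using elim(6) by simp
      have "- 2 * t\<^sup>2 / M\<^sup>2 = - (2 / M\<^sup>2) * t\<^sup>2" by simp
      also have "\<dots> \<le> - (2 / M\<^sup>2) * real n powr (1/10)" using tn M by (intro mult_left_mono_neg) auto
      finally have x1: "exp (- 2 * t\<^sup>2 / M\<^sup>2) \<le> exp (- (2 / M\<^sup>2) * real n powr (1/10))" by simp
      have x2: "exp (- 2 * t\<^sup>2) \<le> exp (- 2 * real n powr (1/10))" using tn by simp
      have "real K * (2 * exp (- 2 * t\<^sup>2 / M\<^sup>2) + 2 * exp (- 2 * t\<^sup>2)) \<le>
          (real n powr (1 / (2 * s)) + 1) * (2 * exp (- (2 / M\<^sup>2) * real n powr (1/10)) + 2 * exp (- 2 * real n powr (1/10)))"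
        using K1(2) x1 x2 np by (intro mult_mono add_mono) auto
      then show ?thesis using elim(5) by linarith
    qed
    have p2: "real N / ((b - a) * real n * \<tau>1\<^sup>2) \<le> \<eta> / 3"
    proof -
      have "sn\<^sup>2 = real n" "sa\<^sup>2 = al" using al by (auto simp: sn_def sa_def)
      then have "\<tau>1\<^sup>2 = \<kappa>\<^sup>2 / (64 * B\<^sup>2 * (al * real n))"
        unfolding \<tau>1_def by (simp add: power_divide power_mult_distrib)
      then have "(b - a) * real n * \<tau>1\<^sup>2 = (b - a) * \<kappa>\<^sup>2 / (64 * B\<^sup>2 * al)" using n by simp
      then have "real N / ((b - a) * real n * \<tau>1\<^sup>2) = (64 * B\<^sup>2 * real N / ((b - a) * \<kappa>\<^sup>2)) * al" by simp
      then show ?thesis using elim(4) by (simp add: al_def)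
    qed
    have p3: "(b - a) * (M\<^sup>2 * (2 * (((b - a) / real N) powr s)\<^sup>2 + 8 * M * ((b - a) / real N))) / (real n * \<tau>2\<^sup>2) \<le> \<eta> / 3"
    proof -
      have "sn\<^sup>2 = real n" by (simp add: sn_def)
      then have "\<tau>2\<^sup>2 = \<kappa>\<^sup>2 / (16 * B\<^sup>2 * real n)"
        unfolding \<tau>2_def by (simp add: power_divide power_mult_distrib)
      then have "real n * \<tau>2\<^sup>2 = \<kappa>\<^sup>2 / (16 * B\<^sup>2)" using n by simp
      then have "(b - a) * (M\<^sup>2 * (2 * (((b - a) / real N) powr s)\<^sup>2 + 8 * M * ((b - a) / real N))) / (real n * \<tau>2\<^sup>2) = rem ((b - a) / real N)"
        by (simp add: rem_def)
      then show ?thesis using N(1) by simp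
    qed
    show ?case
    proof (intro allI impI)
      fix f \<phi> :: "real \<Rightarrow> real" and lam e \<psi>
      assume d: "decon a b M f lam e s \<phi>" and psi: "L2fun a b \<psi>" "L2norm a b \<psi> \<le> C"
        and conv: "(\<lambda>N. L2norm a b (\<lambda>z. \<phi> z - (\<Sum>j<N. lam j powr \<beta> * L2inner a b (Tadj a b f \<psi>) (e j) * e j z))) \<longlonglongrightarrow> 0"
      \<comment> \<open>Keeps the local definition of \<open>B\<close> accessible before the
        interpretation brings in the constant of the same name.\<close>
      note Bd = B_def
      interpret decon a b M f lam e s \<phi> by (rule d)
      have t0: "t \<ge> 0" by (simp add: t_def)
      have "1 - \<eta> \<le> 1 - (real K * (2 * exp (- 2 * t\<^sup>2 / M\<^sup>2) + 2 * exp (- 2 * t\<^sup>2))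
         + real N / ((b - a) * real n * \<tau>1\<^sup>2)
         + (b - a) * (M\<^sup>2 * (2 * (((b - a) / real N) powr s)\<^sup>2 + 8 * M * ((b - a) / real N))) / (real n * \<tau>2\<^sup>2))"
        using p1 p2 p3 by linarith
      also have "\<dots> \<le> measure (Y.S n) {\<omega> \<in> space (Y.S n). \<forall>z\<in>{a..b}.
          \<bar>resolvent a b f al (\<lambda>z. (\<Sum>i<n. f (\<omega> i - z)) / real n) z - \<phi> z\<bar> \<le> q}"
        by (rule estimation_error_bound[unfolded B_def, OF al n K0 N(2) t0 tau be psi conv qle[unfolded Bd]])
      also have "\<dots> = measure (Y.S n) (near (\<alpha> n) n (\<kappa> / (\<alpha> n powr (3/2) * sqrt (real n))))"
        by (simp add: near_def phihat_def q_def al_def sn_def)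
      finally show "1 - \<eta> \<le> measure (Y.S n) (near (\<alpha> n) n (\<kappa> / (\<alpha> n powr (3/2) * sqrt (real n))))" .
    qed
  qed
qed

text \<open>The sequence is the largest deficit over the index set, so it works for every n and not
  just eventually. Including 0 keeps it nonnegative and covers an empty index set; \<open>c0\<close>
  bounds the deficits by 1.\<close>

lemma uniform_rate:
  fixes c :: "nat \<Rightarrow> 'i \<Rightarrow> real"
  assumes lim: "\<And>\<epsilon>. \<epsilon> > 0 \<Longrightarrow> eventually (\<lambda>n. \<forall>x\<in>S. c n x \<ge> 1 - \<epsilon>) sequentially" and c0: "\<And>n x. c n x \<ge> 0"
  shows "\<exists>\<delta>. \<delta> \<longlonglongrightarrow> 0 \<and> (\<forall>n. \<delta> n \<ge> 0) \<and> (\<forall>n. \<forall>x\<in>S. c n x \<ge> 1 - \<delta> n)"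
proof -
  define \<delta> where "\<delta> n = Sup (insert 0 ((\<lambda>x. 1 - c n x) ` S))" for n
  have bdd: "bdd_above (insert 0 ((\<lambda>x. 1 - c n x) ` S))" for n
    using c0 by (intro bdd_aboveI[where M=1]) auto
  have d0: "\<delta> n \<ge> 0" for n unfolding \<delta>_def by (rule cSup_upper[OF _ bdd]) simp
  have dx: "1 - c n x \<le> \<delta> n" if "x \<in> S" for n x unfolding \<delta>_def by (rule cSup_upper[OF _ bdd]) (use that in auto)
  have "\<delta> \<longlonglongrightarrow> 0"
  proof (rule order_tendstoI)
    fix y :: real assume "y < 0"
    then show "eventually (\<lambda>n. y < \<delta> n) sequentially" using d0 by (auto intro!: always_eventually elim: order_less_le_trans)
  next
    fix y :: real assume y: "0 < y"
    show "eventually (\<lambda>n. \<delta> n < y) sequentially"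
    proof (rule eventually_mono[OF lim[of "y / 2"]])
      fix n assume n: "\<forall>x\<in>S. c n x \<ge> 1 - y / 2"
      have "\<delta> n \<le> y / 2" unfolding \<delta>_def
      proof (rule cSup_least)
        fix u assume "u \<in> insert 0 ((\<lambda>x. 1 - c n x) ` S)"
        then show "u \<le> y / 2" using n y by fastforce
      qed simp
      then show "\<delta> n < y" using y by linarith
    qed (use y in simp)
  qed
  moreover have "\<forall>n. \<forall>x\<in>S. c n x \<ge> 1 - \<delta> n" using dx by (simp add: algebra_simps)
  ultimately show ?thesis using d0 by blast
qed

lemma band_coverage:
  fixes \<alpha> :: "nat \<Rightarrow> real"
  assumes ab: "a < b" and s: "0 < s" "s \<le> 1" and be: "0 \<le> \<beta>"
    and pos: "\<And>n. \<alpha> n > 0" and z: "\<alpha> \<longlonglongrightarrow> 0"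
    and rate: "(\<lambda>n. \<alpha> n powr (3/2 + min \<beta> 1) * sqrt (real n)) \<longlonglongrightarrow> 0"
    and ga: "0 < \<gamma>" "\<gamma> < 1" and eta: "\<eta> > 0"
  shows "eventually (\<lambda>n. \<forall>(\<phi>, f)\<in>{(\<phi>, f). in_class a b M s \<beta> C \<phi> f}.
    coverage_ci a b f \<phi> (\<alpha> n) \<gamma> n \<ge> 1 - \<eta> \<and> coverage_g a b f \<phi> (\<alpha> n) \<gamma> n \<ge> 1 - \<eta>) sequentially"
proof (cases "M > 0")
  \<comment> \<open>A density of mass 1 cannot be bounded by M \<le> 0, so the class is
    empty.\<close>
  case False
  have "\<not> in_class a b M s \<beta> C \<phi> f" for \<phi> f
  proof
    assume "in_class a b M s \<beta> C \<phi> f"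
    then obtain lam e where "decon a b M f lam e s \<phi>" using in_class_decon[OF ab s] by metis
    then show False using decon.M_pos False by blast
  qed
  then show ?thesis by simp
next
  case True
  \<comment> \<open>The common constant of \<open>q_g_ge\<close> and \<open>q_ci_ge\<close>, with
    \<open>B\<close> unfolded.\<close>
  define \<kappa> where "\<kappa> = (1 - \<gamma>) / (2 * (b - a)) * (1 / ((b - a) * (M * sqrt (b - a))) / 2)"
  have ka: "\<kappa> > 0" unfolding \<kappa>_def using ga ab True by simp
  show ?thesis using uniform_estimation[OF ab s be pos z rate ka eta True, of C]
  proof eventually_elim
    case (elim n)
    show ?case
    proof (intro ballI, clarify)
      fix \<phi> f assume c: "in_class a b M s \<beta> C \<phi> f"
      obtain lam e \<psi> where d: "decon a b M f lam e s \<phi>" and psi: "L2fun a b \<psi>" "L2norm a b \<psi> \<le> C"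
        and conv: "(\<lambda>N. L2norm a b (\<lambda>z. \<phi> z - (\<Sum>j<N. lam j powr \<beta> * L2inner a b (Tadj a b f \<psi>) (e j) * e j z))) \<longlonglongrightarrow> 0"
        and bdd: "bdd_above ((\<lambda>\<psi>. supnorm a b (Tadj a b f \<psi>)) ` {\<psi>. L2fun a b \<psi> \<and> L2norm a b \<psi> \<le> 1})"
        by (rule in_class_decon[OF ab s c])
      interpret decon a b M f lam e s \<phi> by (rule d)
      have "1 - \<eta> \<le> measure (Y.S n) (near (\<alpha> n) n (\<kappa> / (\<alpha> n powr (3/2) * sqrt (real n))))"
        using elim d psi conv by blast
      moreover have "\<kappa> / (\<alpha> n powr (3/2) * sqrt (real n)) \<le> q_ci a b f (\<alpha> n) \<gamma> n y v" for y v
        using q_ci_ge[OF pos ga bdd] by (simp only: \<kappa>_def B_def)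
      moreover have "\<kappa> / (\<alpha> n powr (3/2) * sqrt (real n)) \<le> q_g a b f \<phi> (\<alpha> n) \<gamma> n"
        using q_g_ge[OF pos ga bdd] by (simp only: \<kappa>_def B_def)
      ultimately show "1 - \<eta> \<le> coverage_ci a b f \<phi> (\<alpha> n) \<gamma> n \<and> 1 - \<eta> \<le> coverage_g a b f \<phi> (\<alpha> n) \<gamma> n"
        using coverage_ci_ge[OF pos] coverage_g_ge[OF pos] order_trans by meson
    qed
  qed
qed

theorem theorem8:
  fixes a b M s \<beta> C \<gamma> :: real and \<alpha> :: "nat \<Rightarrow> real"
  assumes "a < b"
    and "0 < s" and "s \<le> 1"
    and "0 \<le> \<beta>"
    and "\<forall>n. \<alpha> n > 0" and "\<alpha> \<longlonglongrightarrow> 0"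
    and "(\<lambda>n. \<alpha> n powr (3/2 + min \<beta> 1) * sqrt (real n)) \<longlonglongrightarrow> 0"
    and "0 < \<gamma>" and "\<gamma> < 1"
  shows "(\<exists>\<delta>::nat \<Rightarrow> real. \<delta> \<longlonglongrightarrow> 0 \<and>
            (\<forall>n \<phi> f. in_class a b M s \<beta> C \<phi> f \<longrightarrow>
               coverage_ci a b f \<phi> (\<alpha> n) \<gamma> n \<ge> 1 - \<gamma> - \<delta> n))
       \<and> (\<exists>(K::real) (\<delta>::nat \<Rightarrow> real). \<delta> \<longlonglongrightarrow> 0 \<and>
            (\<forall>n \<phi> f. in_class a b M s \<beta> C \<phi> f \<longrightarrow>
               coverage_g a b f \<phi> (\<alpha> n) \<gamma> n \<ge> 1 - \<gamma> - K * real n powr (-1/6) - \<delta> n))"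
proof -
  let ?S = "{(\<phi>, f). in_class a b M s \<beta> C \<phi> f}"
  note ev = band_coverage[OF assms(1-4) assms(5)[rule_format] assms(6-9)]
  have ci: "eventually (\<lambda>n. \<forall>x\<in>?S. coverage_ci a b (snd x) (fst x) (\<alpha> n) \<gamma> n \<ge> 1 - \<epsilon>) sequentially"
    and g: "eventually (\<lambda>n. \<forall>x\<in>?S. coverage_g a b (snd x) (fst x) (\<alpha> n) \<gamma> n \<ge> 1 - \<epsilon>) sequentially" if "\<epsilon> > 0" for \<epsilon>
    using ev[OF that, of M C] by (auto elim: eventually_mono)
  obtain \<delta>1 where d1: "\<delta>1 \<longlonglongrightarrow> 0" "\<And>n x. x \<in> ?S \<Longrightarrow> coverage_ci a b (snd x) (fst x) (\<alpha> n) \<gamma> n \<ge> 1 - \<delta>1 n"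
    using uniform_rate[where c="\<lambda>n x. coverage_ci a b (snd x) (fst x) (\<alpha> n) \<gamma> n", OF ci] by (auto simp: coverage_ci_def)
  obtain \<delta>2 where d2: "\<delta>2 \<longlonglongrightarrow> 0" "\<And>n x. x \<in> ?S \<Longrightarrow> coverage_g a b (snd x) (fst x) (\<alpha> n) \<gamma> n \<ge> 1 - \<delta>2 n"
    using uniform_rate[where c="\<lambda>n x. coverage_g a b (snd x) (fst x) (\<alpha> n) \<gamma> n", OF g] by (auto simp: coverage_g_def)
  have "\<forall>n \<phi> f. in_class a b M s \<beta> C \<phi> f \<longrightarrow> coverage_ci a b f \<phi> (\<alpha> n) \<gamma> n \<ge> 1 - \<gamma> - \<delta>1 n"
  proof (intro allI impI)
    fix n \<phi> f assume c: "in_class a b M s \<beta> C \<phi> f"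
    show "coverage_ci a b f \<phi> (\<alpha> n) \<gamma> n \<ge> 1 - \<gamma> - \<delta>1 n" using d1(2)[of "(\<phi>, f)" n] c assms(8) by simp
  qed
  \<comment> \<open>\<open>\<delta>2\<close> already covers the whole deficit, so the constant in
    front of n^(-1/6) is 0.\<close>
  moreover have "\<forall>n \<phi> f. in_class a b M s \<beta> C \<phi> f \<longrightarrow> coverage_g a b f \<phi> (\<alpha> n) \<gamma> n \<ge> 1 - \<gamma> - 0 * real n powr (-1/6) - \<delta>2 n"
  proof (intro allI impI)
    fix n \<phi> f assume c: "in_class a b M s \<beta> C \<phi> f"
    show "coverage_g a b f \<phi> (\<alpha> n) \<gamma> n \<ge> 1 - \<gamma> - 0 * real n powr (-1/6) - \<delta>2 n" using d2(2)[of "(\<phi>, f)" n] c assms(8) by simp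
  qed
  ultimately show ?thesis using d1(1) d2(1) by blast
qed

end
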